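(* Let $(M,g)$ be a Riemannian manifold with a smooth function $f$ such that $\mathrm{Ric}+\mathrm{Hess} f=0$. If the scalar curvature of $g$ achieves its minimum on $M$, then $g$ is Ricci flat. In particular, steady gradient solitons with constant scalar curvature are Ricci flat.
   Context: Manifolds are connected, without boundary, and all data are smooth. A steady gradient soliton is $(M,g,f)$ with $\mathrm{Ric}+\mathrm{Hess} f=0$. *)

theory Defs
  imports "HOL-Analysis.Analysis"
begin

section \<open>Smooth maps between Euclidean spaces\<close>

text \<open>Only meaningful (and only used) for open sets \<open>S\<close>.\<close>

primrec Ck_on :: "nat \<Rightarrow> 'a::euclidean_space set \<Rightarrow> ('a \<Rightarrow> 'b::euclidean_space) \<Rightarrow> bool" where
  "Ck_on 0 S f \<longleftrightarrow> continuous_on S f"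
| "Ck_on (Suc k) S f \<longleftrightarrow>
     (\<forall>x\<in>S. f differentiable (at x)) \<and> (\<forall>v. Ck_on k S (\<lambda>x. frechet_derivative f (at x) v))"

definition smooth_on :: "'a::euclidean_space set \<Rightarrow> ('a \<Rightarrow> 'b::euclidean_space) \<Rightarrow> bool" where
  "smooth_on S f \<longleftrightarrow> (\<forall>k. Ck_on k S f)"

definition partial_deriv :: "'n::finite \<Rightarrow> (real^'n \<Rightarrow> real) \<Rightarrow> real^'n \<Rightarrow> real" where
  "partial_deriv i u x = frechet_derivative u (at x) (axis i 1)"

section \<open>Smooth manifolds\<close>

text \<open>A chart is a pair of its domain and its coordinate map; the coordinate map is only relevant
  on the domain.  The dimension of the manifold is \<open>CARD('n)\<close>.\<close>

type_synonym ('m, 'n) chart = "'m set \<times> ('m \<Rightarrow> real^'n)"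

abbreviation chart_dom :: "('m, 'n) chart \<Rightarrow> 'm set" where
  "chart_dom c \<equiv> fst c"

abbreviation chart_map :: "('m, 'n) chart \<Rightarrow> 'm \<Rightarrow> real^'n" where
  "chart_map c \<equiv> snd c"

abbreviation chart_img :: "('m, 'n) chart \<Rightarrow> (real^'n) set" where
  "chart_img c \<equiv> chart_map c ` chart_dom c"

definition chart_inv :: "('m, 'n) chart \<Rightarrow> real^'n \<Rightarrow> 'm" where
  "chart_inv c = inv_into (chart_dom c) (chart_map c)"

definition is_chart :: "'m topology \<Rightarrow> ('m, 'n::finite) chart \<Rightarrow> bool" where
  "is_chart X c \<longleftrightarrow>
     openin X (chart_dom c) \<and> open (chart_img c) \<and>
     homeomorphic_map (subtopology X (chart_dom c)) (top_of_set (chart_img c)) (chart_map c)"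

text \<open>\<open>A\<close> is an arbitrary smooth atlas, not necessarily a maximal one.\<close>

definition smooth_manifold :: "'m topology \<Rightarrow> ('m, 'n::finite) chart set \<Rightarrow> bool" where
  "smooth_manifold X A \<longleftrightarrow>
     Hausdorff_space X \<and> second_countable X \<and>
     (\<forall>c\<in>A. is_chart X c) \<and> topspace X = (\<Union>c\<in>A. chart_dom c) \<and>
     (\<forall>c\<in>A. \<forall>d\<in>A.
        smooth_on (chart_map c ` (chart_dom c \<inter> chart_dom d)) (chart_map d \<circ> chart_inv c))"

definition smooth_function :: "('m, 'n::finite) chart set \<Rightarrow> ('m \<Rightarrow> real) \<Rightarrow> bool" where
  "smooth_function A h \<longleftrightarrow> (\<forall>c\<in>A. smooth_on (chart_img c) (h \<circ> chart_inv c))"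

definition smooth_near ::
    "'m topology \<Rightarrow> ('m, 'n::finite) chart set \<Rightarrow> 'm \<Rightarrow> ('m \<Rightarrow> real) \<Rightarrow> bool" where
  "smooth_near X A p h \<longleftrightarrow>
     (\<exists>U. openin X U \<and> p \<in> U \<and>
        (\<forall>c\<in>A. smooth_on (chart_map c ` (chart_dom c \<inter> U)) (h \<circ> chart_inv c)))"

section \<open>Tangent spaces and Riemannian metrics\<close>

text \<open>Tangent vectors at \<open>p\<close> are derivations on the functions that are smooth near \<open>p\<close>, extended by
  \<open>0\<close> to all other functions so that they are determined by their values on the former.  That they
  only depend on germs follows from the Leibniz rule: the indicator function of an open
  neighbourhood of \<open>p\<close> is smooth near \<open>p\<close>.\<close>

type_synonym 'm tangent = "('m \<Rightarrow> real) \<Rightarrow> real"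

definition tangent_space ::
    "'m topology \<Rightarrow> ('m, 'n::finite) chart set \<Rightarrow> 'm \<Rightarrow> 'm tangent set" where
  "tangent_space X A p =
     {v. (\<forall>h. \<not> smooth_near X A p h \<longrightarrow> v h = 0) \<and>
         (\<forall>h k a b. smooth_near X A p h \<longrightarrow> smooth_near X A p k \<longrightarrow>
            v (\<lambda>q. a * h q + b * k q) = a * v h + b * v k) \<and>
         (\<forall>h k. smooth_near X A p h \<longrightarrow> smooth_near X A p k \<longrightarrow>
            v (\<lambda>q. h q * k q) = v h * k p + h p * v k)}"

text \<open>The coordinate vector \<open>\<partial>/\<partial>x\<^sup>i\<close> at \<open>p\<close> of a chart \<open>c\<close> around \<open>p\<close>.\<close>

definition coord_vec ::
    "'m topology \<Rightarrow> ('m, 'n::finite) chart set \<Rightarrow> ('m, 'n) chart \<Rightarrow> 'm \<Rightarrow> 'n \<Rightarrow> 'm tangent" where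
  "coord_vec X A c p i =
     (\<lambda>h. if smooth_near X A p h then partial_deriv i (h \<circ> chart_inv c) (chart_map c p) else 0)"

definition inner_product_on :: "'m tangent set \<Rightarrow> ('m tangent \<Rightarrow> 'm tangent \<Rightarrow> real) \<Rightarrow> bool" where
  "inner_product_on V b \<longleftrightarrow>
     (\<forall>u\<in>V. \<forall>v\<in>V. b u v = b v u) \<and>
     (\<forall>u\<in>V. \<forall>v\<in>V. \<forall>w\<in>V. \<forall>r s. b (\<lambda>h. r * u h + s * v h) w = r * b u w + s * b v w) \<and>
     (\<forall>u\<in>V. u \<noteq> (\<lambda>h. 0) \<longrightarrow> b u u > 0)"

definition metric_coeff ::
    "'m topology \<Rightarrow> ('m, 'n::finite) chart set \<Rightarrow> ('m \<Rightarrow> 'm tangent \<Rightarrow> 'm tangent \<Rightarrow> real)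
       \<Rightarrow> ('m, 'n) chart \<Rightarrow> real^'n \<Rightarrow> real^'n^'n" where
  "metric_coeff X A g c x =
     (\<chi> i j. g (chart_inv c x) (coord_vec X A c (chart_inv c x) i)
                              (coord_vec X A c (chart_inv c x) j))"

definition riemannian_metric ::
    "'m topology \<Rightarrow> ('m, 'n::finite) chart set \<Rightarrow> ('m \<Rightarrow> 'm tangent \<Rightarrow> 'm tangent \<Rightarrow> real) \<Rightarrow> bool" where
  "riemannian_metric X A g \<longleftrightarrow>
     (\<forall>p\<in>topspace X. inner_product_on (tangent_space X A p) (g p)) \<and>
     (\<forall>c\<in>A. \<forall>i j. smooth_on (chart_img c) (\<lambda>x. metric_coeff X A g c x $ i $ j))"

section \<open>Levi-Civita connection and curvature in local coordinates\<close>

text \<open>Here \<open>G\<close> is the matrix field of a metric on an open subset of \<open>\<real>\<^sup>n\<close>.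
  The value \<open>christoffel G k i j\<close> is \<open>\<Gamma>\<^sup>k\<^sub>i\<^sub>j\<close>, that is, the Levi-Civita connection satisfies
  \<open>\<nabla>\<^sub>i \<partial>\<^sub>j = \<Sum>k. \<Gamma>\<^sup>k\<^sub>i\<^sub>j \<partial>\<^sub>k\<close>.\<close>

definition christoffel ::
    "(real^'n::finite \<Rightarrow> real^'n^'n) \<Rightarrow> 'n \<Rightarrow> 'n \<Rightarrow> 'n \<Rightarrow> real^'n \<Rightarrow> real" where
  "christoffel G k i j x =
     (1/2) * (\<Sum>l\<in>UNIV. matrix_inv (G x) $ k $ l *
        (partial_deriv i (\<lambda>y. G y $ j $ l) x + partial_deriv j (\<lambda>y. G y $ i $ l) x
           - partial_deriv l (\<lambda>y. G y $ i $ j) x))"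

text \<open>The \<open>l\<close>-component of \<open>R(\<partial>\<^sub>i,\<partial>\<^sub>j)\<partial>\<^sub>k\<close> with \<open>R(X,Y)Z = \<nabla>\<^sub>X\<nabla>\<^sub>YZ - \<nabla>\<^sub>Y\<nabla>\<^sub>XZ - \<nabla>\<^bsub>[X,Y]\<^esub>Z\<close>.\<close>

definition riemann_coeff ::
    "(real^'n::finite \<Rightarrow> real^'n^'n) \<Rightarrow> 'n \<Rightarrow> 'n \<Rightarrow> 'n \<Rightarrow> 'n \<Rightarrow> real^'n \<Rightarrow> real" where
  "riemann_coeff G l i j k x =
     partial_deriv i (christoffel G l j k) x - partial_deriv j (christoffel G l i k) x
     + (\<Sum>m\<in>UNIV. christoffel G l i m x * christoffel G m j k x
                 - christoffel G l j m x * christoffel G m i k x)"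

text \<open>\<open>Ric(Y,Z)\<close> is the trace of \<open>X \<mapsto> R(X,Y)Z\<close>, so round spheres have positive Ricci curvature.\<close>

definition ricci_coeff ::
    "(real^'n::finite \<Rightarrow> real^'n^'n) \<Rightarrow> 'n \<Rightarrow> 'n \<Rightarrow> real^'n \<Rightarrow> real" where
  "ricci_coeff G j k x = (\<Sum>i\<in>UNIV. riemann_coeff G i i j k x)"

definition scalar_coeff :: "(real^'n::finite \<Rightarrow> real^'n^'n) \<Rightarrow> real^'n \<Rightarrow> real" where
  "scalar_coeff G x =
     (\<Sum>j\<in>UNIV. \<Sum>k\<in>UNIV. matrix_inv (G x) $ j $ k * ricci_coeff G j k x)"

definition hessian_coeff ::
    "(real^'n::finite \<Rightarrow> real^'n^'n) \<Rightarrow> (real^'n \<Rightarrow> real) \<Rightarrow> 'n \<Rightarrow> 'n \<Rightarrow> real^'n \<Rightarrow> real" where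
  "hessian_coeff G u i j x =
     partial_deriv i (partial_deriv j u) x
     - (\<Sum>k\<in>UNIV. christoffel G k i j x * partial_deriv k u x)"

section \<open>Curvature of a Riemannian manifold\<close>

text \<open>An equation between tensor fields means equality of the components in every chart.\<close>

definition ricci_flat ::
    "'m topology \<Rightarrow> ('m, 'n::finite) chart set \<Rightarrow> ('m \<Rightarrow> 'm tangent \<Rightarrow> 'm tangent \<Rightarrow> real) \<Rightarrow> bool" where
  "ricci_flat X A g \<longleftrightarrow>
     (\<forall>c\<in>A. \<forall>x\<in>chart_img c. \<forall>i j. ricci_coeff (metric_coeff X A g c) i j x = 0)"

definition ricci_plus_hessian_zero ::
    "'m topology \<Rightarrow> ('m, 'n::finite) chart set \<Rightarrow> ('m \<Rightarrow> 'm tangent \<Rightarrow> 'm tangent \<Rightarrow> real)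
       \<Rightarrow> ('m \<Rightarrow> real) \<Rightarrow> bool" where
  "ricci_plus_hessian_zero X A g f \<longleftrightarrow>
     (\<forall>c\<in>A. \<forall>x\<in>chart_img c. \<forall>i j.
        ricci_coeff (metric_coeff X A g c) i j x
        + hessian_coeff (metric_coeff X A g c) (f \<circ> chart_inv c) i j x = 0)"

text \<open>Scalar curvature is invariant under coordinate changes, so the choice of the chart around \<open>p\<close>
  does not matter.\<close>

definition scalar_curvature ::
    "'m topology \<Rightarrow> ('m, 'n::finite) chart set \<Rightarrow> ('m \<Rightarrow> 'm tangent \<Rightarrow> 'm tangent \<Rightarrow> real)
       \<Rightarrow> 'm \<Rightarrow> real" where
  "scalar_curvature X A g p =
     (let c = (SOME c. c \<in> A \<and> p \<in> chart_dom c)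
      in scalar_coeff (metric_coeff X A g c) (chart_map c p))"

definition steady_gradient_soliton ::
    "'m topology \<Rightarrow> ('m, 'n::finite) chart set \<Rightarrow> ('m \<Rightarrow> 'm tangent \<Rightarrow> 'm tangent \<Rightarrow> real)
       \<Rightarrow> ('m \<Rightarrow> real) \<Rightarrow> bool" where
  "steady_gradient_soliton X A g f \<longleftrightarrow>
     smooth_manifold X A \<and> connected_space X \<and> riemannian_metric X A g \<and> smooth_function A f \<and>
     ricci_plus_hessian_zero X A g f"

end

theory Submission
  imports Defs
begin

text \<open>
  With \<open>Ric + Hess f = 0\<close>, tracing the commutator \<open>[\<nabla>\<^sub>i,\<nabla>\<^sub>j]\<nabla>f\<close> gives \<open>div Ric = dR - Ric(\<nabla>f)\<close>, while the
  contracted second Bianchi identity says \<open>div Ric = dR / 2\<close>.  Hence \<open>dR = 2 Ric(\<nabla>f)\<close>, and taking the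
  divergence once more yields \<open>\<Delta>R - \<langle>\<nabla>f,\<nabla>R\<rangle> = -2 \<bar>Ric\<bar>\<^sup>2 \<le> 0\<close>.  So \<open>R\<close> is a supersolution of a linear elliptic
  equation without zeroth order term; by Hopf's strong minimum principle the set where \<open>R\<close> attains its
  minimum is open, hence everything, and then \<open>\<bar>Ric\<bar>\<^sup>2 = 0\<close>.  The independence of \<open>R\<close> from the chart
  is only needed for solitons, where \<open>R = -\<Delta>f\<close>; this involves first derivatives of the metric only.
\<close>

section \<open>Calculus of smooth maps\<close>

text \<open>Inside a chart most indices are hidden in matrices: \<open>\<Gamma> i\<close> is the
  connection matrix in direction i, and curvature is the commutator of the matrix operators
  \<open>pd i + \<Gamma> i\<close>. The skewness of curvature and the second Bianchi identity then
  become short noncommutative identities that follow from commuting partial derivatives; indices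
  reappear only when traces are taken. Curvature carries one raised index, so that skewness with
  respect to the metric is plain skewness of a matrix and the contractions are plain sums without
  the metric. Positivity always enters through one factorization H = P P^T of a symmetric positive
  definite matrix. It turns the squared norm of Ric into a sum of squares, and it splits the
  second-order part of the operator at a minimum into second derivatives along the columns of P. The
  transformation law of the Christoffel symbols, on which the invariance of \<Delta>f rests, comes
  from the uniqueness of the torsion-free metric connection, which avoids transforming the formula
  that defines them.\<close>

lemma Ck_on_cong:
  assumes "open S" "\<And>x. x \<in> S \<Longrightarrow> f x = g x" "Ck_on k S f"
  shows "Ck_on k S g"
  using assms(2,3)
proof (induction k arbitrary: f g)
  case 0
  then show ?case using continuous_on_cong by fastforce
next
  case (Suc k)
  have d: "(g has_derivative frechet_derivative f (at x)) (at x)" if "x \<in> S" for x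
    by (rule has_derivative_transform_within_open[where f = f, OF _ assms(1) that])
      (use Suc.prems that in \<open>auto simp flip: frechet_derivative_works\<close>)
  then have e: "frechet_derivative g (at x) = frechet_derivative f (at x)" if "x \<in> S" for x
    using frechet_derivative_at that by metis
  have "Ck_on k S (\<lambda>x. frechet_derivative g (at x) v)" for v
    by (rule Suc.IH[of "\<lambda>x. frechet_derivative f (at x) v"]) (use Suc.prems e in auto)
  then show ?case using d by (auto simp: differentiable_def)
qed

lemma Ck_on_subset: "Ck_on k S f \<Longrightarrow> T \<subseteq> S \<Longrightarrow> Ck_on k T f"
  by (induction k arbitrary: f) (auto intro: continuous_on_subset)

lemma Ck_on_pred: "Ck_on (Suc k) S f \<Longrightarrow> Ck_on k S f"
proof (induction k arbitrary: f)
  case 0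
  then show ?case
    by (auto intro!: differentiable_imp_continuous_on simp: differentiable_on_def differentiable_at_withinI)
next
  case (Suc k)
  then show ?case unfolding Ck_on.simps(2)[of _ S f] by blast
qed

lemma Ck_on_const: "Ck_on k S (\<lambda>x. c)"
  by (induction k arbitrary: c) auto

lemma Ck_on_bounded_linear:
  assumes "open S" "bounded_linear L" "Ck_on k S f"
  shows "Ck_on k S (\<lambda>x. L (f x))"
  using assms(3)
proof (induction k arbitrary: f)
  case 0
  then show ?case using bounded_linear.continuous_on[OF assms(2)] by auto
next
  case (Suc k)
  have d: "((\<lambda>x. L (f x)) has_derivative (\<lambda>v. L (frechet_derivative f (at x) v))) (at x)"
    if "x \<in> S" for x
    by (rule bounded_linear.has_derivative[OF assms(2)])
      (use Suc.prems that in \<open>auto simp flip: frechet_derivative_works\<close>)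
  have "Ck_on k S (\<lambda>x. frechet_derivative (\<lambda>x. L (f x)) (at x) v)" for v
    by (rule Ck_on_cong[OF assms(1) _ Suc.IH[of "\<lambda>x. frechet_derivative f (at x) v"]])
      (use Suc.prems frechet_derivative_at[OF d] in \<open>auto dest: fun_cong\<close>)
  then show ?case using d by (auto simp: differentiable_def)
qed

lemma Ck_on_add:
  assumes "open S" "Ck_on k S f" "Ck_on k S g"
  shows "Ck_on k S (\<lambda>x. f x + g x)"
  using assms(2,3)
proof (induction k arbitrary: f g)
  case 0
  then show ?case by (auto intro: continuous_intros)
next
  case (Suc k)
  have d: "((\<lambda>x. f x + g x) has_derivative
      (\<lambda>v. frechet_derivative f (at x) v + frechet_derivative g (at x) v)) (at x)" if "x \<in> S" for x
    by (rule has_derivative_add) (use Suc.prems that in \<open>auto simp flip: frechet_derivative_works\<close>)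
  have "Ck_on k S (\<lambda>x. frechet_derivative (\<lambda>x. f x + g x) (at x) v)" for v
    by (rule Ck_on_cong[OF assms(1) _ Suc.IH[of "\<lambda>x. frechet_derivative f (at x) v"
        "\<lambda>x. frechet_derivative g (at x) v"]])
      (use Suc.prems frechet_derivative_at[OF d] in \<open>auto dest: fun_cong\<close>)
  then show ?case using d by (auto simp: differentiable_def)
qed

text \<open>The product rule gives two terms of the same shape, one order lower. Stated for any
  bounded bilinear map, it serves products of reals, scalings, inner products and matrix products
  alike.\<close>

lemma Ck_on_bilinear:
  assumes "open S" "bounded_bilinear B" "Ck_on k S f" "Ck_on k S g"
  shows "Ck_on k S (\<lambda>x. B (f x) (g x))"
  using assms(3,4)
proof (induction k arbitrary: f g)
  case 0
  then show ?case by (auto intro: bounded_bilinear.continuous_on[OF assms(2)])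
next
  case (Suc k)
  have d: "((\<lambda>x. B (f x) (g x)) has_derivative
      (\<lambda>v. B (f x) (frechet_derivative g (at x) v) + B (frechet_derivative f (at x) v) (g x))) (at x)"
    if "x \<in> S" for x
    by (rule bounded_bilinear.FDERIV[OF assms(2)])
      (use Suc.prems that in \<open>auto simp flip: frechet_derivative_works\<close>)
  have "Ck_on k S (\<lambda>x. frechet_derivative (\<lambda>x. B (f x) (g x)) (at x) v)" for v
  proof (rule Ck_on_cong[OF assms(1) _ Ck_on_add[OF assms(1)]])
    show "Ck_on k S (\<lambda>x. B (f x) (frechet_derivative g (at x) v))"
      "Ck_on k S (\<lambda>x. B (frechet_derivative f (at x) v) (g x))"
      by (rule Suc.IH; use Suc.prems Ck_on_pred in auto)+
  qed (use frechet_derivative_at[OF d] in \<open>auto dest: fun_cong\<close>)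
  then show ?case using d by (auto simp: differentiable_def)
qed

lemma Ck_on_sum:
  assumes "open S" "finite I" "\<And>i. i \<in> I \<Longrightarrow> Ck_on k S (f i)"
  shows "Ck_on k S (\<lambda>x. \<Sum>i\<in>I. f i x)"
  using assms(2,3) by (induction I) (auto intro: Ck_on_const Ck_on_add[OF assms(1)])

text \<open>The derivative of 1/f is -f'/f^2, and its factors 1/f are supplied by the induction
  hypothesis.\<close>

lemma Ck_on_inverse:
  fixes f :: "'a::euclidean_space \<Rightarrow> real"
  assumes "open S" "Ck_on k S f" "\<And>x. x \<in> S \<Longrightarrow> f x \<noteq> 0"
  shows "Ck_on k S (\<lambda>x. inverse (f x))"
  using assms(2)
proof (induction k)
  case 0
  then show ?case using assms(3) by (auto intro: continuous_intros)
next
  case (Suc k)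
  have d: "((\<lambda>x. inverse (f x)) has_derivative
      (\<lambda>v. - (inverse (f x) * frechet_derivative f (at x) v * inverse (f x)))) (at x)" if "x \<in> S" for x
    by (rule Deriv.has_derivative_inverse) (use Suc.prems that assms(3) in \<open>auto simp flip: frechet_derivative_works\<close>)
  have "Ck_on k S (\<lambda>x. frechet_derivative (\<lambda>x. inverse (f x)) (at x) v)" for v
  proof (rule Ck_on_cong[OF assms(1)])
    have i: "Ck_on k S (\<lambda>x. inverse (f x))" using Suc Ck_on_pred by blast
    show "Ck_on k S (\<lambda>x. - (inverse (f x) * frechet_derivative f (at x) v * inverse (f x)))"
      using Suc.prems i
      by (intro Ck_on_bounded_linear[OF assms(1), of uminus] bounded_linear_minus bounded_linear_ident
          Ck_on_bilinear[OF assms(1) bounded_bilinear_mult]) auto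
  qed (use frechet_derivative_at[OF d] in \<open>auto dest: fun_cong\<close>)
  then show ?case using d by (auto simp: differentiable_def)
qed

text \<open>In the chain rule the direction in which g is differentiated depends on x, whereas
  \<open>Ck_on\<close> speaks of fixed directions. Expanding that direction in \<open>Basis\<close>
  leaves derivatives of g in fixed directions, composed with f, to which the induction hypothesis
  applies.\<close>

lemma Ck_on_compose:
  assumes "open S" "open T" "f ` S \<subseteq> T" "Ck_on k S f" "Ck_on k T g"
  shows "Ck_on k S (\<lambda>x. g (f x))"
  using assms(4,5)
proof (induction k arbitrary: g)
  case 0
  then show ?case using assms(3) by (auto intro: continuous_on_compose2)
next
  case (Suc k)
  have d: "((\<lambda>x. g (f x)) has_derivative
      (\<lambda>v. frechet_derivative g (at (f x)) (frechet_derivative f (at x) v))) (at x)" if "x \<in> S" for x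
    by (rule has_derivative_compose) (use Suc.prems that assms(3) in \<open>auto simp flip: frechet_derivative_works\<close>)
  have e: "frechet_derivative (\<lambda>x. g (f x)) (at x) v =
      (\<Sum>b\<in>Basis. (frechet_derivative f (at x) v \<bullet> b) *\<^sub>R frechet_derivative g (at (f x)) b)"
    if "x \<in> S" for x v
  proof -
    have "linear (frechet_derivative g (at (f x)))"
      using Suc.prems that assms(3) by (intro linear_frechet_derivative) auto
    then have "frechet_derivative g (at (f x)) (\<Sum>b\<in>Basis. (frechet_derivative f (at x) v \<bullet> b) *\<^sub>R b)
      = (\<Sum>b\<in>Basis. (frechet_derivative f (at x) v \<bullet> b) *\<^sub>R frechet_derivative g (at (f x)) b)"
      by (simp add: linear_sum linear_cmul)
    then show ?thesis
      unfolding euclidean_representation frechet_derivative_at[OF d[OF that], symmetric] .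
  qed
  have "Ck_on k S (\<lambda>x. frechet_derivative (\<lambda>x. g (f x)) (at x) v)" for v
  proof (rule Ck_on_cong[OF assms(1) e[symmetric]])
    show "Ck_on k S (\<lambda>x. \<Sum>b\<in>Basis. (frechet_derivative f (at x) v \<bullet> b) *\<^sub>R
        frechet_derivative g (at (f x)) b)"
      using Suc.prems Ck_on_pred[OF Suc.prems(1)]
      by (intro Ck_on_sum[OF assms(1)] Ck_on_bilinear[OF assms(1) bounded_bilinear_scaleR] Suc.IH
          Ck_on_bounded_linear[OF assms(1) bounded_linear_inner_left]) auto
  qed
  then show ?case using d by (auto simp: differentiable_def)
qed

lemma smooth_on_cong:
  assumes "open S" "\<And>x. x \<in> S \<Longrightarrow> f x = g x" "smooth_on S f"
  shows "smooth_on S g"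
  using assms Ck_on_cong unfolding smooth_on_def by blast

lemma smooth_on_subset: "smooth_on S f \<Longrightarrow> T \<subseteq> S \<Longrightarrow> smooth_on T f"
  using Ck_on_subset unfolding smooth_on_def by blast

lemma smooth_on_const [simp]: "smooth_on S (\<lambda>x. c)"
  by (simp add: smooth_on_def Ck_on_const)

lemma smooth_on_bounded_linear:
  "open S \<Longrightarrow> bounded_linear L \<Longrightarrow> smooth_on S f \<Longrightarrow> smooth_on S (\<lambda>x. L (f x))"
  by (simp add: smooth_on_def Ck_on_bounded_linear)

lemma smooth_on_add:
  "open S \<Longrightarrow> smooth_on S f \<Longrightarrow> smooth_on S g \<Longrightarrow> smooth_on S (\<lambda>x. f x + g x)"
  by (simp add: smooth_on_def Ck_on_add)

lemma smooth_on_uminus: "open S \<Longrightarrow> smooth_on S f \<Longrightarrow> smooth_on S (\<lambda>x. - f x)"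
  by (rule smooth_on_bounded_linear[of S uminus]) (auto intro: bounded_linear_minus bounded_linear_ident)

lemma smooth_on_diff:
  "open S \<Longrightarrow> smooth_on S f \<Longrightarrow> smooth_on S g \<Longrightarrow> smooth_on S (\<lambda>x. f x - g x)"
  using smooth_on_add[OF _ _ smooth_on_uminus] by fastforce

lemma smooth_on_bilinear:
  "open S \<Longrightarrow> bounded_bilinear B \<Longrightarrow> smooth_on S f \<Longrightarrow> smooth_on S g \<Longrightarrow> smooth_on S (\<lambda>x. B (f x) (g x))"
  by (simp add: smooth_on_def Ck_on_bilinear)

lemmas smooth_on_mult = smooth_on_bilinear[OF _ bounded_bilinear_mult]

lemma smooth_on_sum:
  "open S \<Longrightarrow> finite I \<Longrightarrow> (\<And>i. i \<in> I \<Longrightarrow> smooth_on S (f i)) \<Longrightarrow> smooth_on S (\<lambda>x. \<Sum>i\<in>I. f i x)"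
  by (simp add: smooth_on_def Ck_on_sum)

lemma smooth_on_prod:
  fixes f :: "'i \<Rightarrow> 'a::euclidean_space \<Rightarrow> real"
  assumes "open S" "finite I" "\<And>i. i \<in> I \<Longrightarrow> smooth_on S (f i)"
  shows "smooth_on S (\<lambda>x. \<Prod>i\<in>I. f i x)"
  using assms(2,3) by (induction I) (auto intro: smooth_on_mult[OF assms(1)])

lemma smooth_on_inverse:
  fixes f :: "'a::euclidean_space \<Rightarrow> real"
  shows "open S \<Longrightarrow> smooth_on S f \<Longrightarrow> (\<And>x. x \<in> S \<Longrightarrow> f x \<noteq> 0) \<Longrightarrow> smooth_on S (\<lambda>x. inverse (f x))"
  by (simp add: smooth_on_def Ck_on_inverse)

lemma smooth_on_compose:
  "open S \<Longrightarrow> open T \<Longrightarrow> f ` S \<subseteq> T \<Longrightarrow> smooth_on S f \<Longrightarrow> smooth_on T g \<Longrightarrow> smooth_on S (\<lambda>x. g (f x))"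
  using Ck_on_compose unfolding smooth_on_def by blast

lemma smooth_on_nth:
  "open S \<Longrightarrow> smooth_on S f \<Longrightarrow> smooth_on S (\<lambda>x. f x $ i)"
  by (rule smooth_on_bounded_linear[of S "\<lambda>y. y $ i"]) (auto intro: bounded_linear_vec_nth)

lemma smooth_on_vec:
  fixes f :: "'a::euclidean_space \<Rightarrow> 'b::euclidean_space^'n"
  assumes "open S" "\<And>i. smooth_on S (\<lambda>x. f x $ i)"
  shows "smooth_on S f"
proof (rule smooth_on_cong[OF assms(1)])
  have "linear (axis i :: 'b \<Rightarrow> 'b^'n)" for i
    by (rule linearI) (auto simp: axis_def vec_eq_iff)
  then show "smooth_on S (\<lambda>x. \<Sum>i\<in>UNIV. axis i (f x $ i))"
    by (intro smooth_on_sum smooth_on_bounded_linear[OF assms(1) _ assms(2)])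
      (auto simp: assms linear_conv_bounded_linear)
  show "(\<Sum>i\<in>UNIV. axis i (f x $ i)) = f x" for x
    by (simp add: vec_eq_iff axis_def if_distrib cong: if_cong)
qed

lemma smooth_on_imp_differentiable: "smooth_on S f \<Longrightarrow> x \<in> S \<Longrightarrow> f differentiable at x"
  unfolding smooth_on_def using Ck_on.simps(2) by blast

lemma smooth_on_imp_continuous_on: "smooth_on S f \<Longrightarrow> continuous_on S f"
  unfolding smooth_on_def using Ck_on.simps(1) by blast

lemma smooth_on_ident: "open S \<Longrightarrow> smooth_on S (\<lambda>x. x)"
proof -
  have "Ck_on k S (\<lambda>x::'a. x)" for k
    by (cases k) (auto simp: Ck_on_const continuous_on_id)
  then show ?thesis by (simp add: smooth_on_def)
qed

text \<open>Extends \<open>partial_deriv\<close> to all directions and to vector values, so that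
  whole matrix fields can be differentiated at once.\<close>

definition dir_deriv :: "'a::euclidean_space \<Rightarrow> ('a \<Rightarrow> 'b::euclidean_space) \<Rightarrow> 'a \<Rightarrow> 'b" where
  "dir_deriv v f x = frechet_derivative f (at x) v"

abbreviation pd :: "'n::finite \<Rightarrow> (real^'n \<Rightarrow> 'b::euclidean_space) \<Rightarrow> real^'n \<Rightarrow> 'b" where
  "pd i \<equiv> dir_deriv (axis i 1)"

lemma partial_deriv_eq_pd: "partial_deriv i u = pd i u"
  by (simp add: fun_eq_iff partial_deriv_def dir_deriv_def)

lemma smooth_on_dir_deriv: "smooth_on S f \<Longrightarrow> smooth_on S (dir_deriv v f)"
  unfolding smooth_on_def dir_deriv_def using Ck_on.simps(2) by blast

lemma has_derivative_dir_deriv: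
  "f differentiable at x \<Longrightarrow> (f has_derivative (\<lambda>v. dir_deriv v f x)) (at x)"
  by (simp add: dir_deriv_def frechet_derivative_works)

lemma dir_deriv_eqI: "(f has_derivative f') (at x) \<Longrightarrow> dir_deriv v f x = f' v"
  by (metis dir_deriv_def frechet_derivative_at)

lemma dir_deriv_cong:
  assumes "open S" "x \<in> S" "f differentiable at x" "\<And>y. y \<in> S \<Longrightarrow> f y = g y"
  shows "dir_deriv v f x = dir_deriv v g x"
proof -
  have "(g has_derivative (\<lambda>v. dir_deriv v f x)) (at x)"
    by (rule has_derivative_transform_within_open[OF has_derivative_dir_deriv assms(1)])
      (use assms in auto)
  then show ?thesis by (rule dir_deriv_eqI[symmetric])
qed

lemma dir_deriv_const [simp]: "dir_deriv v (\<lambda>x. c) x = 0"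
  by (simp add: dir_deriv_def)

lemma dir_deriv_bounded_linear:
  "bounded_linear L \<Longrightarrow> f differentiable at x \<Longrightarrow> dir_deriv v (\<lambda>x. L (f x)) x = L (dir_deriv v f x)"
  by (rule dir_deriv_eqI) (auto intro: bounded_linear.has_derivative has_derivative_dir_deriv)

lemma dir_deriv_bilinear:
  "bounded_bilinear B \<Longrightarrow> f differentiable at x \<Longrightarrow> g differentiable at x \<Longrightarrow>
    dir_deriv v (\<lambda>x. B (f x) (g x)) x = B (f x) (dir_deriv v g x) + B (dir_deriv v f x) (g x)"
  by (rule dir_deriv_eqI[OF bounded_bilinear.FDERIV])
    (auto intro: has_derivative_dir_deriv)

lemmas dir_deriv_mult = dir_deriv_bilinear[OF bounded_bilinear_mult]

lemma dir_deriv_add: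
  "f differentiable at x \<Longrightarrow> g differentiable at x \<Longrightarrow>
    dir_deriv v (\<lambda>x. f x + g x) x = dir_deriv v f x + dir_deriv v g x"
  by (rule dir_deriv_eqI[OF has_derivative_add]) (auto intro: has_derivative_dir_deriv)

lemma dir_deriv_diff:
  "f differentiable at x \<Longrightarrow> g differentiable at x \<Longrightarrow>
    dir_deriv v (\<lambda>x. f x - g x) x = dir_deriv v f x - dir_deriv v g x"
  by (rule dir_deriv_eqI[OF has_derivative_diff]) (auto intro: has_derivative_dir_deriv)

lemma dir_deriv_uminus:
  "f differentiable at x \<Longrightarrow> dir_deriv v (\<lambda>x. - f x) x = - dir_deriv v f x"
  by (rule dir_deriv_eqI[OF has_derivative_minus]) (auto intro: has_derivative_dir_deriv)

lemma dir_deriv_sum: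
  "(\<And>i. i \<in> I \<Longrightarrow> f i differentiable at x) \<Longrightarrow>
    dir_deriv v (\<lambda>x. \<Sum>i\<in>I. f i x) x = (\<Sum>i\<in>I. dir_deriv v (f i) x)"
  by (rule dir_deriv_eqI[OF has_derivative_sum]) (auto intro: has_derivative_dir_deriv)

lemma dir_deriv_nth:
  "f differentiable at x \<Longrightarrow> dir_deriv v (\<lambda>x. f x $ i) x = dir_deriv v f x $ i"
  by (rule dir_deriv_bounded_linear) (auto intro: bounded_linear_vec_nth)

lemma dir_deriv_compose:
  fixes f :: "'a::euclidean_space \<Rightarrow> real^'n"
  assumes "f differentiable at x" "g differentiable at (f x)"
  shows "dir_deriv v (\<lambda>x. g (f x)) x = (\<Sum>k\<in>UNIV. (dir_deriv v f x $ k) *\<^sub>R pd k g (f x))"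
proof -
  have l: "linear (\<lambda>v. dir_deriv v g (f x))"
    using has_derivative_linear[OF has_derivative_dir_deriv] assms(2) by blast
  have "dir_deriv v (\<lambda>x. g (f x)) x = dir_deriv (dir_deriv v f x) g (f x)"
    by (rule dir_deriv_eqI[OF has_derivative_compose])
      (auto intro: has_derivative_dir_deriv assms)
  also have "\<dots> = dir_deriv (\<Sum>k\<in>UNIV. (dir_deriv v f x $ k) *\<^sub>R axis k 1) g (f x)"
    using basis_expansion[of "dir_deriv v f x"] by (simp add: scalar_mult_eq_scaleR)
  also have "\<dots> = (\<Sum>k\<in>UNIV. (dir_deriv v f x $ k) *\<^sub>R pd k g (f x))"
    by (simp add: linear_sum[OF l] linear_cmul[OF l])
  finally show ?thesis .
qed

lemma dir_deriv_expand:
  fixes g :: "real^'n \<Rightarrow> 'b::euclidean_space"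
  assumes "g differentiable at x"
  shows "dir_deriv v g x = (\<Sum>i\<in>UNIV. v $ i *\<^sub>R pd i g x)"
  using dir_deriv_compose[of "\<lambda>x. x" x g v] assms
  by (simp add: dir_deriv_eqI[OF has_derivative_ident])

section \<open>Derivatives along lines and symmetry of second derivatives\<close>

lemma has_real_derivative_along_line:
  fixes k :: "'a::euclidean_space \<Rightarrow> real"
  assumes "k differentiable at (y + s *\<^sub>R w)"
  shows "((\<lambda>s. k (y + s *\<^sub>R w)) has_real_derivative dir_deriv w k (y + s *\<^sub>R w)) (at s)"
proof -
  have "((\<lambda>s. k (y + s *\<^sub>R w)) has_derivative (\<lambda>r. dir_deriv (r *\<^sub>R w) k (y + s *\<^sub>R w))) (at s)"
    by (rule has_derivative_compose[where f = "\<lambda>s. y + s *\<^sub>R w"])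
      (auto intro!: derivative_eq_intros has_derivative_dir_deriv assms)
  moreover have l: "linear (\<lambda>v. dir_deriv v k (y + s *\<^sub>R w))"
    using has_derivative_linear[OF has_derivative_dir_deriv[OF assms]] .
  ultimately show ?thesis
    by (simp add: has_field_derivative_def linear_cmul[OF l] mult_commute_abs)
qed

text \<open>The mean value theorem is applied in direction u and then in direction v. The left-hand
  side is symmetric in u and v while the right-hand side is not, which is what makes the mixed
  derivatives agree in the limit.\<close>

lemma second_difference:
  fixes f :: "'a::euclidean_space \<Rightarrow> real"
  assumes "open S" "smooth_on S f" "h > 0"
    and sub: "\<And>s t. 0 \<le> s \<Longrightarrow> s \<le> h \<Longrightarrow> 0 \<le> t \<Longrightarrow> t \<le> h \<Longrightarrow> x + s *\<^sub>R u + t *\<^sub>R v \<in> S"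
  obtains s t where "0 \<le> s" "s \<le> h" "0 \<le> t" "t \<le> h"
    "f (x + h *\<^sub>R u + h *\<^sub>R v) - f (x + h *\<^sub>R u) - f (x + h *\<^sub>R v) + f x
      = h * h * dir_deriv v (dir_deriv u f) (x + s *\<^sub>R u + t *\<^sub>R v)"
proof -
  note d = has_real_derivative_along_line[OF smooth_on_imp_differentiable]
  define p where "p s = f (x + h *\<^sub>R v + s *\<^sub>R u) - f (x + s *\<^sub>R u)" for s
  have "\<exists>s. 0 < s \<and> s < h \<and> p h - p 0 = (h - 0) *
      (dir_deriv u f (x + h *\<^sub>R v + s *\<^sub>R u) - dir_deriv u f (x + s *\<^sub>R u))"
  proof (rule MVT2[OF assms(3)])
    fix s assume "0 \<le> s" "s \<le> h"
    then have "x + h *\<^sub>R v + s *\<^sub>R u \<in> S" "x + s *\<^sub>R u \<in> S"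
      using sub[of s h] sub[of s 0] assms(3) by (simp_all add: add_ac)
    then show "(p has_real_derivative
        dir_deriv u f (x + h *\<^sub>R v + s *\<^sub>R u) - dir_deriv u f (x + s *\<^sub>R u)) (at s)"
      unfolding p_def by (intro DERIV_diff d[OF assms(2)])
  qed
  then obtain s where s: "0 < s" "s < h" "p h - p 0 = h *
      (dir_deriv u f (x + h *\<^sub>R v + s *\<^sub>R u) - dir_deriv u f (x + s *\<^sub>R u))" by auto
  have "\<exists>t. 0 < t \<and> t < h \<and> dir_deriv u f (x + s *\<^sub>R u + h *\<^sub>R v) - dir_deriv u f (x + s *\<^sub>R u + 0 *\<^sub>R v)
      = (h - 0) * dir_deriv v (dir_deriv u f) (x + s *\<^sub>R u + t *\<^sub>R v)"
    by (rule MVT2[OF assms(3)]) (use s sub in \<open>auto intro!: d[OF smooth_on_dir_deriv[OF assms(2)]]\<close>)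
  then obtain t where t: "0 < t" "t < h" "dir_deriv u f (x + s *\<^sub>R u + h *\<^sub>R v) - dir_deriv u f (x + s *\<^sub>R u)
      = h * dir_deriv v (dir_deriv u f) (x + s *\<^sub>R u + t *\<^sub>R v)" by auto
  show ?thesis
    by (rule that[of s t]) (use s t in \<open>simp_all add: p_def algebra_simps\<close>)
qed

lemma dir_deriv_commute_real:
  fixes f :: "'a::euclidean_space \<Rightarrow> real"
  assumes "open S" "smooth_on S f" "x \<in> S"
  shows "dir_deriv v (dir_deriv u f) x = dir_deriv u (dir_deriv v f) x"
proof -
  have close: "\<exists>\<delta>>0. \<forall>h s t. 0 < h \<longrightarrow> h < \<delta> \<longrightarrow> 0 \<le> s \<longrightarrow> s \<le> h \<longrightarrow> 0 \<le> t \<longrightarrow> t \<le> h \<longrightarrow>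
      x + s *\<^sub>R u + t *\<^sub>R v \<in> S \<and>
      \<bar>dir_deriv v (dir_deriv u f) (x + s *\<^sub>R u + t *\<^sub>R v) - dir_deriv v (dir_deriv u f) x\<bar> < e"
    if "e > 0" for e u v
  proof -
    have "continuous_on S (dir_deriv v (dir_deriv u f))"
      by (intro smooth_on_imp_continuous_on smooth_on_dir_deriv assms)
    then obtain d1 where d1: "d1 > 0" "\<And>y. y \<in> S \<Longrightarrow> dist y x < d1 \<Longrightarrow>
        \<bar>dir_deriv v (dir_deriv u f) y - dir_deriv v (dir_deriv u f) x\<bar> < e"
      unfolding continuous_on_iff dist_real_def using assms(3) \<open>e > 0\<close> by blast
    obtain d2 where d2: "d2 > 0" "ball x d2 \<subseteq> S" using assms openE by blast
    \<comment> \<open>For h < d the parallelogram spanned by h u and h v stays in the ball around x;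
      the 1 keeps the denominator positive when u and v vanish.\<close>
    define d where "d = min d1 d2 / (norm u + norm v + 1)"
    have "d > 0" using d1 d2 by (simp add: d_def add_nonneg_pos)
    have "dist (x + s *\<^sub>R u + t *\<^sub>R v) x < min d1 d2"
      if "0 < h" "h < d" "0 \<le> s" "s \<le> h" "0 \<le> t" "t \<le> h" for s t h
    proof -
      have "norm (s *\<^sub>R u + t *\<^sub>R v) \<le> s * norm u + t * norm v"
        using norm_triangle_ineq[of "s *\<^sub>R u" "t *\<^sub>R v"] that by simp
      also have "\<dots> \<le> h * norm u + h * norm v"
        using that by (intro add_mono mult_right_mono) auto
      also have "\<dots> \<le> h * (norm u + norm v + 1)" using that by (simp add: algebra_simps)
      also have "\<dots> < d * (norm u + norm v + 1)"
        using that by (intro mult_strict_right_mono) (auto simp: add_nonneg_pos)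
      also have "\<dots> = min d1 d2" using add_nonneg_pos[of "norm u + norm v" 1] by (simp add: d_def)
      finally show ?thesis by (simp add: dist_norm)
    qed
    then show ?thesis
      using d1 d2 \<open>d > 0\<close> by (intro exI[of _ d]) (auto simp: subset_iff dist_commute)
  qed
  have "\<bar>dir_deriv v (dir_deriv u f) x - dir_deriv u (dir_deriv v f) x\<bar> < 2 * e" if e: "e > 0" for e
  proof -
    obtain d1 where d1: "d1 > 0" "\<And>h s t. 0 < h \<Longrightarrow> h < d1 \<Longrightarrow> 0 \<le> s \<Longrightarrow> s \<le> h \<Longrightarrow> 0 \<le> t \<Longrightarrow> t \<le> h \<Longrightarrow>
      x + s *\<^sub>R u + t *\<^sub>R v \<in> S \<and>
      \<bar>dir_deriv v (dir_deriv u f) (x + s *\<^sub>R u + t *\<^sub>R v) - dir_deriv v (dir_deriv u f) x\<bar> < e"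
      using close[OF e, of u v] by blast
    obtain d2 where d2: "d2 > 0" "\<And>h s t. 0 < h \<Longrightarrow> h < d2 \<Longrightarrow> 0 \<le> s \<Longrightarrow> s \<le> h \<Longrightarrow> 0 \<le> t \<Longrightarrow> t \<le> h \<Longrightarrow>
      x + s *\<^sub>R v + t *\<^sub>R u \<in> S \<and>
      \<bar>dir_deriv u (dir_deriv v f) (x + s *\<^sub>R v + t *\<^sub>R u) - dir_deriv u (dir_deriv v f) x\<bar> < e"
      using close[OF e, of v u] by blast
    define h where "h = min d1 d2 / 2"
    have h: "h > 0" "h < d1" "h < d2" using d1(1) d2(1) by (auto simp: h_def)
    obtain s t where st: "0 \<le> s" "s \<le> h" "0 \<le> t" "t \<le> h"
      "f (x + h *\<^sub>R u + h *\<^sub>R v) - f (x + h *\<^sub>R u) - f (x + h *\<^sub>R v) + f x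
        = h * h * dir_deriv v (dir_deriv u f) (x + s *\<^sub>R u + t *\<^sub>R v)"
      using second_difference[OF assms(1,2) h(1), of x u v] d1(2) h by blast
    obtain s' t' where st': "0 \<le> s'" "s' \<le> h" "0 \<le> t'" "t' \<le> h"
      "f (x + h *\<^sub>R v + h *\<^sub>R u) - f (x + h *\<^sub>R v) - f (x + h *\<^sub>R u) + f x
        = h * h * dir_deriv u (dir_deriv v f) (x + s' *\<^sub>R v + t' *\<^sub>R u)"
      using second_difference[OF assms(1,2) h(1), of x v u] d2(2) h by blast
    have "h * h * dir_deriv v (dir_deriv u f) (x + s *\<^sub>R u + t *\<^sub>R v)
        = h * h * dir_deriv u (dir_deriv v f) (x + s' *\<^sub>R v + t' *\<^sub>R u)"
      using st(5) st'(5) by (simp add: algebra_simps)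
    then have "dir_deriv v (dir_deriv u f) (x + s *\<^sub>R u + t *\<^sub>R v)
        = dir_deriv u (dir_deriv v f) (x + s' *\<^sub>R v + t' *\<^sub>R u)" using h by simp
    then show ?thesis using d1(2)[OF h(1,2) st(1-4)] d2(2)[OF h(1,3) st'(1-4)] by linarith
  qed
  \<comment> \<open>With e half the distance of the two values, that distance would be smaller than
    itself unless it is zero.\<close>
  from this[of "\<bar>dir_deriv v (dir_deriv u f) x - dir_deriv u (dir_deriv v f) x\<bar> / 2"]
  show ?thesis by fastforce
qed

lemma dir_deriv_commute:
  fixes f :: "'a::euclidean_space \<Rightarrow> 'b::euclidean_space"
  assumes "open S" "smooth_on S f" "x \<in> S"
  shows "dir_deriv v (dir_deriv u f) x = dir_deriv u (dir_deriv v f) x"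
proof (rule euclidean_eqI)
  fix b :: 'b
  have L: "bounded_linear (\<lambda>y::'b. y \<bullet> b)" by (rule bounded_linear_inner_left)
  have sm: "smooth_on S (\<lambda>x. g x \<bullet> b)" if "smooth_on S g" for g
    by (rule smooth_on_bounded_linear[OF assms(1) L that])
  have 1: "dir_deriv w g y \<bullet> b = dir_deriv w (\<lambda>x. g x \<bullet> b) y" if "smooth_on S g" "y \<in> S" for w g y
    using dir_deriv_bounded_linear[OF L, of g y w] smooth_on_imp_differentiable that by fastforce
  have 2: "dir_deriv w (dir_deriv w' f) x \<bullet> b = dir_deriv w (dir_deriv w' (\<lambda>x. f x \<bullet> b)) x" for w w'
    unfolding 1[OF smooth_on_dir_deriv[OF assms(2)] assms(3)]
    by (rule dir_deriv_cong[OF assms(1,3)])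
      (auto intro!: smooth_on_imp_differentiable[OF _ assms(3)] sm smooth_on_dir_deriv assms 1)
  show "dir_deriv v (dir_deriv u f) x \<bullet> b = dir_deriv u (dir_deriv v f) x \<bullet> b"
    unfolding 2 by (rule dir_deriv_commute_real[OF assms(1) sm[OF assms(2)] assms(3)])
qed

section \<open>Metrics in local coordinates\<close>

lemma bounded_bilinear_matrix_mult:
  "bounded_bilinear ((**) :: real^'n^'m \<Rightarrow> real^'k^'n \<Rightarrow> real^'k^'m)"
proof -
  have "bilinear ((**) :: real^'n^'m \<Rightarrow> real^'k^'n \<Rightarrow> real^'k^'m)"
    unfolding bilinear_def
    by (auto intro!: linearI simp: matrix_matrix_mult_def vec_eq_iff sum.distrib sum_distrib_left
        algebra_simps)
  then show ?thesis by (simp add: bilinear_conv_bounded_bilinear)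
qed

lemma bounded_bilinear_matrix_vector_mult:
  "bounded_bilinear ((*v) :: real^'n^'m \<Rightarrow> real^'n \<Rightarrow> real^'m)"
proof -
  have "bilinear ((*v) :: real^'n^'m \<Rightarrow> real^'n \<Rightarrow> real^'m)"
    unfolding bilinear_def
    by (auto intro!: linearI simp: matrix_vector_mult_def vec_eq_iff sum.distrib sum_distrib_left
        algebra_simps)
  then show ?thesis by (simp add: bilinear_conv_bounded_bilinear)
qed

interpretation mm: bounded_bilinear "(**) :: real^'n^'m \<Rightarrow> real^'k^'n \<Rightarrow> real^'k^'m"
  by (rule bounded_bilinear_matrix_mult)

interpretation mv: bounded_bilinear "(*v) :: real^'n^'m \<Rightarrow> real^'n \<Rightarrow> real^'m"
  by (rule bounded_bilinear_matrix_vector_mult)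

lemma bounded_linear_transpose: "bounded_linear (transpose :: real^'n^'m \<Rightarrow> real^'m^'n)"
  unfolding linear_conv_bounded_linear[symmetric]
  by (auto intro!: linearI simp: transpose_def vec_eq_iff)

lemmas linear_transpose = bounded_linear.linear[OF bounded_linear_transpose]

lemmas mat_simps = mm.add_left mm.add_right mm.diff_left mm.diff_right mm.minus_left mm.minus_right
  mv.add_left mv.add_right mv.diff_left mv.diff_right mv.minus_left mv.minus_right
  linear_add[OF linear_transpose] linear_diff[OF linear_transpose]
  linear_neg[OF linear_transpose] matrix_transpose_mul matrix_mul_assoc
  matrix_vector_mul_assoc

lemma smooth_on_det:
  fixes M :: "'a::euclidean_space \<Rightarrow> real^'n^'n"
  assumes "open S" "\<And>i j. smooth_on S (\<lambda>x. M x $ i $ j)"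
  shows "smooth_on S (\<lambda>x. det (M x))"
  unfolding det_def
  by (intro smooth_on_sum smooth_on_mult smooth_on_prod) (auto simp: assms)

lemma matrix_inv:
  fixes A :: "real^'n^'n"
  assumes "invertible A"
  shows "A ** matrix_inv A = mat 1" "matrix_inv A ** A = mat 1"
  using someI_ex[OF assms[unfolded invertible_def]] by (simp_all add: matrix_inv_def)

text \<open>By Cramer's rule each entry of the inverse is a quotient of determinants, and
  determinants are polynomials in the entries. The matrix \<open>C x\<close> is \<open>M x\<close>
  with column k replaced by the l-th unit vector.\<close>

lemma smooth_on_matrix_inv:
  fixes M :: "'a::euclidean_space \<Rightarrow> real^'n^'n"
  assumes "open S" "smooth_on S M" "\<And>x. x \<in> S \<Longrightarrow> invertible (M x)"
  shows "smooth_on S (\<lambda>x. matrix_inv (M x))"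
proof (intro smooth_on_vec[OF assms(1)])
  fix k l :: 'n
  define C where "C x = (\<chi> i j. if j = k then (axis l 1 :: real^'n) $ i else M x $ i $ j)" for x
  have e: "matrix_inv (M x) $ k $ l = det (C x) * inverse (det (M x))" if "x \<in> S" for x
  proof -
    have d: "det (M x) \<noteq> 0" using assms(3)[OF that] invertible_det_nz by blast
    have "M x *v (matrix_inv (M x) *v axis l 1) = axis l 1"
      using matrix_inv[OF assms(3)[OF that]] by (simp add: matrix_vector_mul_assoc)
    then have "matrix_inv (M x) *v axis l 1 =
        (\<chi> k. det (\<chi> i j. if j = k then (axis l 1 :: real^'n) $ i else M x $ i $ j) / det (M x))"
      using cramer[OF d] by blast
    moreover have "(matrix_inv (M x) *v axis l 1) $ k = matrix_inv (M x) $ k $ l"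
      by (simp add: matrix_vector_mult_def axis_def if_distrib cong: if_cong)
    ultimately show ?thesis by (simp add: C_def divide_inverse)
  qed
  have "smooth_on S (\<lambda>x. M x $ i $ j)" for i j
    by (intro smooth_on_nth assms)
  then have "smooth_on S (\<lambda>x. C x $ i $ j)" for i j
    by (cases "j = k") (simp_all add: C_def)
  moreover have "det (M x) \<noteq> 0" if "x \<in> S" for x using assms(3)[OF that] invertible_det_nz by blast
  ultimately have "smooth_on S (\<lambda>x. det (C x) * inverse (det (M x)))"
    using \<open>\<And>i j. smooth_on S (\<lambda>x. M x $ i $ j)\<close>
    by (intro smooth_on_mult smooth_on_inverse smooth_on_det assms(1))
  then show "smooth_on S (\<lambda>x. matrix_inv (M x) $ k $ l)"
    by (rule smooth_on_cong[OF assms(1), rotated]) (simp add: e)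
qed

locale open_domain =
  fixes S :: "(real^'n::finite) set"
  assumes open_S: "open S"
begin

lemmas smooth_intros = smooth_on_const smooth_on_add[OF open_S] smooth_on_diff[OF open_S]
  smooth_on_uminus[OF open_S] smooth_on_mult[OF open_S] smooth_on_sum[OF open_S finite]
  smooth_on_bilinear[OF open_S bounded_bilinear_matrix_mult]
  smooth_on_bilinear[OF open_S bounded_bilinear_matrix_vector_mult]
  smooth_on_bounded_linear[OF open_S bounded_linear_transpose]
  smooth_on_nth[OF open_S] smooth_on_dir_deriv

lemma pd_rules:
  fixes u v :: "real^'n \<Rightarrow> 'b::euclidean_space" and a b :: "real^'n \<Rightarrow> real"
    and A :: "real^'n \<Rightarrow> real^'k^'l" and B :: "real^'n \<Rightarrow> real^'m^'k" and c :: "real^'n \<Rightarrow> real^'k"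
    and w :: "'i \<Rightarrow> real^'n \<Rightarrow> 'b"
  assumes "x \<in> S"
  shows "smooth_on S u \<Longrightarrow> smooth_on S v \<Longrightarrow> pd i (\<lambda>x. u x + v x) x = pd i u x + pd i v x"
    and "smooth_on S u \<Longrightarrow> smooth_on S v \<Longrightarrow> pd i (\<lambda>x. u x - v x) x = pd i u x - pd i v x"
    and "smooth_on S u \<Longrightarrow> pd i (\<lambda>x. - u x) x = - pd i u x"
    and "smooth_on S a \<Longrightarrow> smooth_on S b \<Longrightarrow> pd i (\<lambda>x. a x * b x) x = a x * pd i b x + pd i a x * b x"
    and "smooth_on S A \<Longrightarrow> smooth_on S B \<Longrightarrow> pd i (\<lambda>x. A x ** B x) x = A x ** pd i B x + pd i A x ** B x"
    and "smooth_on S A \<Longrightarrow> smooth_on S c \<Longrightarrow> pd i (\<lambda>x. A x *v c x) x = A x *v pd i c x + pd i A x *v c x"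
    and "smooth_on S A \<Longrightarrow> pd i (\<lambda>x. transpose (A x)) x = transpose (pd i A x)"
    and "(\<And>j. smooth_on S (w j)) \<Longrightarrow> pd i (\<lambda>x. \<Sum>j\<in>J. w j x) x = (\<Sum>j\<in>J. pd i (w j) x)"
  by (simp_all add: smooth_on_imp_differentiable[OF _ assms] dir_deriv_add dir_deriv_diff dir_deriv_uminus dir_deriv_mult
      dir_deriv_bilinear[OF bounded_bilinear_matrix_mult]
      dir_deriv_bilinear[OF bounded_bilinear_matrix_vector_mult]
      dir_deriv_bounded_linear[OF bounded_linear_transpose] dir_deriv_sum)

lemma pd_nth: "x \<in> S \<Longrightarrow> smooth_on S u \<Longrightarrow> pd i (\<lambda>x. u x $ k) x = pd i u x $ k"
  by (simp add: smooth_on_imp_differentiable dir_deriv_nth)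

lemma pd_nth2:
  "x \<in> S \<Longrightarrow> smooth_on S u \<Longrightarrow> pd i (\<lambda>x. u x $ k $ l) x = pd i u x $ k $ l"
  by (simp add: pd_nth smooth_on_nth[OF open_S])

lemma pd_cong:
  "x \<in> S \<Longrightarrow> smooth_on S u \<Longrightarrow> (\<And>y. y \<in> S \<Longrightarrow> u y = v y) \<Longrightarrow> pd i u x = pd i v x"
  by (rule dir_deriv_cong[OF open_S _ smooth_on_imp_differentiable])

lemma pd_commute: "x \<in> S \<Longrightarrow> smooth_on S u \<Longrightarrow> pd i (pd j u) x = pd j (pd i u) x"
  using dir_deriv_commute[OF open_S] by blast

end

section \<open>The Levi-Civita connection of a metric on an open set\<close>

locale metric_chart = open_domain S for S :: "(real^'n::finite) set" +
  fixes G :: "real^'n \<Rightarrow> real^'n^'n"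
  assumes smooth_entries: "smooth_on S (\<lambda>x. G x $ i $ j)"
    and G_sym: "x \<in> S \<Longrightarrow> G x $ i $ j = G x $ j $ i"
    and G_pos: "x \<in> S \<Longrightarrow> v \<noteq> 0 \<Longrightarrow> v \<bullet> (G x *v v) > 0"
begin

definition inv_G :: "real^'n \<Rightarrow> real^'n^'n" where "inv_G x = matrix_inv (G x)"

text \<open>Arranged as a matrix so that the covariant derivative of a vector field V in direction i
  is \<open>pd i V x + \<Gamma> i x *v V x\<close>.\<close>

definition \<Gamma> :: "'n \<Rightarrow> real^'n \<Rightarrow> real^'n^'n" where
  "\<Gamma> i x = (\<chi> l k. christoffel G l i k x)"

text \<open>Christoffel symbols of the first kind; the row l is the lowered index.\<close>

definition lowered :: "'n \<Rightarrow> real^'n \<Rightarrow> real^'n^'n" where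
  "lowered i x = (\<chi> l k. (1/2) * (pd i G x $ k $ l + pd k G x $ i $ l - pd l G x $ i $ k))"

text \<open>\<open>curv i j\<close> is the endomorphism \<open>R(\<partial>\<^sub>i,\<partial>\<^sub>j)\<close>, \<open>curv_up i j\<close> has its second index raised, and
  \<open>ricci_up j m\<close> is \<open>Ric\<^sub>j\<^sup>m\<close>.\<close>

definition curv :: "'n \<Rightarrow> 'n \<Rightarrow> real^'n \<Rightarrow> real^'n^'n" where
  "curv i j = (\<lambda>x. pd i (\<Gamma> j) x - pd j (\<Gamma> i) x + \<Gamma> i x ** \<Gamma> j x - \<Gamma> j x ** \<Gamma> i x)"

definition curv_up :: "'n \<Rightarrow> 'n \<Rightarrow> real^'n \<Rightarrow> real^'n^'n" where
  "curv_up i j = (\<lambda>x. curv i j x ** inv_G x)"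

definition ricci_up :: "'n \<Rightarrow> 'n \<Rightarrow> real^'n \<Rightarrow> real" where
  "ricci_up j m = (\<lambda>x. \<Sum>i\<in>UNIV. curv_up i j x $ i $ m)"

lemma smooth_G: "smooth_on S G"
  by (intro smooth_on_vec[OF open_S] smooth_entries)

lemma transpose_G: "x \<in> S \<Longrightarrow> transpose (G x) = G x"
  using G_sym by (simp add: transpose_def vec_eq_iff)

lemma invertible_G: assumes "x \<in> S" shows "invertible (G x)"
proof -
  have "v = 0" if "G x *v v = 0" for v
    using G_pos[OF assms, of v] that by force
  then show ?thesis
    by (simp add: invertible_left_inverse matrix_left_invertible_ker)
qed

lemma G_inv_G: "x \<in> S \<Longrightarrow> G x ** inv_G x = mat 1" "x \<in> S \<Longrightarrow> inv_G x ** G x = mat 1"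
  using matrix_inv invertible_G by (auto simp: inv_G_def)

lemma smooth_inv_G: "smooth_on S inv_G"
  unfolding inv_G_def[abs_def] by (rule smooth_on_matrix_inv[OF open_S smooth_G invertible_G])

lemma transpose_inv_G: assumes "x \<in> S" shows "transpose (inv_G x) = inv_G x"
proof -
  have "transpose (inv_G x) ** G x = mat 1"
    using arg_cong[OF G_inv_G(1)[OF assms], of transpose]
    by (simp add: matrix_transpose_mul transpose_G[OF assms] transpose_mat)
  then have "transpose (inv_G x) ** (G x ** inv_G x) = inv_G x"
    by (simp add: matrix_mul_assoc)
  then show ?thesis by (simp add: G_inv_G[OF assms])
qed

lemma inv_G_sym: "x \<in> S \<Longrightarrow> inv_G x $ i $ j = inv_G x $ j $ i"
  using transpose_inv_G[of x] by (simp add: transpose_def vec_eq_iff)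

lemma inv_G_pos: assumes "x \<in> S" "v \<noteq> 0" shows "v \<bullet> (inv_G x *v v) > 0"
proof -
  have e: "G x *v (inv_G x *v v) = v"
    using G_inv_G[OF assms(1)] by (simp add: matrix_vector_mul_assoc)
  then have "inv_G x *v v \<noteq> 0" using assms(2) by force
  from G_pos[OF assms(1) this] show ?thesis by (simp add: e inner_commute)
qed

lemma Gamma_lowered: assumes "x \<in> S" shows "\<Gamma> i x = inv_G x ** lowered i x"
  by (simp add: \<Gamma>_def lowered_def matrix_matrix_mult_def vec_eq_iff christoffel_def
      partial_deriv_eq_pd pd_nth2[OF assms smooth_G] inv_G_def sum_distrib_left mult_ac)

lemma pd_G_sym: assumes "x \<in> S" shows "pd k G x $ i $ j = pd k G x $ j $ i"
proof -
  have "pd k (\<lambda>x. G x $ i $ j) x = pd k (\<lambda>x. G x $ j $ i) x"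
    by (rule pd_cong[OF assms smooth_entries G_sym])
  then show ?thesis by (simp add: pd_nth2[OF assms smooth_G])
qed

lemma Gamma_sym: assumes "x \<in> S" shows "\<Gamma> i x $ l $ j = \<Gamma> j x $ l $ i"
  unfolding Gamma_lowered[OF assms]
  by (simp add: lowered_def matrix_matrix_mult_def pd_G_sym[OF assms, of _ i j] algebra_simps)

lemma smooth_Gamma: "smooth_on S (\<Gamma> i)"
proof (rule smooth_on_cong[OF open_S])
  show "smooth_on S (\<lambda>x. inv_G x ** lowered i x)"
    unfolding lowered_def
    by (intro smooth_on_bilinear[OF open_S bounded_bilinear_matrix_mult] smooth_inv_G smooth_on_vec[OF open_S])
      (simp only: vec_lambda_beta, intro smooth_intros smooth_G)
qed (simp add: Gamma_lowered)

text \<open>The metric is parallel. In \<open>lowered i x\<close> plus its transpose the derivatives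
  in the directions k and l cancel, and the two halves of \<open>pd i G\<close> remain.\<close>

lemma pd_G: assumes "x \<in> S" shows "pd i G x = G x ** \<Gamma> i x + transpose (\<Gamma> i x) ** G x"
proof -
  have 1: "G x ** \<Gamma> i x = lowered i x"
    by (simp add: Gamma_lowered assms matrix_mul_assoc G_inv_G)
  then have 2: "transpose (\<Gamma> i x) ** G x = transpose (lowered i x)"
    using matrix_transpose_mul[of "G x" "\<Gamma> i x"] by (simp add: transpose_G assms)
  show ?thesis
    unfolding 1 2 using pd_G_sym[OF assms]
    by (simp add: lowered_def transpose_def vec_eq_iff field_simps)
qed

text \<open>The inverse metric is parallel too, as differentiating
  \<open>G x ** inv_G x = mat 1\<close> shows.\<close>

lemma pd_inv_G: assumes "x \<in> S" shows "pd i inv_G x = - (\<Gamma> i x ** inv_G x) - inv_G x ** transpose (\<Gamma> i x)"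
proof -
  have "G x ** pd i inv_G x + pd i G x ** inv_G x = pd i (\<lambda>x. G x ** inv_G x) x"
    by (simp add: pd_rules[OF assms] smooth_G smooth_inv_G)
  also have "\<dots> = pd i (\<lambda>x. mat 1 :: real^'n^'n) x"
    by (rule pd_cong[OF assms]) (auto simp: G_inv_G intro!: smooth_intros smooth_G smooth_inv_G)
  finally have "inv_G x ** (G x ** pd i inv_G x) + inv_G x ** (pd i G x ** inv_G x) = 0"
    by (simp flip: mm.add_right)
  moreover have "inv_G x ** (G x ** pd i inv_G x) = pd i inv_G x"
    by (simp add: matrix_mul_assoc G_inv_G assms)
  moreover have "inv_G x ** (pd i G x ** inv_G x) = \<Gamma> i x ** inv_G x + inv_G x ** transpose (\<Gamma> i x)"
    by (simp add: pd_G[OF assms] mat_simps G_inv_G assms) (simp add: G_inv_G assms flip: matrix_mul_assoc)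
  ultimately show ?thesis by (simp add: algebra_simps eq_neg_iff_add_eq_0)
qed

section \<open>Curvature: skewness and the Bianchi identities\<close>

lemma smooth_curv: "smooth_on S (curv i j)"
  unfolding curv_def by (intro smooth_intros smooth_Gamma)

lemma smooth_curv_up: "smooth_on S (curv_up i j)"
  unfolding curv_up_def by (intro smooth_intros smooth_curv smooth_inv_G)

lemma smooth_ricci_up: "smooth_on S (ricci_up i j)"
  unfolding ricci_up_def by (intro smooth_intros smooth_curv_up)

lemma curv_skew: "curv j i x = - curv i j x"
  by (simp add: curv_def)

lemma curv_up_skew: "curv_up j i x = - curv_up i j x"
  by (simp add: curv_up_def curv_skew[of j i] mat_simps)

text \<open>Curvature annihilates the parallel tensor \<open>inv_G\<close>: substituting
  \<open>pd_inv_G\<close> into the commutator of its second derivatives, which is zero, leaves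
  \<open>curv_up i j x\<close> plus its transpose, up to sign.\<close>

lemma transpose_curv_up: assumes "x \<in> S" shows "transpose (curv_up i j x) = - curv_up i j x"
proof -
  have "pd i (pd j inv_G) x = pd i (\<lambda>x. - (\<Gamma> j x ** inv_G x) - inv_G x ** transpose (\<Gamma> j x)) x" for i j
    by (rule pd_cong[OF assms]) (auto intro: smooth_on_dir_deriv smooth_inv_G pd_inv_G)
  also have "\<dots> i j = - (\<Gamma> j x ** pd i inv_G x) - pd i (\<Gamma> j) x ** inv_G x
      - pd i inv_G x ** transpose (\<Gamma> j x) - inv_G x ** transpose (pd i (\<Gamma> j) x)" for i j
    by (simp add: pd_rules[OF assms] smooth_intros smooth_inv_G smooth_Gamma)
  finally have *: "pd i (pd j inv_G) x = - (\<Gamma> j x ** pd i inv_G x) - pd i (\<Gamma> j) x ** inv_G x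
      - pd i inv_G x ** transpose (\<Gamma> j x) - inv_G x ** transpose (pd i (\<Gamma> j) x)" for i j .
  have "pd i (pd j inv_G) x - pd j (pd i inv_G) x = 0"
    using pd_commute[OF assms smooth_inv_G] by simp
  then have "curv_up i j x + transpose (curv_up i j x) = 0"
    unfolding * pd_inv_G[OF assms] curv_up_def curv_def
    by (simp add: mat_simps transpose_inv_G[OF assms] algebra_simps)
  then show ?thesis by (simp add: add.commute eq_neg_iff_add_eq_0)
qed

lemma curv_up_skew': "x \<in> S \<Longrightarrow> curv_up i j x $ l $ m = - (curv_up i j x $ m $ l)"
  using arg_cong[OF transpose_curv_up[of x i j], of "\<lambda>M. M $ m $ l"] by (simp add: transpose_def)

text \<open>The second derivatives of \<open>\<Gamma>\<close> cancel because partial derivatives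
  commute, the mixed terms cancel in pairs, and the cubic terms form the Jacobi identity for
  commutators. The Christoffel terms belonging to i, j and k themselves are absent: by torsion
  freeness they cancel in the cyclic sum.\<close>

lemma bianchi_curv: assumes "x \<in> S"
  shows "(pd k (curv i j) x + \<Gamma> k x ** curv i j x - curv i j x ** \<Gamma> k x)
    + (pd i (curv j k) x + \<Gamma> i x ** curv j k x - curv j k x ** \<Gamma> i x)
    + (pd j (curv k i) x + \<Gamma> j x ** curv k i x - curv k i x ** \<Gamma> j x) = 0"
proof -
  have "pd k (curv i j) x = pd k (pd i (\<Gamma> j)) x - pd k (pd j (\<Gamma> i)) x
      + (\<Gamma> i x ** pd k (\<Gamma> j) x + pd k (\<Gamma> i) x ** \<Gamma> j x)
      - (\<Gamma> j x ** pd k (\<Gamma> i) x + pd k (\<Gamma> j) x ** \<Gamma> i x)" for i j k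
    unfolding curv_def by (simp add: pd_rules[OF assms] smooth_intros smooth_Gamma)
  note d = this
  show ?thesis
    unfolding d pd_commute[OF assms smooth_Gamma, of k i j] pd_commute[OF assms smooth_Gamma, of k j i]
      pd_commute[OF assms smooth_Gamma, of i j k]
    by (simp add: curv_def mat_simps)
qed

text \<open>As \<open>inv_G\<close> is parallel, raising the index commutes with covariant
  differentiation, so each bracket is the previous one times \<open>inv_G x\<close>.\<close>

lemma bianchi_curv_up: assumes "x \<in> S"
  shows "(pd k (curv_up i j) x + \<Gamma> k x ** curv_up i j x + curv_up i j x ** transpose (\<Gamma> k x))
    + (pd i (curv_up j k) x + \<Gamma> i x ** curv_up j k x + curv_up j k x ** transpose (\<Gamma> i x))
    + (pd j (curv_up k i) x + \<Gamma> j x ** curv_up k i x + curv_up k i x ** transpose (\<Gamma> j x)) = 0"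
proof -
  have *: "pd k (curv_up i j) x + \<Gamma> k x ** curv_up i j x + curv_up i j x ** transpose (\<Gamma> k x)
      = (pd k (curv i j) x + \<Gamma> k x ** curv i j x - curv i j x ** \<Gamma> k x) ** inv_G x" for i j k
    unfolding curv_up_def
    by (simp add: pd_rules[OF assms] smooth_curv smooth_inv_G pd_inv_G[OF assms] mat_simps algebra_simps)
  show ?thesis
    unfolding * mm.add_left[symmetric] bianchi_curv[OF assms] by (simp add: mm.zero_left)
qed

text \<open>The covariant divergence \<open>\<nabla>\<^sub>i Ric\<^sub>k\<^sup>i\<close>.\<close>

definition div_ricci :: "'n \<Rightarrow> real^'n \<Rightarrow> real" where
  "div_ricci k x = (\<Sum>i\<in>UNIV. pd i (ricci_up k i) x) + (\<Sum>i\<in>UNIV. \<Sum>p\<in>UNIV. \<Gamma> i x $ i $ p * ricci_up k p x)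
    - (\<Sum>i\<in>UNIV. \<Sum>p\<in>UNIV. \<Gamma> k x $ i $ p * ricci_up i p x)"

definition scalar :: "real^'n \<Rightarrow> real" where
  "scalar = (\<lambda>x. \<Sum>j\<in>UNIV. ricci_up j j x)"

lemma smooth_scalar: "smooth_on S scalar"
  unfolding scalar_def by (intro smooth_intros smooth_ricci_up)

text \<open>Skewness in each pair of indices turns every contraction across the two pairs into
  Ricci, up to sign.\<close>

lemma curv_up_contract:
  "(\<Sum>i\<in>UNIV. curv_up i j x $ i $ m) = ricci_up j m x"
  "(\<Sum>i\<in>UNIV. curv_up j i x $ i $ m) = - ricci_up j m x"
  "x \<in> S \<Longrightarrow> (\<Sum>i\<in>UNIV. curv_up i j x $ m $ i) = - ricci_up j m x"
  "x \<in> S \<Longrightarrow> (\<Sum>i\<in>UNIV. curv_up j i x $ m $ i) = ricci_up j m x"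
  by (simp_all add: ricci_up_def sum_negf curv_up_skew[of j _] curv_up_skew'[of x _ j m])

lemma pd_ricci_up: assumes "x \<in> S" shows "pd k (ricci_up j m) x = (\<Sum>i\<in>UNIV. pd k (curv_up i j) x $ i $ m)"
proof -
  have "smooth_on S (\<lambda>x. curv_up i j x $ i $ m)" for i
    by (rule smooth_on_nth[OF open_S smooth_on_nth[OF open_S smooth_curv_up]])
  then show ?thesis
    unfolding ricci_up_def by (simp add: pd_rules(8)[OF assms] pd_nth2[OF assms smooth_curv_up])
qed

lemma pd_curv_up_skew: assumes "x \<in> S"
  shows "pd k (curv_up j i) x = - pd k (curv_up i j) x" "pd k (curv_up i j) x $ l $ m = - (pd k (curv_up i j) x $ m $ l)"
proof -
  have "pd k (curv_up j i) x = pd k (\<lambda>x. - curv_up i j x) x"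
    by (rule pd_cong[OF assms smooth_curv_up curv_up_skew])
  then show "pd k (curv_up j i) x = - pd k (curv_up i j) x"
    by (simp add: pd_rules(3)[OF assms smooth_curv_up])
  have "pd k (\<lambda>x. transpose (curv_up i j x)) x = pd k (\<lambda>x. - curv_up i j x) x"
    by (rule pd_cong[OF assms _ transpose_curv_up])
      (rule smooth_on_bounded_linear[OF open_S bounded_linear_transpose smooth_curv_up])
  then have "transpose (pd k (curv_up i j) x) = - pd k (curv_up i j) x"
    by (simp add: pd_rules(3,7)[OF assms smooth_curv_up])
  from arg_cong[OF this, of "\<lambda>M. M $ m $ l"]
  show "pd k (curv_up i j) x $ l $ m = - (pd k (curv_up i j) x $ m $ l)"
    by (simp add: transpose_def)
qed

lemma pd_curv_up_contract: assumes "x \<in> S"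
  shows "(\<Sum>i\<in>UNIV. pd k (curv_up i j) x $ i $ m) = pd k (ricci_up j m) x"
    "(\<Sum>i\<in>UNIV. pd k (curv_up j i) x $ i $ m) = - pd k (ricci_up j m) x"
    "(\<Sum>i\<in>UNIV. pd k (curv_up i j) x $ m $ i) = - pd k (ricci_up j m) x"
  by (simp_all add: pd_ricci_up[OF assms] sum_negf pd_curv_up_skew(1)[OF assms, of k j]
      pd_curv_up_skew(2)[OF assms, of k _ j m])

text \<open>Contracting the directions i and j of the Bianchi identity with the row and the column
  leaves dR from the term in direction k and minus the divergence of Ricci from each of the other
  two. The Christoffel terms in direction k complete the two divergences.\<close>

lemma contracted_bianchi: assumes "x \<in> S" shows "pd k scalar x = 2 * div_ricci k x"
proof -
  have sw: "(\<Sum>j\<in>UNIV. \<Sum>p\<in>UNIV. a p * b j p) = (\<Sum>p\<in>UNIV. a p * (\<Sum>j\<in>UNIV. b j p))"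
    for a :: "'n \<Rightarrow> real" and b :: "'n \<Rightarrow> 'n \<Rightarrow> real"
    by (subst sum.swap) (simp add: sum_distrib_left)
  \<comment> \<open>A skew array contracted with a symmetric one. It removes the products of
    curvature, skew in its last pair, with \<open>\<Gamma>\<close>, symmetric by torsion
    freeness.\<close>
  have zero: "(\<Sum>i\<in>UNIV. \<Sum>p\<in>UNIV. a i p * b i p) = 0"
    if "\<And>i p. a i p = - a p i" "\<And>i p. b i p = b p i" for a b :: "'n \<Rightarrow> 'n \<Rightarrow> real"
  proof -
    have "(\<Sum>i\<in>UNIV. \<Sum>p\<in>UNIV. a i p * b i p) = (\<Sum>i\<in>UNIV. \<Sum>p\<in>UNIV. a p i * b p i)"
      by (rule sum.swap)
    also have "\<dots> = (\<Sum>i\<in>UNIV. \<Sum>p\<in>UNIV. - (a i p * b i p))"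
      by (intro sum.cong refl) (metis that minus_mult_left)
    also have "\<dots> = - (\<Sum>i\<in>UNIV. \<Sum>p\<in>UNIV. a i p * b i p)" by (simp add: sum_negf)
    finally show ?thesis by simp
  qed
  have b: "(pd k (curv_up i j) x $ i $ j + (\<Sum>p\<in>UNIV. \<Gamma> k x $ i $ p * curv_up i j x $ p $ j)
        + (\<Sum>p\<in>UNIV. \<Gamma> k x $ j $ p * curv_up i j x $ i $ p))
    + (pd i (curv_up j k) x $ i $ j + (\<Sum>p\<in>UNIV. \<Gamma> i x $ i $ p * curv_up j k x $ p $ j)
        + (\<Sum>p\<in>UNIV. curv_up j k x $ i $ p * \<Gamma> i x $ j $ p))
    + (pd j (curv_up k i) x $ i $ j + (\<Sum>p\<in>UNIV. curv_up k i x $ p $ j * \<Gamma> j x $ i $ p)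
        + (\<Sum>p\<in>UNIV. \<Gamma> j x $ j $ p * curv_up k i x $ i $ p)) = 0" for i j
    using arg_cong[OF bianchi_curv_up[OF assms, of k i j], of "\<lambda>M. M $ i $ j"]
    by (simp add: matrix_matrix_mult_def transpose_def mult.commute)
  \<comment> \<open>From here on, the nine sums of the contracted identity \<open>b\<close> are
    evaluated one by one, in order.\<close>
  have "(\<Sum>i\<in>UNIV. \<Sum>j\<in>UNIV. pd k (curv_up i j) x $ i $ j) = pd k scalar x"
    unfolding scalar_def pd_rules(8)[OF assms smooth_ricci_up] pd_ricci_up[OF assms] by (rule sum.swap)
  moreover have "(\<Sum>i\<in>UNIV. \<Sum>j\<in>UNIV. \<Sum>p\<in>UNIV. \<Gamma> k x $ i $ p * curv_up i j x $ p $ j)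
      = (\<Sum>i\<in>UNIV. \<Sum>p\<in>UNIV. \<Gamma> k x $ i $ p * ricci_up i p x)"
    unfolding sw curv_up_contract(4)[OF assms] ..
  moreover have "(\<Sum>i\<in>UNIV. \<Sum>j\<in>UNIV. \<Sum>p\<in>UNIV. \<Gamma> k x $ j $ p * curv_up i j x $ i $ p)
      = (\<Sum>i\<in>UNIV. \<Sum>p\<in>UNIV. \<Gamma> k x $ i $ p * ricci_up i p x)"
    by (subst sum.swap) (unfold sw curv_up_contract(1), rule refl)
  moreover have "(\<Sum>i\<in>UNIV. \<Sum>j\<in>UNIV. pd i (curv_up j k) x $ i $ j) = - (\<Sum>i\<in>UNIV. pd i (ricci_up k i) x)"
    unfolding pd_curv_up_contract(3)[OF assms] by (rule sum_negf)
  moreover have "(\<Sum>i\<in>UNIV. \<Sum>j\<in>UNIV. \<Sum>p\<in>UNIV. \<Gamma> i x $ i $ p * curv_up j k x $ p $ j)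
      = - (\<Sum>i\<in>UNIV. \<Sum>p\<in>UNIV. \<Gamma> i x $ i $ p * ricci_up k p x)"
    unfolding sw curv_up_contract(3)[OF assms] by (simp add: sum_negf)
  moreover have "(\<Sum>i\<in>UNIV. \<Sum>j\<in>UNIV. \<Sum>p\<in>UNIV. curv_up j k x $ i $ p * \<Gamma> i x $ j $ p) = 0"
    by (subst sum.swap, intro sum.neutral ballI zero)
      (rule curv_up_skew'[OF assms], rule Gamma_sym[OF assms])
  moreover have "(\<Sum>i\<in>UNIV. \<Sum>j\<in>UNIV. pd j (curv_up k i) x $ i $ j) = - (\<Sum>i\<in>UNIV. pd i (ricci_up k i) x)"
    by (subst sum.swap) (unfold pd_curv_up_contract(2)[OF assms], rule sum_negf)
  moreover have "(\<Sum>i\<in>UNIV. \<Sum>j\<in>UNIV. \<Sum>p\<in>UNIV. curv_up k i x $ p $ j * \<Gamma> j x $ i $ p) = 0"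
    by (intro sum.neutral ballI zero) (rule curv_up_skew'[OF assms], rule Gamma_sym[OF assms])
  moreover have "(\<Sum>i\<in>UNIV. \<Sum>j\<in>UNIV. \<Sum>p\<in>UNIV. \<Gamma> j x $ j $ p * curv_up k i x $ i $ p)
      = - (\<Sum>i\<in>UNIV. \<Sum>p\<in>UNIV. \<Gamma> i x $ i $ p * ricci_up k p x)"
    by (subst sum.swap) (unfold sw curv_up_contract(2), simp add: sum_negf)
  moreover have "(\<Sum>i\<in>UNIV. \<Sum>j\<in>UNIV.
      (pd k (curv_up i j) x $ i $ j + (\<Sum>p\<in>UNIV. \<Gamma> k x $ i $ p * curv_up i j x $ p $ j)
        + (\<Sum>p\<in>UNIV. \<Gamma> k x $ j $ p * curv_up i j x $ i $ p))
    + (pd i (curv_up j k) x $ i $ j + (\<Sum>p\<in>UNIV. \<Gamma> i x $ i $ p * curv_up j k x $ p $ j)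
        + (\<Sum>p\<in>UNIV. curv_up j k x $ i $ p * \<Gamma> i x $ j $ p))
    + (pd j (curv_up k i) x $ i $ j + (\<Sum>p\<in>UNIV. curv_up k i x $ p $ j * \<Gamma> j x $ i $ p)
        + (\<Sum>p\<in>UNIV. \<Gamma> j x $ j $ p * curv_up k i x $ i $ p))) = 0"
    unfolding b by simp
  ultimately show ?thesis
    unfolding sum.distrib div_ricci_def by (simp only:) simp
qed

end

text \<open>Induction on the index set, splitting off one index by the Schur complement \<open>c\<close>.\<close>

lemma symmetric_decomposition:
  fixes a :: "'i \<Rightarrow> 'i \<Rightarrow> real"
  assumes "finite I" "\<And>i j. i \<in> I \<Longrightarrow> j \<in> I \<Longrightarrow> a i j = a j i"
    and "\<And>v. \<exists>i\<in>I. v i \<noteq> 0 \<Longrightarrow> (\<Sum>i\<in>I. \<Sum>j\<in>I. v i * a i j * v j) > 0"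
  shows "\<exists>P. \<forall>i\<in>I. \<forall>j\<in>I. a i j = (\<Sum>k\<in>I. P i k * P j k)"
  using assms
proof (induction I arbitrary: a)
  case empty
  then show ?case by simp
next
  case (insert p I)
  have app: "a p p > 0"
    using insert.prems(2)[of "\<lambda>i. if i = p then 1 else 0"] insert.hyps
    by (simp add: if_distrib[of "\<lambda>x. x * _"] if_distrib[of "\<lambda>x. _ * x"] cong: if_cong)
  define c where "c i j = a i j - a i p * a j p / a p p" for i j
  have "\<exists>P. \<forall>i\<in>I. \<forall>j\<in>I. c i j = (\<Sum>k\<in>I. P i k * P j k)"
  proof (rule insert.IH)
    show "c i j = c j i" if "i \<in> I" "j \<in> I" for i j
      using that insert.prems(1) by (simp add: c_def)
  next
    fix v :: "'i \<Rightarrow> real" assume v: "\<exists>i\<in>I. v i \<noteq> 0"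
    define s where "s = (\<Sum>i\<in>I. a i p * v i)"
    \<comment> \<open>The value at p minimises the form of a among all extensions of v; the minimum
      is the form of c at v.\<close>
    define w where "w = v(p := - s / a p p)"
    have wI: "w i = v i" if "i \<in> I" for i using that insert.hyps by (auto simp: w_def)
    have sum1: "(\<Sum>i\<in>I. v i * a i p) = s" by (simp add: s_def mult.commute)
    have sum2: "(\<Sum>j\<in>I. a p j * v j) = s"
      unfolding s_def by (intro sum.cong refl) (use insert.prems(1) in auto)
    have "0 < (\<Sum>i\<in>insert p I. \<Sum>j\<in>insert p I. w i * a i j * w j)"
      by (rule insert.prems(2)) (use v wI in force)
    also have "\<dots> = w p * a p p * w p + w p * (\<Sum>j\<in>I. a p j * v j)
        + ((\<Sum>i\<in>I. v i * a i p) * w p + (\<Sum>i\<in>I. \<Sum>j\<in>I. v i * a i j * v j))"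
      using insert.hyps by (simp add: wI sum.distrib sum_distrib_left sum_distrib_right mult.assoc)
    also have "\<dots> = (\<Sum>i\<in>I. \<Sum>j\<in>I. v i * a i j * v j) - s * s / a p p"
      unfolding sum1 sum2 using app by (simp add: w_def field_simps)
    also have "s * s / a p p = (\<Sum>i\<in>I. \<Sum>j\<in>I. v i * (a i p * a j p / a p p) * v j)"
      unfolding s_def sum_product sum_divide_distrib by (intro sum.cong refl) (simp add: field_simps)
    also have "(\<Sum>i\<in>I. \<Sum>j\<in>I. v i * a i j * v j) - \<dots> = (\<Sum>i\<in>I. \<Sum>j\<in>I. v i * c i j * v j)"
      by (simp add: c_def algebra_simps sum_subtractf)
    finally show "0 < (\<Sum>i\<in>I. \<Sum>j\<in>I. v i * c i j * v j)" .
  qed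
  then obtain P where P: "\<And>i j. i \<in> I \<Longrightarrow> j \<in> I \<Longrightarrow> c i j = (\<Sum>k\<in>I. P i k * P j k)" by blast
  \<comment> \<open>Column p of a, scaled by the root of the pivot, becomes column p of Q; the other
    columns come from P with row p set to zero.\<close>
  define Q where "Q i k = (if k = p then a i p / sqrt (a p p) else if i = p then 0 else P i k)" for i k
  have "a i j = (\<Sum>k\<in>insert p I. Q i k * Q j k)" if ij: "i \<in> insert p I" "j \<in> insert p I" for i j
  proof -
    have Qp: "Q i p * Q j p = a i p * a j p / a p p"
      using app by (simp add: Q_def)
    have QI: "(\<Sum>k\<in>I. Q i k * Q j k) = (if i = p \<or> j = p then 0 else (\<Sum>k\<in>I. P i k * P j k))"
      using insert.hyps by (auto simp: Q_def intro!: sum.neutral sum.cong)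
    show ?thesis
      using insert.hyps app ij insert.prems(1)[of p j] P[of i j]
      by (auto simp: Qp QI c_def)
  qed
  then show ?case by blast
qed

text \<open>For A an inverse metric the columns of P form an orthonormal frame.\<close>

lemma posdef_factor:
  fixes A :: "real^'n^'n"
  assumes "\<And>i j. A $ i $ j = A $ j $ i" "\<And>v. v \<noteq> 0 \<Longrightarrow> v \<bullet> (A *v v) > 0"
  obtains P :: "real^'n^'n" where "A = P ** transpose P"
proof -
  have "(\<Sum>i\<in>UNIV. \<Sum>j\<in>UNIV. v i * A $ i $ j * v j) > 0" if "\<exists>i\<in>UNIV. v i \<noteq> 0" for v
    using assms(2)[of "\<chi> i. v i"] that
    by (auto simp: vec_eq_iff inner_vec_def matrix_vector_mult_def sum_distrib_left mult.assoc)
  then have "\<exists>P. \<forall>i\<in>UNIV. \<forall>j\<in>UNIV. A $ i $ j = (\<Sum>k\<in>(UNIV :: 'n set). P i k * P j k)"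
    by (intro symmetric_decomposition[of UNIV "\<lambda>i j. A $ i $ j"]) (auto intro: assms(1))
  then obtain P where "\<And>i j. A $ i $ j = (\<Sum>k\<in>(UNIV :: 'n set). P i k * P j k)" by blast
  then have "A = (\<chi> i j. P i j) ** transpose (\<chi> i j. P i j)"
    by (simp add: vec_eq_iff matrix_matrix_mult_def transpose_def)
  then show ?thesis by (rule that)
qed

text \<open>With H = P P^T, cyclicity of the trace turns the expression into the trace of Q^2, where
  Q = P^T A P holds the components of A in the frame formed by the columns of P. As Q is symmetric,
  this is the sum of its squared entries.\<close>

lemma trace_square_weighted:
  fixes H A :: "real^'n^'n"
  assumes "\<And>i j. H $ i $ j = H $ j $ i" "\<And>v. v \<noteq> 0 \<Longrightarrow> v \<bullet> (H *v v) > 0" "transpose A = A"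
  shows "trace ((A ** H) ** (A ** H)) \<ge> 0"
    and "trace ((A ** H) ** (A ** H)) = 0 \<Longrightarrow> invertible H \<Longrightarrow> A = 0"
proof -
  obtain P :: "real^'n^'n" where P: "H = P ** transpose P" by (rule posdef_factor[OF assms(1,2)])
  define Q where "Q = transpose P ** A ** P"
  have symQ: "transpose Q = Q"
    by (simp add: Q_def matrix_transpose_mul assms(3) matrix_mul_assoc)
  have Qs: "Q $ k $ i = Q $ i $ k" for i k
    using arg_cong[OF symQ, of "\<lambda>M. M $ i $ k"] by (simp add: transpose_def)
  have "trace ((A ** H) ** (A ** H)) = trace ((A ** P) ** (transpose P ** A ** P ** transpose P))"
    by (simp add: P matrix_mul_assoc)
  also have "\<dots> = trace (Q ** Q)"
    by (subst trace_mul_sym) (simp add: Q_def matrix_mul_assoc)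
  also have "\<dots> = (\<Sum>i\<in>UNIV. \<Sum>k\<in>UNIV. Q $ i $ k * Q $ i $ k)"
    unfolding trace_def matrix_matrix_mult_def vec_lambda_beta
    by (intro sum.cong refl) (simp add: Qs[of _ i for i])
  finally have e: "trace ((A ** H) ** (A ** H)) = (\<Sum>i\<in>UNIV. \<Sum>k\<in>UNIV. Q $ i $ k * Q $ i $ k)" .
  then show "trace ((A ** H) ** (A ** H)) \<ge> 0" by (simp add: sum_nonneg)
  assume "trace ((A ** H) ** (A ** H)) = 0" "invertible H"
  then have "Q = 0"
    unfolding e by (auto simp: sum_nonneg_eq_0_iff sum_nonneg vec_eq_iff)
  \<comment> \<open>Going through H A H allows cancelling H, known to be invertible, rather than
    P.\<close>
  moreover have "H ** A ** H = P ** Q ** transpose P"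
    by (simp add: P Q_def matrix_mul_assoc)
  ultimately have "H ** A ** H = 0"
    by (simp add: mm.zero_left mm.zero_right)
  moreover have "(matrix_inv H ** H) ** A ** (H ** matrix_inv H)
      = matrix_inv H ** (H ** A ** H) ** matrix_inv H"
    by (simp only: matrix_mul_assoc)
  ultimately have "(matrix_inv H ** H) ** A ** (H ** matrix_inv H) = 0"
    by (simp only: mm.zero_left mm.zero_right)
  then show "A = 0" using matrix_inv[OF \<open>invertible H\<close>] by simp
qed

section \<open>The soliton equation in local coordinates\<close>

locale soliton_chart = metric_chart S G for S :: "(real^'n::finite) set" and G +
  fixes f :: "real^'n \<Rightarrow> real"
  assumes smooth_f: "smooth_on S f"
    and soliton: "x \<in> S \<Longrightarrow> ricci_coeff G i j x + hessian_coeff G f i j x = 0"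

definition differential :: "(real^'n::finite \<Rightarrow> real) \<Rightarrow> real^'n \<Rightarrow> real^'n" where
  "differential u = (\<lambda>x. \<chi> k. pd k u x)"

section \<open>Ricci, scalar curvature and Hessian in matrix form\<close>

context metric_chart
begin

lemma pd_christoffel: "x \<in> S \<Longrightarrow> pd i (christoffel G l j k) x = pd i (\<Gamma> j) x $ l $ k"
  using pd_nth2[OF _ smooth_Gamma, of x i j l k] by (simp add: \<Gamma>_def)

lemma ricci_coeff_curv: "x \<in> S \<Longrightarrow> ricci_coeff G j k x = (\<Sum>i\<in>UNIV. curv i j x $ i $ k)"
  by (simp add: ricci_coeff_def riemann_coeff_def partial_deriv_eq_pd pd_christoffel curv_def
      matrix_matrix_mult_def sum_subtractf sum.distrib) (simp add: \<Gamma>_def)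

lemma ricci_up_eq: "x \<in> S \<Longrightarrow> ricci_up j m x = (\<Sum>k\<in>UNIV. ricci_coeff G j k x * inv_G x $ k $ m)"
  unfolding ricci_up_def curv_up_def
  by (simp add: matrix_matrix_mult_def ricci_coeff_curv sum_distrib_right) (rule sum.swap)

lemma scalar_coeff_eq: "x \<in> S \<Longrightarrow> scalar_coeff G x = scalar x"
  by (simp add: scalar_coeff_def scalar_def ricci_up_eq inv_G_sym mult.commute flip: inv_G_def)

lemma hessian_coeff_Gamma:
  "hessian_coeff G u i j x = pd i (pd j u) x - (\<Sum>k\<in>UNIV. \<Gamma> i x $ k $ j * pd k u x)"
  by (simp add: hessian_coeff_def partial_deriv_eq_pd \<Gamma>_def)

lemma smooth_differential: "smooth_on S u \<Longrightarrow> smooth_on S (differential u)"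
  unfolding differential_def by (rule smooth_on_vec[OF open_S]) (simp add: smooth_on_dir_deriv)

text \<open>The Hessian as the covariant derivative of the covector field du: covectors are
  differentiated with minus the transposed connection matrix.\<close>

lemma hessian_row:
  assumes "x \<in> S" "smooth_on S u"
  shows "(pd i (differential u) x - transpose (\<Gamma> i x) *v differential u x) $ j = hessian_coeff G u i j x"
proof -
  have "pd i (differential u) x $ j = pd i (pd j u) x"
    using pd_nth[OF assms(1) smooth_differential[OF assms(2)], of i j] by (simp add: differential_def)
  then show ?thesis
    by (simp add: matrix_vector_mult_def vector_matrix_mult_def transpose_def hessian_coeff_Gamma
        differential_def mult.commute)
qed

lemma hessian_coeff_sym:
  "x \<in> S \<Longrightarrow> smooth_on S u \<Longrightarrow> hessian_coeff G u i j x = hessian_coeff G u j i x"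
  by (simp add: hessian_coeff_Gamma pd_commute[of x u i j] Gamma_sym[of x i _ j])

end

section \<open>Consequences of the soliton equation\<close>

context soliton_chart
begin

lemma scalar_coeff_hessian: "x \<in> S \<Longrightarrow>
    scalar_coeff G x = - (\<Sum>j\<in>UNIV. \<Sum>k\<in>UNIV. inv_G x $ j $ k * hessian_coeff G f j k x)"
  using soliton
  by (simp add: scalar_coeff_def inv_G_def eq_neg_iff_add_eq_0 distrib_left[symmetric] sum.distrib[symmetric])

text \<open>Ric inherits symmetry from the Hessian of f.\<close>

lemma ricci_sym: "x \<in> S \<Longrightarrow> ricci_coeff G i j x = ricci_coeff G j i x"
  using soliton[of x i j] soliton[of x j i] hessian_coeff_sym[OF _ smooth_f, of x i j] by simp

definition grad :: "real^'n \<Rightarrow> real^'n" where "grad = (\<lambda>x. inv_G x *v differential f x)"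

definition ricci_up_vec :: "'n \<Rightarrow> real^'n \<Rightarrow> real^'n" where "ricci_up_vec j x = (\<chi> l. ricci_up j l x)"

lemma smooth_grad: "smooth_on S grad"
  unfolding grad_def by (intro smooth_intros smooth_inv_G smooth_differential[OF smooth_f])

lemma smooth_ricci_up_vec: "smooth_on S (ricci_up_vec j)"
  unfolding ricci_up_vec_def by (rule smooth_on_vec[OF open_S]) (simp add: smooth_ricci_up)

text \<open>The soliton equation with an index raised: the covariant derivative of the gradient of f
  in direction j is minus \<open>ricci_up_vec j\<close>. All derivatives of the gradient can thus be
  traded for Ricci.\<close>

lemma pd_grad: assumes "x \<in> S" shows "pd j grad x = - ricci_up_vec j x - \<Gamma> j x *v grad x"
proof -
  have 1: "(pd j (differential f) x - transpose (\<Gamma> j x) *v differential f x) $ k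
      = - ricci_coeff G j k x" for k
    using soliton[OF assms, of j k] hessian_row[OF assms smooth_f, of j k] by simp
  have "pd j grad x = inv_G x *v pd j (differential f) x + pd j inv_G x *v differential f x"
    unfolding grad_def by (rule pd_rules(6)[OF assms smooth_inv_G smooth_differential[OF smooth_f]])
  also have "\<dots> = inv_G x *v (pd j (differential f) x - transpose (\<Gamma> j x) *v differential f x) - \<Gamma> j x *v grad x"
    unfolding pd_inv_G[OF assms] grad_def
    by (simp add: mv.diff_left mv.diff_right mv.minus_left matrix_vector_mul_assoc
        del: transpose_matrix_vector)
  also have "inv_G x *v (pd j (differential f) x - transpose (\<Gamma> j x) *v differential f x) = - ricci_up_vec j x"
    by (subst vec_eq_iff, subst matrix_vector_mult_def, simp only: vec_lambda_beta 1)
      (simp add: ricci_up_vec_def ricci_up_eq[OF assms] sum_negf inv_G_sym[OF assms] mult.commute)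
  finally show ?thesis .
qed

lemma pd_ricci_up_vec: "x \<in> S \<Longrightarrow> pd i (ricci_up_vec j) x $ l = pd i (ricci_up j l) x"
  using pd_nth[OF _ smooth_ricci_up_vec, of x i j l] by (simp add: ricci_up_vec_def)

text \<open>The second derivatives of \<open>grad\<close> commute; expressing them twice through
  \<open>pd_grad\<close> produces the curvature term on one side and the skew derivative of Ricci on
  the other.\<close>

lemma curv_grad: assumes "x \<in> S"
  shows "curv i j x *v grad x = pd j (ricci_up_vec i) x - pd i (ricci_up_vec j) x + \<Gamma> j x *v ricci_up_vec i x - \<Gamma> i x *v ricci_up_vec j x"
proof -
  have "pd i (pd j grad) x = pd i (\<lambda>x. - ricci_up_vec j x - \<Gamma> j x *v grad x) x" for i j
    by (rule pd_cong[OF assms smooth_on_dir_deriv[OF smooth_grad] pd_grad])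
  moreover have "pd i (\<lambda>x. - ricci_up_vec j x - \<Gamma> j x *v grad x) x
      = - pd i (ricci_up_vec j) x - (\<Gamma> j x *v pd i grad x + pd i (\<Gamma> j) x *v grad x)" for i j
    by (simp add: pd_rules[OF assms] smooth_on_uminus[OF open_S] smooth_ricci_up_vec smooth_Gamma smooth_grad
        smooth_on_bilinear[OF open_S bounded_bilinear_matrix_vector_mult])
  ultimately have d: "pd i (pd j grad) x
      = - pd i (ricci_up_vec j) x - (\<Gamma> j x *v (- ricci_up_vec i x - \<Gamma> i x *v grad x) + pd i (\<Gamma> j) x *v grad x)" for i j
    using pd_grad[OF assms] by simp
  show ?thesis
    using pd_commute[OF assms smooth_grad, of i j] unfolding d curv_def
    by (simp add: mat_simps algebra_simps)
qed

text \<open>The trace of \<open>curv_grad\<close> gives Ric(\<nabla>f) = dR - div Ric, and the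
  contracted Bianchi identity makes the right-hand side equal to div Ric.\<close>

lemma pd_scalar_div: assumes "x \<in> S"
  shows "(\<Sum>m\<in>UNIV. ricci_coeff G j m x * grad x $ m) = div_ricci j x" and "pd j scalar x = 2 * div_ricci j x"
proof -
  have "(\<Sum>m\<in>UNIV. ricci_coeff G j m x * grad x $ m) = (\<Sum>i\<in>UNIV. (curv i j x *v grad x) $ i)"
    unfolding ricci_coeff_curv[OF assms] matrix_vector_mult_def vec_lambda_beta sum_distrib_right
    by (rule sum.swap)
  also have "\<dots> = pd j scalar x - div_ricci j x"
    unfolding curv_grad[OF assms] div_ricci_def scalar_def pd_rules(8)[OF assms smooth_ricci_up]
    by (simp add: matrix_vector_mult_def sum.distrib sum_subtractf pd_ricci_up_vec[OF assms]) (simp add: ricci_up_vec_def)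
  finally show "(\<Sum>m\<in>UNIV. ricci_coeff G j m x * grad x $ m) = div_ricci j x"
    using contracted_bianchi[OF assms] by simp
  show "pd j scalar x = 2 * div_ricci j x" by (rule contracted_bianchi[OF assms])
qed

lemma raised_pd_scalar: assumes "x \<in> S"
  shows "(\<Sum>j\<in>UNIV. inv_G x $ i $ j * pd j scalar x) = 2 * (\<Sum>m\<in>UNIV. ricci_up m i x * grad x $ m)"
proof -
  have "(\<Sum>j\<in>UNIV. inv_G x $ i $ j * pd j scalar x)
      = (\<Sum>j\<in>UNIV. \<Sum>m\<in>UNIV. 2 * (ricci_coeff G m j x * inv_G x $ j $ i * grad x $ m))"
    unfolding pd_scalar_div(2)[OF assms] pd_scalar_div(1)[OF assms, symmetric] sum_distrib_left
    by (intro sum.cong refl)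
      (simp add: ricci_sym[OF assms, of _ m for m] inv_G_sym[OF assms, of i])
  also have "\<dots> = 2 * (\<Sum>m\<in>UNIV. ricci_up m i x * grad x $ m)"
    unfolding ricci_up_eq[OF assms] sum_distrib_left sum_distrib_right by (rule sum.swap)
  finally show ?thesis .
qed

text \<open>Writing \<open>\<Delta>u - \<langle>\<nabla>f,\<nabla>u\<rangle>\<close> as \<open>g\<^sup>i\<^sup>j \<partial>\<^sub>i\<partial>\<^sub>j u + b\<^sup>j \<partial>\<^sub>j u\<close>, this is \<open>b\<^sup>j\<close>; the contraction of the Christoffel
  symbols with \<open>g\<^sup>i\<^sup>j\<close> is expressed through the divergence of \<open>g\<^sup>i\<^sup>j\<close>.\<close>

definition drift :: "'n \<Rightarrow> real^'n \<Rightarrow> real" where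
  "drift j x = (\<Sum>i\<in>UNIV. pd i inv_G x $ i $ j) + (\<Sum>i\<in>UNIV. \<Sum>p\<in>UNIV. \<Gamma> i x $ i $ p * inv_G x $ p $ j) - grad x $ j"

lemma smooth_drift: "smooth_on S (drift j)"
  unfolding drift_def
  by (intro smooth_on_diff[OF open_S] smooth_on_add[OF open_S] smooth_on_sum[OF open_S finite]
      smooth_on_mult[OF open_S] smooth_on_nth[OF open_S] smooth_on_dir_deriv smooth_inv_G smooth_Gamma smooth_grad)

text \<open>The divergence of the gradient of R is computed twice: directly, which gives \<Delta>R,
  and from \<open>raised_pd_scalar\<close> as the divergence of twice Ric(\<nabla>f).\<close>

lemma scalar_curvature_equation: assumes "x \<in> S"
  shows "(\<Sum>i\<in>UNIV. \<Sum>j\<in>UNIV. inv_G x $ i $ j * pd i (pd j scalar) x) + (\<Sum>j\<in>UNIV. drift j x * pd j scalar x)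
    = - 2 * (\<Sum>m\<in>UNIV. \<Sum>i\<in>UNIV. ricci_up m i x * ricci_up i m x)"
proof -
  \<comment> \<open>The gradient of R.\<close>
  define W where "W i x = (\<Sum>j\<in>UNIV. inv_G x $ i $ j * pd j scalar x)" for i x
  have smH: "smooth_on S (\<lambda>x. inv_G x $ i $ j)" for i j
    by (intro smooth_on_nth[OF open_S] smooth_inv_G)
  have smV: "smooth_on S (\<lambda>x. grad x $ m)" for m
    by (intro smooth_on_nth[OF open_S] smooth_grad)
  have smW: "smooth_on S (W i)" for i
    unfolding W_def
    by (intro smooth_on_sum[OF open_S finite] smooth_on_mult[OF open_S] smH smooth_on_dir_deriv smooth_scalar)
  have dW: "pd i (W i) x = (\<Sum>j\<in>UNIV. inv_G x $ i $ j * pd i (pd j scalar) x + pd i inv_G x $ i $ j * pd j scalar x)" for i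
    unfolding W_def
    by (simp add: pd_rules[OF assms] pd_nth2[OF assms smooth_inv_G] smH smooth_on_dir_deriv smooth_scalar
        smooth_on_mult[OF open_S])
  have "pd i (W i) x = pd i (\<lambda>x. \<Sum>m\<in>UNIV. 2 * (ricci_up m i x * grad x $ m)) x" for i
    by (rule pd_cong[OF assms smW]) (simp add: W_def raised_pd_scalar sum_distrib_left)
  then have dW': "pd i (W i) x
      = 2 * (\<Sum>m\<in>UNIV. ricci_up m i x * pd i grad x $ m + pd i (ricci_up m i) x * grad x $ m)" for i
    by (simp add: pd_rules[OF assms] pd_nth[OF assms smooth_grad] smV smooth_ricci_up
        smooth_on_mult[OF open_S] sum_distrib_left)
  have "(\<Sum>i\<in>UNIV. pd i (W i) x) + (\<Sum>i\<in>UNIV. \<Sum>p\<in>UNIV. \<Gamma> i x $ i $ p * W p x)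
    = (\<Sum>i\<in>UNIV. \<Sum>j\<in>UNIV. inv_G x $ i $ j * pd i (pd j scalar) x)
      + (\<Sum>j\<in>UNIV. (drift j x + grad x $ j) * pd j scalar x)"
  proof -
    have "(\<Sum>i\<in>UNIV. \<Sum>p\<in>UNIV. \<Gamma> i x $ i $ p * W p x)
        = (\<Sum>j\<in>UNIV. (\<Sum>i\<in>UNIV. \<Sum>p\<in>UNIV. \<Gamma> i x $ i $ p * inv_G x $ p $ j) * pd j scalar x)"
    proof -
      have "(\<Sum>i\<in>UNIV. \<Sum>p\<in>UNIV. \<Gamma> i x $ i $ p * W p x)
        = (\<Sum>i\<in>UNIV. \<Sum>p\<in>UNIV. \<Sum>j\<in>UNIV. \<Gamma> i x $ i $ p * inv_G x $ p $ j * pd j scalar x)"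
        by (simp add: W_def sum_distrib_left mult.assoc)
      also have "\<dots> = (\<Sum>i\<in>UNIV. \<Sum>j\<in>UNIV. \<Sum>p\<in>UNIV. \<Gamma> i x $ i $ p * inv_G x $ p $ j * pd j scalar x)"
        by (intro sum.cong refl sum.swap)
      also have "\<dots> = (\<Sum>j\<in>UNIV. \<Sum>i\<in>UNIV. \<Sum>p\<in>UNIV. \<Gamma> i x $ i $ p * inv_G x $ p $ j * pd j scalar x)"
        by (rule sum.swap)
      finally show ?thesis by (simp add: sum_distrib_right)
    qed
    moreover have "(\<Sum>i\<in>UNIV. \<Sum>j\<in>UNIV. pd i inv_G x $ i $ j * pd j scalar x)
        = (\<Sum>j\<in>UNIV. (\<Sum>i\<in>UNIV. pd i inv_G x $ i $ j) * pd j scalar x)"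
      unfolding sum_distrib_right by (rule sum.swap)
    ultimately show ?thesis
      unfolding dW drift_def sum.distrib by (simp add: sum.distrib distrib_right)
  qed
  \<comment> \<open>Here 2 (div Ric)(\<nabla>f) is dR(\<nabla>f), and Ric paired with the Hessian of
    f is minus the squared norm of Ric. The Christoffel terms in \<open>1\<close>, \<open>2\<close>
    and \<open>3\<close> cancel.\<close>
  moreover have "(\<Sum>i\<in>UNIV. pd i (W i) x) + (\<Sum>i\<in>UNIV. \<Sum>p\<in>UNIV. \<Gamma> i x $ i $ p * W p x)
    = (\<Sum>m\<in>UNIV. grad x $ m * pd m scalar x) - 2 * (\<Sum>m\<in>UNIV. \<Sum>i\<in>UNIV. ricci_up m i x * ricci_up i m x)"
  proof -
    have 1: "(\<Sum>i\<in>UNIV. \<Sum>m\<in>UNIV. pd i (ricci_up m i) x * grad x $ m)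
        = (\<Sum>m\<in>UNIV. grad x $ m * div_ricci m x)
          - (\<Sum>m\<in>UNIV. grad x $ m * (\<Sum>i\<in>UNIV. \<Sum>p\<in>UNIV. \<Gamma> i x $ i $ p * ricci_up m p x))
          + (\<Sum>m\<in>UNIV. grad x $ m * (\<Sum>i\<in>UNIV. \<Sum>p\<in>UNIV. \<Gamma> m x $ i $ p * ricci_up i p x))"
      by (subst sum.swap)
        (simp add: div_ricci_def algebra_simps sum.distrib sum_subtractf sum_distrib_left)
    have 2: "(\<Sum>i\<in>UNIV. \<Sum>p\<in>UNIV. \<Gamma> i x $ i $ p * W p x)
        = 2 * (\<Sum>m\<in>UNIV. grad x $ m * (\<Sum>i\<in>UNIV. \<Sum>p\<in>UNIV. \<Gamma> i x $ i $ p * ricci_up m p x))"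
    proof -
      have "(\<Sum>i\<in>UNIV. \<Sum>p\<in>UNIV. \<Gamma> i x $ i $ p * W p x)
        = 2 * (\<Sum>i\<in>UNIV. \<Sum>p\<in>UNIV. \<Sum>m\<in>UNIV. grad x $ m * (\<Gamma> i x $ i $ p * ricci_up m p x))"
        unfolding W_def raised_pd_scalar[OF assms] by (simp add: sum_distrib_left mult_ac)
      also have "(\<Sum>i\<in>UNIV. \<Sum>p\<in>UNIV. \<Sum>m\<in>UNIV. grad x $ m * (\<Gamma> i x $ i $ p * ricci_up m p x))
        = (\<Sum>i\<in>UNIV. \<Sum>m\<in>UNIV. \<Sum>p\<in>UNIV. grad x $ m * (\<Gamma> i x $ i $ p * ricci_up m p x))"
        by (intro sum.cong refl sum.swap)
      also have "\<dots> = (\<Sum>m\<in>UNIV. \<Sum>i\<in>UNIV. \<Sum>p\<in>UNIV. grad x $ m * (\<Gamma> i x $ i $ p * ricci_up m p x))"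
        by (rule sum.swap)
      finally show ?thesis by (simp add: sum_distrib_left)
    qed
    have 3: "(\<Sum>i\<in>UNIV. \<Sum>m\<in>UNIV. ricci_up m i x * pd i grad x $ m)
        = - (\<Sum>m\<in>UNIV. \<Sum>i\<in>UNIV. ricci_up m i x * ricci_up i m x)
          - (\<Sum>m\<in>UNIV. grad x $ m * (\<Sum>i\<in>UNIV. \<Sum>p\<in>UNIV. \<Gamma> m x $ i $ p * ricci_up i p x))"
    proof -
      have "(\<Sum>i\<in>UNIV. \<Sum>m\<in>UNIV. ricci_up m i x * pd i grad x $ m)
        = (\<Sum>i\<in>UNIV. \<Sum>m\<in>UNIV. - (ricci_up m i x * ricci_up i m x))
          - (\<Sum>i\<in>UNIV. \<Sum>m\<in>UNIV. \<Sum>p\<in>UNIV. ricci_up m i x * (\<Gamma> i x $ m $ p * grad x $ p))"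
        unfolding pd_grad[OF assms]
        by (simp add: ricci_up_vec_def matrix_vector_mult_def sum_distrib_left algebra_simps sum_subtractf)
      also have "(\<Sum>i\<in>UNIV. \<Sum>m\<in>UNIV. - (ricci_up m i x * ricci_up i m x)) = - (\<Sum>m\<in>UNIV. \<Sum>i\<in>UNIV. ricci_up m i x * ricci_up i m x)"
        by (simp add: sum_negf mult.commute)
      also have "(\<Sum>i\<in>UNIV. \<Sum>m\<in>UNIV. \<Sum>p\<in>UNIV. ricci_up m i x * (\<Gamma> i x $ m $ p * grad x $ p))
        = (\<Sum>m\<in>UNIV. \<Sum>i\<in>UNIV. \<Sum>p\<in>UNIV. ricci_up m i x * (\<Gamma> i x $ m $ p * grad x $ p))"
        by (rule sum.swap)
      also have "\<dots> = (\<Sum>m\<in>UNIV. \<Sum>p\<in>UNIV. \<Sum>i\<in>UNIV. ricci_up m i x * (\<Gamma> i x $ m $ p * grad x $ p))"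
        by (intro sum.cong refl sum.swap)
      also have "\<dots> = (\<Sum>p\<in>UNIV. \<Sum>m\<in>UNIV. \<Sum>i\<in>UNIV. ricci_up m i x * (\<Gamma> i x $ m $ p * grad x $ p))"
        by (rule sum.swap)
      also have "\<dots> = (\<Sum>m\<in>UNIV. grad x $ m * (\<Sum>i\<in>UNIV. \<Sum>p\<in>UNIV. \<Gamma> m x $ i $ p * ricci_up i p x))"
        unfolding sum_distrib_left
        by (intro sum.cong refl) (simp add: Gamma_sym[OF assms, of p m i for p m i] mult_ac)
      finally show ?thesis .
    qed
    have 4: "(\<Sum>m\<in>UNIV. grad x $ m * pd m scalar x) = 2 * (\<Sum>m\<in>UNIV. grad x $ m * div_ricci m x)"
      unfolding pd_scalar_div(2)[OF assms] by (simp add: sum_distrib_left mult_ac)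
    show ?thesis
      unfolding dW' sum_distrib_left[symmetric] sum.distrib 1 2 3 4 by simp
  qed
  ultimately show ?thesis by (simp add: distrib_right sum.distrib)
qed

lemma ricci_norm_square: assumes "x \<in> S"
  shows "(\<Sum>m\<in>UNIV. \<Sum>i\<in>UNIV. ricci_up m i x * ricci_up i m x) \<ge> 0"
    and "(\<Sum>m\<in>UNIV. \<Sum>i\<in>UNIV. ricci_up m i x * ricci_up i m x) = 0 \<Longrightarrow> ricci_coeff G i j x = 0"
proof -
  define A where "A = (\<chi> i j. ricci_coeff G i j x)"
  have A: "transpose A = A" using ricci_sym[OF assms] by (simp add: A_def transpose_def vec_eq_iff)
  have e: "(\<Sum>m\<in>UNIV. \<Sum>i\<in>UNIV. ricci_up m i x * ricci_up i m x) = trace ((A ** inv_G x) ** (A ** inv_G x))"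
    by (simp add: trace_def matrix_matrix_mult_def A_def ricci_up_eq[OF assms])
  have "invertible (inv_G x)" using G_inv_G[OF assms] by (auto simp: invertible_def)
  then show "(\<Sum>m\<in>UNIV. \<Sum>i\<in>UNIV. ricci_up m i x * ricci_up i m x) = 0 \<Longrightarrow> ricci_coeff G i j x = 0"
    using trace_square_weighted(2)[OF inv_G_sym[OF assms] inv_G_pos[OF assms] A] unfolding e
    by (auto simp: A_def vec_eq_iff)
  show "(\<Sum>m\<in>UNIV. \<Sum>i\<in>UNIV. ricci_up m i x * ricci_up i m x) \<ge> 0"
    unfolding e by (rule trace_square_weighted(1)[OF inv_G_sym[OF assms] inv_G_pos[OF assms] A])
qed

end

section \<open>The strong minimum principle\<close>

text \<open>The one-variable tests along the line z + t v. A negative second derivative would make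
  the first one negative just after t = 0, and w would fall below its value at z.\<close>

lemma local_min_derivatives:
  fixes w :: "'a::euclidean_space \<Rightarrow> real"
  assumes "open S" "smooth_on S w" "z \<in> S" "\<And>y. y \<in> S \<Longrightarrow> w z \<le> w y"
  shows "dir_deriv v w z = 0" "dir_deriv v (dir_deriv v w) z \<ge> 0"
proof -
  obtain e where e: "e > 0" "ball z e \<subseteq> S" using assms openE by blast
  define d where "d = e / (norm v + 1)"
  have "d > 0" using e by (simp add: d_def add_nonneg_pos)
  have inS: "z + t *\<^sub>R v \<in> S" if "\<bar>t\<bar> < d" for t
  proof -
    have "\<bar>t\<bar> * norm v \<le> \<bar>t\<bar> * (norm v + 1)" by (simp add: mult_left_mono)
    also have "\<dots> < d * (norm v + 1)" using that by (intro mult_strict_right_mono) (auto simp: add_nonneg_pos)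
    also have "\<dots> = e" using norm_ge_zero[of v] by (simp add: d_def add_nonneg_eq_0_iff)
    finally show ?thesis using e by (auto simp: dist_norm subset_iff)
  qed
  define p where "p t = w (z + t *\<^sub>R v)" for t
  have d1: "(p has_real_derivative dir_deriv v w (z + t *\<^sub>R v)) (at t)" if "\<bar>t\<bar> < d" for t
    unfolding p_def
    by (rule has_real_derivative_along_line[OF smooth_on_imp_differentiable[OF assms(2) inS[OF that]]])
  have d2: "((\<lambda>t. dir_deriv v w (z + t *\<^sub>R v)) has_real_derivative dir_deriv v (dir_deriv v w) z) (at 0)"
    using has_real_derivative_along_line[of "dir_deriv v w" z 0 v]
      smooth_on_imp_differentiable[OF smooth_on_dir_deriv[OF assms(2)] assms(3)] by simp
  show zero: "dir_deriv v w z = 0"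
    using DERIV_local_min[of p _ 0 d] d1[of 0] \<open>d > 0\<close> assms(4)[OF inS] by (auto simp: p_def)
  show "dir_deriv v (dir_deriv v w) z \<ge> 0"
  proof (rule ccontr)
    assume "\<not> ?thesis"
    then obtain d' where d': "d' > 0" "\<And>h. 0 < h \<Longrightarrow> h < d' \<Longrightarrow> dir_deriv v w (z + h *\<^sub>R v) < 0"
      using DERIV_neg_dec_right[OF d2] zero by auto
    define h where "h = min d d' / 2"
    have h: "0 < h" "h < d" "h < d'" using \<open>d > 0\<close> d' by (auto simp: h_def)
    have "\<exists>t. 0 < t \<and> t < h \<and> p h - p 0 = (h - 0) * dir_deriv v w (z + t *\<^sub>R v)"
      by (rule MVT2[OF h(1)]) (use h in \<open>auto intro!: d1\<close>)
    then obtain t where "0 < t" "t < h" "p h - p 0 = h * dir_deriv v w (z + t *\<^sub>R v)" by auto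
    then have "p h < p 0" using d'(2)[of t] h mult_pos_neg[of h] by force
    then show False using assms(4)[OF inS[of h]] h by (simp add: p_def)
  qed
qed

definition elliptic ::
    "(real^'n::finite \<Rightarrow> real^'n^'n) \<Rightarrow> ('n \<Rightarrow> real^'n \<Rightarrow> real) \<Rightarrow> (real^'n \<Rightarrow> real) \<Rightarrow> real^'n \<Rightarrow> real" where
  "elliptic a b u x =
     (\<Sum>i\<in>UNIV. \<Sum>j\<in>UNIV. a x $ i $ j * pd i (pd j u) x) + (\<Sum>j\<in>UNIV. b j x * pd j u x)"

section \<open>Elliptic operators and Hopf's argument\<close>

locale elliptic_operator = open_domain S for S :: "(real^'n::finite) set" +
  fixes a :: "real^'n \<Rightarrow> real^'n^'n" and b :: "'n \<Rightarrow> real^'n \<Rightarrow> real"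
  assumes continuous_a: "continuous_on S a" and continuous_b: "continuous_on S (b j)"
    and a_sym: "x \<in> S \<Longrightarrow> a x $ i $ j = a x $ j $ i"
    and a_pos: "x \<in> S \<Longrightarrow> v \<noteq> 0 \<Longrightarrow> v \<bullet> (a x *v v) > 0"
begin

text \<open>With a = P P^T at z, the second-order part is the sum of the second derivatives along
  the columns of P, each nonnegative at a minimum, and the first-order part vanishes there.\<close>

lemma elliptic_local_min:
  assumes "open U" "U \<subseteq> S" "smooth_on U w" "z \<in> U" "\<And>y. y \<in> U \<Longrightarrow> w z \<le> w y"
  shows "elliptic a b w z \<ge> 0"
proof -
  have zS: "z \<in> S" using assms by blast
  obtain P :: "real^'n^'n" where P: "a z = P ** transpose P"
    by (rule posdef_factor[OF a_sym[OF zS] a_pos[OF zS]])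
  define v where "v k = (\<chi> i. P $ i $ k)" for k
  have dif: "g differentiable at z" if "smooth_on U g" for g :: "real^'n \<Rightarrow> real"
    using smooth_on_imp_differentiable that assms(4) by blast
  have dd: "dir_deriv (v k) (dir_deriv (v k) w) z
      = (\<Sum>i\<in>UNIV. \<Sum>j\<in>UNIV. P $ i $ k * (P $ j $ k * pd i (pd j w) z))" for k
  proof -
    have sm: "smooth_on U (\<lambda>x. v k $ j *\<^sub>R pd j w x)" for j
      by (rule smooth_on_bounded_linear[OF assms(1) bounded_linear_scaleR_right
            smooth_on_dir_deriv[OF assms(3)]])
    have "dir_deriv (v k) (dir_deriv (v k) w) z = (\<Sum>i\<in>UNIV. v k $ i * pd i (dir_deriv (v k) w) z)"
      by (subst dir_deriv_expand[OF dif[OF smooth_on_dir_deriv[OF assms(3)]]]) simp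
    moreover have "pd i (dir_deriv (v k) w) z = (\<Sum>j\<in>UNIV. v k $ j * pd i (pd j w) z)" for i
    proof -
      have "pd i (dir_deriv (v k) w) z = pd i (\<lambda>x. \<Sum>j\<in>UNIV. v k $ j *\<^sub>R pd j w x) z"
        by (rule dir_deriv_cong[OF assms(1,4) dif[OF smooth_on_dir_deriv[OF assms(3)]]])
          (rule dir_deriv_expand, rule smooth_on_imp_differentiable[OF assms(3)])
      also have "\<dots> = (\<Sum>j\<in>UNIV. v k $ j * pd i (pd j w) z)"
        unfolding dir_deriv_sum[OF dif[OF sm]]
        using dir_deriv_bounded_linear[OF bounded_linear_scaleR_right
          dif[OF smooth_on_dir_deriv[OF assms(3)]]] by simp
      finally show ?thesis .
    qed
    ultimately show ?thesis by (simp add: v_def sum_distrib_left)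
  qed
  have "(\<Sum>i\<in>UNIV. \<Sum>j\<in>UNIV. a z $ i $ j * pd i (pd j w) z)
      = (\<Sum>i\<in>UNIV. \<Sum>j\<in>UNIV. \<Sum>k\<in>UNIV. P $ i $ k * (P $ j $ k * pd i (pd j w) z))"
    by (simp add: P matrix_matrix_mult_def transpose_def sum_distrib_right mult.assoc)
  also have "\<dots> = (\<Sum>i\<in>UNIV. \<Sum>k\<in>UNIV. \<Sum>j\<in>UNIV. P $ i $ k * (P $ j $ k * pd i (pd j w) z))"
    by (intro sum.cong refl sum.swap)
  also have "\<dots> = (\<Sum>k\<in>UNIV. dir_deriv (v k) (dir_deriv (v k) w) z)"
    unfolding dd by (rule sum.swap)
  also have "\<dots> \<ge> 0" by (intro sum_nonneg local_min_derivatives(2)[OF assms(1,3-5)])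
  finally have "0 \<le> (\<Sum>i\<in>UNIV. \<Sum>j\<in>UNIV. a z $ i $ j * pd i (pd j w) z)" .
  moreover have "pd j w z = 0" for j
    by (rule local_min_derivatives(1)[OF assms(1,3,4)]) (rule assms(5))
  ultimately show ?thesis unfolding elliptic_def by simp
qed

lemma elliptic_diff_scaled:
  assumes "smooth_on S u" "smooth_on S v" "x \<in> S"
  shows "elliptic a b (\<lambda>x. u x - c * v x) x = elliptic a b u x - c * elliptic a b v x"
proof -
  have d: "pd j (\<lambda>x. u x - c * v x) x = pd j u x - c * pd j v x"
    if "x \<in> S" "smooth_on S u" "smooth_on S v" for j x u v
    using that by (simp add: pd_rules smooth_on_mult[OF open_S])
  have dd: "pd i (pd j (\<lambda>x. u x - c * v x)) x = pd i (pd j u) x - c * pd i (pd j v) x" for i j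
  proof -
    have "pd i (pd j (\<lambda>x. u x - c * v x)) x = pd i (\<lambda>x. pd j u x - c * pd j v x) x"
      by (rule pd_cong[OF assms(3)]) (auto intro!: d assms smooth_on_dir_deriv
        smooth_on_diff[OF open_S] smooth_on_mult[OF open_S])
    then show ?thesis
      using d[OF assms(3) smooth_on_dir_deriv[OF assms(1)] smooth_on_dir_deriv[OF assms(2)]] by simp
  qed
  show ?thesis
    unfolding elliptic_def d[OF assms(3,1,2)] dd
    by (simp add: algebra_simps sum_subtractf sum.distrib sum_distrib_left)
qed

text \<open>The barrier is \<open>s + K s\<^sup>2\<close> instead of the usual exponential, so that only product rules are needed;
  it has the sign of \<open>s\<close> as long as \<open>K\<bar>s\<bar> < 1\<close>.\<close>

lemma elliptic_barrier:
  fixes y :: "real^'n" and r K :: real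
  assumes "x \<in> S"
  defines "s \<equiv> \<lambda>x. r\<^sup>2 - (x - y) \<bullet> (x - y)"
  shows "smooth_on S s"
    and "elliptic a b s x = - 2 * trace (a x) - 2 * (\<Sum>j\<in>UNIV. b j x * (x - y) $ j)"
    and "elliptic a b (\<lambda>x. s x + K * (s x * s x)) x
      = (1 + 2 * K * s x) * elliptic a b s x + 8 * K * ((x - y) \<bullet> (a x *v (x - y)))"
proof -
  show sm: "smooth_on S s"
    unfolding s_def
    by (intro smooth_on_diff[OF open_S] smooth_on_const smooth_on_ident[OF open_S]
        smooth_on_bilinear[OF open_S bounded_bilinear_inner])
  have ds: "pd j s = (\<lambda>x. - 2 * (x - y) $ j)" for j
  proof
    fix x
    have "(s has_derivative (\<lambda>h. - 2 * ((x - y) \<bullet> h))) (at x)"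
      unfolding s_def by (auto intro!: derivative_eq_intros simp: inner_commute)
    then show "pd j s x = - 2 * (x - y) $ j"
      using dir_deriv_eqI[of s _ x "axis j 1"] by (simp add: inner_axis)
  qed
  have dds: "pd i (\<lambda>x::real^'n. - 2 * (x - y) $ j) x = (if i = j then - 2 else 0)" for i j x
  proof -
    have "((\<lambda>x::real^'n. - 2 * (x - y) $ j) has_derivative (\<lambda>h. - 2 * (h - 0) $ j)) (at x)"
      by (intro has_derivative_mult_right bounded_linear.has_derivative[OF bounded_linear_vec_nth]
          has_derivative_diff has_derivative_ident has_derivative_const)
    from dir_deriv_eqI[OF this, of "axis i 1"] show ?thesis by (simp add: axis_def)
  qed
  show Ls: "elliptic a b s x = - 2 * trace (a x) - 2 * (\<Sum>j\<in>UNIV. b j x * (x - y) $ j)"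
  proof -
    have "(\<Sum>i\<in>UNIV. \<Sum>j\<in>UNIV. a x $ i $ j * (if i = j then - 2 else 0)) = - 2 * trace (a x)"
      by (simp add: if_distrib[of "\<lambda>y. _ * y"] trace_def sum_distrib_left sum_negf mult.commute cong: if_cong)
    moreover have "(\<Sum>j\<in>UNIV. b j x * (- 2 * (x - y) $ j)) = - 2 * (\<Sum>j\<in>UNIV. b j x * (x - y) $ j)"
      unfolding sum_distrib_left by (intro sum.cong refl) (simp add: algebra_simps)
    ultimately show ?thesis unfolding elliptic_def ds dds by simp
  qed
  have d1: "pd j (\<lambda>x. s x + K * (s x * s x)) x = (1 + 2 * K * s x) * pd j s x" if "x \<in> S" for j x
    using that sm
    by (simp add: pd_rules smooth_on_mult[OF open_S] algebra_simps)
  have d2: "pd i (pd j (\<lambda>x. s x + K * (s x * s x))) x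
      = (1 + 2 * K * s x) * pd i (pd j s) x + 2 * K * pd i s x * pd j s x" for i j
  proof -
    have "pd i (pd j (\<lambda>x. s x + K * (s x * s x))) x = pd i (\<lambda>x. (1 + 2 * K * s x) * pd j s x) x"
      by (rule pd_cong[OF assms(1)]) (auto intro!: d1 sm smooth_on_dir_deriv
        smooth_on_add[OF open_S] smooth_on_mult[OF open_S])
    also have "\<dots> = (1 + 2 * K * s x) * pd i (pd j s) x + 2 * K * pd i s x * pd j s x"
      using sm by (simp add: pd_rules[OF assms(1)] smooth_on_mult[OF open_S] smooth_on_add[OF open_S] smooth_on_dir_deriv)
    finally show ?thesis .
  qed
  \<comment> \<open>The only source of a definite sign: away from y this form is positive, and its
    factor K can be chosen large.\<close>
  have q: "(\<Sum>i\<in>UNIV. \<Sum>j\<in>UNIV. a x $ i $ j * (pd i s x * pd j s x)) = 4 * ((x - y) \<bullet> (a x *v (x - y)))"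
    unfolding ds inner_vec_def matrix_vector_mult_def vec_lambda_beta inner_real_def sum_distrib_left
    by (intro sum.cong refl) (simp add: algebra_simps)
  have "elliptic a b (\<lambda>x. s x + K * (s x * s x)) x
    = (1 + 2 * K * s x) * elliptic a b s x
      + 2 * K * (\<Sum>i\<in>UNIV. \<Sum>j\<in>UNIV. a x $ i $ j * (pd i s x * pd j s x))"
    unfolding elliptic_def d1[OF assms(1)] d2
    by (simp add: distrib_left sum.distrib sum_distrib_left mult_ac)
  then show "elliptic a b (\<lambda>x. s x + K * (s x * s x)) x
      = (1 + 2 * K * s x) * elliptic a b s x + 8 * K * ((x - y) \<bullet> (a x *v (x - y)))"
    unfolding q by simp
qed

text \<open>On the boundary of a small ball around z the function w = u - \<epsilon> v stays above
  m, while w = m at z. Hence w has an interior minimum, which is impossible where u is a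
  supersolution and the barrier v is a strict subsolution.\<close>

lemma hopf_touching:
  assumes u: "smooth_on S u" "\<And>x. x \<in> S \<Longrightarrow> elliptic a b u x \<le> 0" "\<And>x. x \<in> S \<Longrightarrow> m \<le> u x"
    and z: "z \<in> S" "u z = m" "dist y z = r" "r > 0"
    and touch: "\<And>x. x \<in> cball y r \<Longrightarrow> x \<in> S \<Longrightarrow> x \<noteq> z \<Longrightarrow> u x > m"
  shows False
proof -
  define s where "s = (\<lambda>x. r\<^sup>2 - (x - y) \<bullet> (x - y))"
  have s_dist: "s x = r\<^sup>2 - (dist y x)\<^sup>2" for x
    by (simp add: s_def dist_norm norm_minus_commute power2_norm_eq_inner)
  have sm_s: "smooth_on S s" and Ls: "elliptic a b s x = - 2 * trace (a x) - 2 * (\<Sum>j\<in>UNIV. b j x * (x - y) $ j)"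
    and Lv: "elliptic a b (\<lambda>x. s x + K * (s x * s x)) x
      = (1 + 2 * K * s x) * elliptic a b s x + 8 * K * ((x - y) \<bullet> (a x *v (x - y)))" if "x \<in> S" for x K
    using elliptic_barrier[OF that, of r y] unfolding s_def by blast+
  have sm_s: "smooth_on S s" using sm_s z(1) by blast
  obtain d0 where d0: "d0 > 0" "cball z d0 \<subseteq> S" using open_contains_cball open_S z(1) by blast
  \<comment> \<open>The bound r/2 keeps the ball away from y, so that the quadratic form in x - y
    has a positive minimum l on it.\<close>
  define d1 where "d1 = min d0 (r / 2)"
  have d1: "d1 > 0" "cball z d1 \<subseteq> S" using d0 z by (auto simp: d1_def)
  have ne: "x - y \<noteq> 0" if "x \<in> cball z d1" for x
    using that z by (auto simp: d1_def dist_commute)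
  have cont_a: "continuous_on (cball z d1) (\<lambda>x. a x $ i $ j)" for i j
    by (intro continuous_intros continuous_on_subset[OF continuous_a d1(2)])
  have "continuous_on (cball z d1) (\<lambda>x. - 2 * trace (a x) - 2 * (\<Sum>j\<in>UNIV. b j x * (x - y) $ j))"
    unfolding trace_def
    by (intro continuous_intros cont_a continuous_on_subset[OF continuous_b d1(2)])
  then have "bounded ((\<lambda>x. - 2 * trace (a x) - 2 * (\<Sum>j\<in>UNIV. b j x * (x - y) $ j)) ` cball z d1)"
    by (intro compact_imp_bounded compact_continuous_image compact_cball)
  then obtain C where C': "\<And>x. x \<in> cball z d1 \<Longrightarrow>
      norm (- 2 * trace (a x) - 2 * (\<Sum>j\<in>UNIV. b j x * (x - y) $ j)) \<le> C"
    unfolding bounded_iff by blast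
  have C: "\<bar>elliptic a b s x\<bar> \<le> C" if "x \<in> cball z d1" for x
    using C'[OF that] Ls[of x] that d1(2) by (metis real_norm_def subsetD)
  have "C \<ge> 0" using C[of z] d1(1) abs_ge_zero[of "elliptic a b s z"] by (auto intro: order_trans)
  have "continuous_on (cball z d1) (\<lambda>x. (x - y) \<bullet> (a x *v (x - y)))"
    unfolding inner_vec_def matrix_vector_mult_def vec_lambda_beta inner_real_def
    by (intro continuous_intros cont_a)
  moreover have "cball z d1 \<noteq> {}" using d1(1) by simp
  ultimately obtain x1 where x1: "x1 \<in> cball z d1"
    "\<And>x. x \<in> cball z d1 \<Longrightarrow> (x1 - y) \<bullet> (a x1 *v (x1 - y)) \<le> (x - y) \<bullet> (a x *v (x - y))"
    using continuous_attains_inf[OF compact_cball] by blast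
  define l where "l = (x1 - y) \<bullet> (a x1 *v (x1 - y))"
  have "l > 0" unfolding l_def using a_pos ne[OF x1(1)] x1(1) d1(2) by blast
  \<comment> \<open>Chosen so that 8 K l = 8 (C + 1) beats 2 C, the bound on the remaining term of
    the operator applied to the barrier.\<close>
  define K where "K = (C + 1) / l"
  have K: "K > 0" "K * l = C + 1" using \<open>l > 0\<close> \<open>C \<ge> 0\<close> by (auto simp: K_def)
  \<comment> \<open>As s vanishes at z, near z the factor 1 + 2 K s is at most 2 in absolute value
    and 1 + K s lies between 1/2 and 2.\<close>
  have "continuous_on S s" by (rule smooth_on_imp_continuous_on[OF sm_s])
  moreover have "s z = 0" using z by (simp add: s_dist)
  moreover have "1 / (2 * K) > 0" using K(1) by simp
  ultimately have "\<exists>d2>0. \<forall>x\<in>S. dist x z < d2 \<longrightarrow> \<bar>s x\<bar> < 1 / (2 * K)"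
    using z(1) unfolding continuous_on_iff dist_real_def by fastforce
  then obtain d2 where d2: "d2 > 0" "\<And>x. x \<in> S \<Longrightarrow> dist x z < d2 \<Longrightarrow> \<bar>s x\<bar> < 1 / (2 * K)" by blast
  define d where "d = min d1 (d2 / 2)"
  have d: "d > 0" "cball z d \<subseteq> cball z d1" "cball z d \<subseteq> S" using d1 d2 by (auto simp: d_def)
  have Ks: "\<bar>2 * K * s x\<bar> \<le> 1" if "x \<in> cball z d" for x
  proof -
    have "dist x z < d2" using that d2(1) by (simp add: d_def dist_commute)
    then have "\<bar>s x\<bar> < 1 / (2 * K)" using d2(2) that d(3) by blast
    then show ?thesis using K(1) by (simp add: abs_mult field_simps)
  qed
  define v where "v = (\<lambda>x. s x + K * (s x * s x))"
  have Lv_pos: "elliptic a b v x > 0" if "x \<in> cball z d" for x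
  proof -
    have "\<bar>(1 + 2 * K * s x) * elliptic a b s x\<bar> \<le> 2 * C"
      unfolding abs_mult by (intro mult_mono) (use Ks[OF that] C that d(2) in \<open>auto simp: abs_le_iff\<close>)
    moreover have "8 * K * ((x - y) \<bullet> (a x *v (x - y))) \<ge> 8 * K * l"
      unfolding l_def by (intro mult_left_mono x1(2)) (use that d(2) K(1) in auto)
    ultimately show ?thesis
      using Lv[of x K] that d(3) K(2) \<open>C \<ge> 0\<close> unfolding v_def by (auto simp: abs_le_iff)
  qed
  have v_fac: "v x = s x * (1 + K * s x)" for x by (simp add: v_def algebra_simps)
  have fac: "1 + K * s x \<ge> 1/2" "1 + K * s x \<le> 2" if "x \<in> cball z d" for x
    using Ks[OF that] by (auto simp: abs_le_iff)
  have sm_v: "smooth_on S v"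
    unfolding v_def by (intro smooth_on_add[OF open_S] smooth_on_mult[OF open_S] smooth_on_const sm_s)
  \<comment> \<open>The part of the small sphere inside the touching ball. It is compact and omits
    z, so u exceeds m on it by some margin \<eta>.\<close>
  define Q where "Q = sphere z d \<inter> cball y r"
  have Q: "u x > m" if "x \<in> Q" for x
    using that touch[of x] d by (auto simp: Q_def subset_iff)
  obtain \<eta> where \<eta>: "\<eta> > 0" "\<And>x. x \<in> Q \<Longrightarrow> u x \<ge> m + \<eta>"
  proof (cases "Q = {}")
    case True
    then show ?thesis using that[of 1] by simp
  next
    case False
    have "compact Q" unfolding Q_def by (intro compact_Int compact_sphere compact_cball)
    have "Q \<subseteq> S" using d by (auto simp: Q_def)
    then have "continuous_on Q u"
      by (rule continuous_on_subset[OF smooth_on_imp_continuous_on[OF u(1)]])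
    then obtain q where "q \<in> Q" "\<And>x. x \<in> Q \<Longrightarrow> u q \<le> u x"
      using continuous_attains_inf[OF \<open>compact Q\<close> False, of u] by blast
    then show ?thesis using that[of "u q - m"] Q by auto
  qed
  \<comment> \<open>On Q the barrier is at most 2 r^2; the added 1 makes \<epsilon> v strictly
    smaller than \<eta>.\<close>
  define \<epsilon> where "\<epsilon> = \<eta> / (2 * r\<^sup>2 + 1)"
  have rp: "2 * r\<^sup>2 + 1 > 0" by (simp add: add_nonneg_pos)
  then have \<epsilon>: "\<epsilon> > 0" "\<epsilon> * (2 * r\<^sup>2 + 1) = \<eta>" using \<eta>(1) by (auto simp: \<epsilon>_def)
  define w where "w = (\<lambda>x. u x - \<epsilon> * v x)"
  \<comment> \<open>Inside the touching ball the margin \<eta> absorbs \<epsilon> v; outside it the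
    barrier is negative, so u \<ge> m suffices.\<close>
  have w_sphere: "w x > m" if x: "x \<in> sphere z d" for x
  proof (cases "x \<in> cball y r")
    case True
    then have "x \<in> Q" using x by (simp add: Q_def)
    have "s x \<ge> 0" using True by (simp add: s_dist power_mono)
    have "v x \<le> r\<^sup>2 * 2"
      unfolding v_fac using \<open>s x \<ge> 0\<close> fac[of x] x by (intro mult_mono) (auto simp: s_dist)
    then have "\<epsilon> * v x \<le> \<epsilon> * (2 * r\<^sup>2)" using \<epsilon>(1) by (intro mult_left_mono) auto
    also have "\<dots> < \<eta>" using \<epsilon> by (simp add: algebra_simps)
    finally show ?thesis using \<eta>(2)[OF \<open>x \<in> Q\<close>] by (simp add: w_def)
  next
    case False
    then have "s x < 0" using z by (simp add: s_dist power_strict_mono)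
    moreover have "1 + K * s x > 0" using fac(1)[of x] x by auto
    ultimately have "\<epsilon> * v x < 0" unfolding v_fac using \<epsilon>(1) by (intro mult_pos_neg mult_neg_pos)
    moreover have "u x \<ge> m" using u(3) x d(3) by auto
    ultimately show ?thesis by (simp add: w_def)
  qed
  have sm_w: "smooth_on S w"
    unfolding w_def by (intro smooth_on_diff[OF open_S] smooth_on_mult[OF open_S] smooth_on_const sm_v u)
  have "continuous_on (cball z d) w"
    by (rule continuous_on_subset[OF smooth_on_imp_continuous_on[OF sm_w] d(3)])
  moreover have "cball z d \<noteq> {}" using d(1) by simp
  ultimately obtain p where p: "p \<in> cball z d" "\<And>x. x \<in> cball z d \<Longrightarrow> w p \<le> w x"
    using continuous_attains_inf[OF compact_cball] by blast
  have "w p \<le> m" using p(2)[of z] d(1) z(2) \<open>s z = 0\<close> by (simp add: w_def v_fac)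
  then have "p \<in> ball z d" using p(1) w_sphere[of p] by (auto simp: order_le_less)
  then have "elliptic a b w p \<ge> 0"
    using d(3) p(2)
    by (intro elliptic_local_min[of "ball z d"] smooth_on_subset[OF sm_w]) (auto simp: subset_iff)
  moreover have "elliptic a b w p = elliptic a b u p - \<epsilon> * elliptic a b v p"
    unfolding w_def by (rule elliptic_diff_scaled[OF u(1) sm_v]) (use p(1) d(3) in blast)
  moreover have "\<epsilon> * elliptic a b v p > 0" using \<epsilon>(1) Lv_pos[OF p(1)] by simp
  moreover have "elliptic a b u p \<le> 0" using u(2) p(1) d(3) by blast
  ultimately show False by linarith
qed

text \<open>If u were not m at some x1 near x0, a point z of the minimum set nearest to x1 would
  allow a ball that touches this set at z alone, contrary to \<open>hopf_touching\<close>.\<close>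

lemma strong_minimum_principle:
  assumes u: "smooth_on S u" "\<And>x. x \<in> S \<Longrightarrow> elliptic a b u x \<le> 0" "\<And>x. x \<in> S \<Longrightarrow> m \<le> u x"
    and x0: "x0 \<in> S" "u x0 = m"
  shows "\<exists>e>0. ball x0 e \<subseteq> S \<and> (\<forall>x\<in>ball x0 e. u x = m)"
proof -
  obtain e where e: "e > 0" "cball x0 e \<subseteq> S" using open_contains_cball open_S x0(1) by blast
  \<comment> \<open>With radius e/2 for x1, the points within the distance from x1 to z still lie in
    \<open>cball x0 e\<close>, where Z is closed.\<close>
  have "u x1 = m" if x1: "x1 \<in> ball x0 (e / 2)" for x1
  proof (rule ccontr)
    assume ne: "u x1 \<noteq> m"
    define Z where "Z = {x \<in> cball x0 e. u x = m}"
    have "continuous_on (cball x0 e) u"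
      by (rule continuous_on_subset[OF smooth_on_imp_continuous_on[OF u(1)] e(2)])
    then have "closed Z"
      unfolding Z_def by (intro continuous_closed_preimage_constant closed_cball)
    moreover have "x0 \<in> Z" using x0 e by (simp add: Z_def)
    ultimately obtain z where z: "z \<in> Z" "\<And>x. x \<in> Z \<Longrightarrow> dist x1 z \<le> dist x1 x"
      using distance_attains_inf[of Z x1] by blast
    \<comment> \<open>The ball around x1 through z may meet Z at several points of its boundary. The
      ball with diameter from x1 to z is contained in it and shares only the boundary point
      z.\<close>
    define y where "y = midpoint x1 z"
    define r where "r = dist x1 z / 2"
    have "x1 \<noteq> z" using ne z(1) by (auto simp: Z_def)
    then have r: "r > 0" by (simp add: r_def)
    have yz: "dist y z = r" and yx1: "dist y x1 = r"
      by (simp_all add: y_def r_def dist_midpoint)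
    have "r < e / 4" using z(2)[OF \<open>x0 \<in> Z\<close>] x1 by (simp add: r_def dist_commute)
    have "u x > m" if x: "x \<in> cball y r" "x \<noteq> z" "x \<in> S" for x
    proof -
      have "dist x1 x \<le> 2 * r" using x(1) yx1 dist_triangle[of x1 x y] by (simp add: dist_commute)
      then have "dist x0 x \<le> e"
        using dist_triangle[of x0 x x1] x1 \<open>r < e / 4\<close> by (simp add: dist_commute)
      have "x \<notin> Z"
      proof
        assume "x \<in> Z"
        then have "norm ((x - y) + (y - x1)) \<ge> 2 * r"
          using z(2)[of x] by (simp add: r_def dist_norm norm_minus_commute)
        then have "(norm ((x - y) + (y - x1)))\<^sup>2 \<ge> (2 * r)\<^sup>2" using r by (intro power_mono) auto
        moreover have "(norm (x - y))\<^sup>2 \<le> r\<^sup>2"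
          using x(1) by (intro power_mono) (auto simp: dist_norm norm_minus_commute)
        moreover have "(norm (y - x1))\<^sup>2 = r\<^sup>2" using yx1 by (simp add: dist_norm)
        \<comment> \<open>The parallelogram law settles the equality case: vectors of length at most
          r whose sum has length at least 2 r are equal.\<close>
        moreover have "(norm (p + q))\<^sup>2 + (norm (p - q))\<^sup>2 = 2 * (norm p)\<^sup>2 + 2 * (norm q)\<^sup>2"
          for p q :: "real^'n"
          by (simp add: power2_norm_eq_inner inner_add_left inner_add_right inner_diff_left
              inner_diff_right)
        then have "(norm ((x - y) + (y - x1)))\<^sup>2 + (norm ((x - y) - (y - x1)))\<^sup>2
            = 2 * (norm (x - y))\<^sup>2 + 2 * (norm (y - x1))\<^sup>2" .
        moreover have "(2 * r)\<^sup>2 = 4 * r\<^sup>2" by (simp add: power_mult_distrib)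
        ultimately have "(norm ((x - y) - (y - x1)))\<^sup>2 \<le> 0" by linarith
        then have "(x - y) - (y - x1) = 0" by (metis norm_eq_zero power2_less_eq_zero_iff)
        then have "x = y + (y - x1)" by (metis right_minus_eq diff_eq_eq add.commute)
        also have "\<dots> = z" by (simp add: y_def midpoint_def algebra_simps flip: scaleR_2)
        finally show False using x(2) by simp
      qed
      then have "u x \<noteq> m" using \<open>dist x0 x \<le> e\<close> by (simp add: Z_def)
      then show ?thesis using u(3)[OF x(3)] by simp
    qed
    then show False
      using hopf_touching[OF u _ _ yz r] z(1) e(2) by (auto simp: Z_def)
  qed
  moreover have "ball x0 (e / 2) \<subseteq> S" using e by (auto simp: subset_iff)
  ultimately show ?thesis using e(1) by (intro exI[of _ "e / 2"]) simp
qed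

end

section \<open>The minimum principle for the scalar curvature\<close>

context soliton_chart
begin

lemma continuous_scalar_coeff: "continuous_on S (scalar_coeff G)"
  using smooth_on_imp_continuous_on[OF smooth_scalar] scalar_coeff_eq by (simp cong: continuous_on_cong)

lemma elliptic_scalar: "x \<in> S \<Longrightarrow> elliptic inv_G drift scalar x = - 2 * (\<Sum>m\<in>UNIV. \<Sum>i\<in>UNIV. ricci_up m i x * ricci_up i m x)"
  unfolding elliptic_def by (rule scalar_curvature_equation)

lemma scalar_coeff_local_min:
  assumes "x0 \<in> S" "\<And>x. x \<in> S \<Longrightarrow> scalar_coeff G x0 \<le> scalar_coeff G x"
  shows "\<exists>e>0. \<forall>x\<in>ball x0 e. scalar_coeff G x = scalar_coeff G x0"
proof -
  interpret elliptic_operator S inv_G drift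
    using smooth_on_imp_continuous_on[OF smooth_inv_G] smooth_on_imp_continuous_on[OF smooth_drift]
      inv_G_sym inv_G_pos open_S by unfold_locales
  have "elliptic inv_G drift scalar x \<le> 0" if "x \<in> S" for x
    using elliptic_scalar[OF that] ricci_norm_square(1)[OF that] by simp
  moreover have "scalar x0 \<le> scalar x" if "x \<in> S" for x
    using assms(2)[OF that] by (simp add: scalar_coeff_eq assms(1) that)
  ultimately have "\<exists>e>0. ball x0 e \<subseteq> S \<and> (\<forall>x\<in>ball x0 e. scalar x = scalar x0)"
    by (intro strong_minimum_principle smooth_scalar assms(1) refl)
  then obtain e where e: "e > 0" "ball x0 e \<subseteq> S" "\<forall>x\<in>ball x0 e. scalar x = scalar x0" by blast
  have "\<forall>x\<in>ball x0 e. scalar_coeff G x = scalar_coeff G x0"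
    using e(2,3) scalar_coeff_eq assms(1) by (simp add: subset_iff)
  then show ?thesis using e(1) by blast
qed

text \<open>For constant R the elliptic expression vanishes, and the equation says that the squared
  norm of Ric is zero.\<close>

lemma ricci_zero_if_scalar_constant:
  assumes "\<And>x. x \<in> S \<Longrightarrow> scalar_coeff G x = m" "x \<in> S"
  shows "ricci_coeff G i j x = 0"
proof -
  have 1: "pd j scalar x = 0" if "x \<in> S" for j x
    using pd_cong[OF that smooth_scalar, of "\<lambda>x. m"] assms(1) scalar_coeff_eq by simp
  have 2: "pd i (pd j scalar) x = 0" for i j
    using pd_cong[OF assms(2) smooth_on_dir_deriv[OF smooth_scalar], of _ "\<lambda>x. 0"] 1 by simp
  have "elliptic inv_G drift scalar x = 0"
    unfolding elliptic_def by (simp add: 1[OF assms(2)] 2)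
  then show ?thesis
    using elliptic_scalar[OF assms(2)] ricci_norm_square(2)[OF assms(2)] by simp
qed

end

section \<open>Change of coordinates\<close>

text \<open>The braid argument behind the uniqueness of the Levi-Civita connection.\<close>

lemma skew_symmetric_zero:
  fixes c :: "'a \<Rightarrow> 'a \<Rightarrow> 'a \<Rightarrow> real"
  assumes "\<And>i l j. c i l j = c j l i" "\<And>i l j. c i l j = - c i j l"
  shows "c i l j = 0"
proof -
  have "c i l j = - c i j l" "c i j l = c l j i" "c l j i = - c l i j" "c l i j = c j i l"
    "c j i l = - c j l i" "c j l i = c i l j"
    by (rule assms)+
  then show ?thesis by linarith
qed

section \<open>Uniqueness of the Levi-Civita connection\<close>

context metric_chart
begin

text \<open>With its upper index lowered, the difference of two torsion-free metric connections is
  symmetric in i and j but skew in l and j, hence zero.\<close>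

lemma Gamma_unique:
  assumes "x \<in> S" "\<And>i. pd i G x = G x ** N i + transpose (N i) ** G x"
    and "\<And>i l j. N i $ l $ j = N j $ l $ i"
  shows "N i = \<Gamma> i x"
proof -
  define D where "D i = N i - \<Gamma> i x" for i
  have tG: "transpose (G x) = G x" by (rule transpose_G[OF assms(1)])
  have "G x ** D i + transpose (D i) ** G x = 0" for i
    using assms(2)[of i] pd_G[OF assms(1), of i]
    by (simp add: D_def mat_simps algebra_simps)
  then have skew: "(G x ** D i) + transpose (G x ** D i) = 0" for i
    by (simp add: matrix_transpose_mul tG)
  have "(G x ** D i) $ l $ j = 0" for i l j
  proof (rule skew_symmetric_zero[of "\<lambda>i l j. (G x ** D i) $ l $ j"])
    show "(G x ** D i) $ l $ j = (G x ** D j) $ l $ i" for i l j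
      by (simp add: matrix_matrix_mult_def D_def assms(3)[of i _ j] Gamma_sym[OF assms(1), of i _ j])
    show "(G x ** D i) $ l $ j = - (G x ** D i) $ j $ l" for i l j
      using arg_cong[OF skew[of i], of "\<lambda>M. M $ l $ j"] by (simp add: transpose_def)
  qed
  then have "G x ** D i = 0" by (simp add: vec_eq_iff)
  then have "inv_G x ** (G x ** D i) = 0" by (simp add: mm.zero_right)
  then show ?thesis by (simp add: matrix_mul_assoc G_inv_G[OF assms(1)] D_def)
qed

end

text \<open>By \<open>G_pullback\<close> the map is a local isometry; that its Jacobian is
  invertible follows, since G is.\<close>

locale coordinate_change =
  src: metric_chart S G + tgt: metric_chart S' G'
  for S S' :: "(real^'n::finite) set" and G G' :: "real^'n \<Rightarrow> real^'n^'n" +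
  fixes \<phi> :: "real^'n \<Rightarrow> real^'n"
  assumes smooth_phi: "smooth_on S \<phi>" and phi_S: "\<phi> ` S \<subseteq> S'"
    and G_pullback: "x \<in> S \<Longrightarrow>
      G x $ i $ j = (\<Sum>p\<in>UNIV. \<Sum>q\<in>UNIV. pd i \<phi> x $ p * pd j \<phi> x $ q * G' (\<phi> x) $ p $ q)"
begin

definition jac :: "real^'n \<Rightarrow> real^'n^'n" where "jac x = (\<chi> p i. pd i \<phi> x $ p)"

lemma smooth_jac: "smooth_on S jac"
proof (intro smooth_on_vec[OF src.open_S])
  show "smooth_on S (\<lambda>x. jac x $ p $ i)" for p i
    unfolding jac_def by (simp add: smooth_on_nth[OF src.open_S smooth_on_dir_deriv[OF smooth_phi]])
qed

lemma G_jac: assumes "x \<in> S" shows "G x = transpose (jac x) ** G' (\<phi> x) ** jac x"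
proof -
  have "(transpose (jac x) ** G' (\<phi> x) ** jac x) $ i $ j = G x $ i $ j" for i j
    unfolding G_pullback[OF assms] matrix_matrix_mult_def transpose_def jac_def vec_lambda_beta
      sum_distrib_right
    by (subst sum.swap) (simp add: mult_ac)
  then show ?thesis by (simp add: vec_eq_iff)
qed

lemma phi_in: "x \<in> S \<Longrightarrow> \<phi> x \<in> S'" using phi_S by blast

text \<open>\<open>inv_G x ** G x = mat 1\<close> exhibits a left inverse of the Jacobian, which for
  a square matrix is also a right inverse.\<close>

lemma jac_inv_G_jac: assumes "x \<in> S" shows "jac x ** src.inv_G x ** transpose (jac x) = tgt.inv_G (\<phi> x)"
proof -
  have "(src.inv_G x ** transpose (jac x) ** G' (\<phi> x)) ** jac x = mat 1"
    using src.G_inv_G(2)[OF assms] unfolding G_jac[OF assms] by (simp add: matrix_mul_assoc)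
  then have "jac x ** (src.inv_G x ** transpose (jac x) ** G' (\<phi> x)) = mat 1"
    by (simp add: matrix_left_right_inverse)
  then have "(jac x ** src.inv_G x ** transpose (jac x)) ** (G' (\<phi> x) ** tgt.inv_G (\<phi> x)) = tgt.inv_G (\<phi> x)"
    by (simp add: matrix_mul_assoc)
  then show ?thesis using tgt.G_inv_G(1)[OF phi_in[OF assms]] by simp
qed

lemma pd_compose_phi:
  assumes "x \<in> S" "smooth_on S' u"
  shows "pd i (\<lambda>x. u (\<phi> x)) x = (\<Sum>r\<in>UNIV. jac x $ r $ i *\<^sub>R pd r u (\<phi> x))"
  unfolding jac_def vec_lambda_beta
  by (rule dir_deriv_compose) (use smooth_on_imp_differentiable assms smooth_phi phi_in in blast)+

lemma smooth_compose_phi: "smooth_on S' u \<Longrightarrow> smooth_on S (\<lambda>x. u (\<phi> x))"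
  by (rule smooth_on_compose[OF src.open_S tgt.open_S phi_S smooth_phi])

lemma pd_jac_sym: assumes "x \<in> S" shows "pd i jac x $ p $ j = pd j jac x $ p $ i"
proof -
  have "pd i jac x $ p $ j = pd i (pd j \<phi>) x $ p" for i j
    using src.pd_nth2[OF assms smooth_jac, of i p j]
      src.pd_nth[OF assms smooth_on_dir_deriv[OF smooth_phi], of i _ p]
    by (simp add: jac_def)
  then show ?thesis using src.pd_commute[OF assms smooth_phi, of i j] by simp
qed

text \<open>Connection matrix, in direction i, of the connection of \<open>G'\<close> pulled back
  along the map.\<close>

definition pulled_back_conn :: "'n \<Rightarrow> real^'n \<Rightarrow> real^'n^'n" where
  "pulled_back_conn i x = (\<Sum>r\<in>UNIV. jac x $ r $ i *\<^sub>R tgt.\<Gamma> r (\<phi> x))"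

text \<open>The transformation law of Christoffel symbols: \<open>jac\<^sup>-\<^sup>1\<close> times the right-hand side is torsion free
  and metric.\<close>

lemma jac_Gamma: assumes "x \<in> S"
  shows "jac x ** src.\<Gamma> i x = pd i jac x + pulled_back_conn i x ** jac x"
proof -
  define K where "K = src.inv_G x ** transpose (jac x) ** G' (\<phi> x)"
  have KJ: "K ** jac x = mat 1"
    using src.G_inv_G(2)[OF assms] unfolding G_jac[OF assms] K_def by (simp add: matrix_mul_assoc)
  then have JK: "jac x ** K = mat 1" by (simp add: matrix_left_right_inverse)
  define M where "M i = pd i jac x + pulled_back_conn i x ** jac x" for i
  define N where "N i = K ** M i" for i
  have JN: "jac x ** N i = M i" for i by (simp add: N_def matrix_mul_assoc JK)
  have dG': "pd i (\<lambda>x. G' (\<phi> x)) x = G' (\<phi> x) ** pulled_back_conn i x + transpose (pulled_back_conn i x) ** G' (\<phi> x)" for i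
  proof -
    have "pd i (\<lambda>x. G' (\<phi> x)) x = (\<Sum>r\<in>UNIV. jac x $ r $ i *\<^sub>R
        (G' (\<phi> x) ** tgt.\<Gamma> r (\<phi> x) + transpose (tgt.\<Gamma> r (\<phi> x)) ** G' (\<phi> x)))"
      unfolding pd_compose_phi[OF assms tgt.smooth_G] tgt.pd_G[OF phi_in[OF assms]] ..
    also have "\<dots> = G' (\<phi> x) ** pulled_back_conn i x + transpose (pulled_back_conn i x) ** G' (\<phi> x)"
      unfolding pulled_back_conn_def linear_sum[OF linear_transpose] mm.sum_left mm.sum_right
      by (simp add: linear_cmul[OF linear_transpose] mm.scaleR_left mm.scaleR_right
          scaleR_add_right sum.distrib)
    finally show ?thesis .
  qed
  have smG': "smooth_on S (\<lambda>x. G' (\<phi> x))" by (rule smooth_compose_phi[OF tgt.smooth_G])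
  have smT: "smooth_on S (\<lambda>x. transpose (jac x))"
    by (rule smooth_on_bounded_linear[OF src.open_S bounded_linear_transpose smooth_jac])
  have dG: "pd i G x = G x ** N i + transpose (N i) ** G x" for i
  proof -
    have "pd i G x = pd i (\<lambda>x. transpose (jac x) ** G' (\<phi> x) ** jac x) x"
      by (rule src.pd_cong[OF assms src.smooth_G G_jac])
    also have "\<dots> = transpose (jac x) ** G' (\<phi> x) ** pd i jac x
        + (transpose (jac x) ** pd i (\<lambda>x. G' (\<phi> x)) x + transpose (pd i jac x) ** G' (\<phi> x)) ** jac x"
      by (simp add: src.pd_rules(5,7)[OF assms] smooth_jac smG' smT
          smooth_on_bilinear[OF src.open_S bounded_bilinear_matrix_mult])
    also have "\<dots> = transpose (jac x) ** G' (\<phi> x) ** M i + transpose (M i) ** G' (\<phi> x) ** jac x"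
      unfolding dG' M_def by (simp add: mat_simps algebra_simps)
    also have "\<dots> = G x ** N i + transpose (N i) ** G x"
      unfolding G_jac[OF assms] JN[symmetric]
      by (simp add: matrix_transpose_mul matrix_mul_assoc)
    finally show ?thesis .
  qed
  \<comment> \<open>Torsion freeness: the second derivatives of the map commute, and the Christoffel
    symbols of \<open>G'\<close> are symmetric.\<close>
  have M_sym: "M i $ l $ j = M j $ l $ i" for i l j
  proof -
    have "(pulled_back_conn i x ** jac x) $ l $ j = (pulled_back_conn j x ** jac x) $ l $ i" for i j
    proof -
      have *: "(pulled_back_conn i x ** jac x) $ l $ j
          = (\<Sum>q\<in>UNIV. \<Sum>r\<in>UNIV. jac x $ r $ i * tgt.\<Gamma> r (\<phi> x) $ l $ q * jac x $ q $ j)" for i j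
        by (simp add: matrix_matrix_mult_def pulled_back_conn_def sum_distrib_right)
      show ?thesis
        unfolding * by (subst sum.swap)
          (simp add: tgt.Gamma_sym[OF phi_in[OF assms], of _ l] mult_ac)
    qed
    then show ?thesis using pd_jac_sym[OF assms, of i l j] by (simp add: M_def)
  qed
  have "N i $ l $ j = N j $ l $ i" for i l j
    by (simp add: N_def matrix_matrix_mult_def M_sym[of i _ j])
  from src.Gamma_unique[OF assms dG this] have "N i = src.\<Gamma> i x" .
  then show ?thesis using JN[of i] by (simp add: M_def)
qed

text \<open>The derivative of the Jacobian produced by the chain rule cancels against the
  inhomogeneous term in the transformation of \<open>\<Gamma>\<close>.\<close>

lemma hessian_pullback:
  assumes "x \<in> S" "smooth_on S' u"
  shows "hessian_coeff G (\<lambda>x. u (\<phi> x)) i j x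
    = (\<Sum>r\<in>UNIV. \<Sum>q\<in>UNIV. jac x $ r $ i * jac x $ q $ j * hessian_coeff G' u r q (\<phi> x))"
proof -
  let ?du = "\<lambda>x. differential u (\<phi> x)"
  have smd: "smooth_on S ?du" by (rule smooth_compose_phi[OF tgt.smooth_differential[OF assms(2)]])
  have smT: "smooth_on S (\<lambda>x. transpose (jac x))"
    by (rule smooth_on_bounded_linear[OF src.open_S bounded_linear_transpose smooth_jac])
  have d: "differential (\<lambda>x. u (\<phi> x)) x = transpose (jac x) *v ?du x" if "x \<in> S" for x
    by (simp add: vec_eq_iff differential_def matrix_vector_mult_def pd_compose_phi[OF that assms(2)]
        del: transpose_matrix_vector) (simp add: transpose_def)
  have "pd i (differential (\<lambda>x. u (\<phi> x))) x = pd i (\<lambda>x. transpose (jac x) *v ?du x) x"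
    by (rule src.pd_cong[OF assms(1) src.smooth_differential[OF smooth_compose_phi[OF assms(2)]] d])
  also have "\<dots> = transpose (jac x) *v pd i ?du x + transpose (pd i jac x) *v ?du x"
    by (simp add: src.pd_rules(6,7)[OF assms(1)] smT smd smooth_jac del: transpose_matrix_vector)
  also have "pd i ?du x = (\<Sum>r\<in>UNIV. jac x $ r $ i *\<^sub>R pd r (differential u) (\<phi> x))"
    by (rule pd_compose_phi[OF assms(1) tgt.smooth_differential[OF assms(2)]])
  finally have 1: "pd i (differential (\<lambda>x. u (\<phi> x))) x = transpose (jac x) *v
      (\<Sum>r\<in>UNIV. jac x $ r $ i *\<^sub>R pd r (differential u) (\<phi> x)) + transpose (pd i jac x) *v ?du x" .
  have 2: "transpose (src.\<Gamma> i x) *v differential (\<lambda>x. u (\<phi> x)) x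
      = transpose (pd i jac x) *v ?du x + transpose (jac x) *v (transpose (pulled_back_conn i x) *v ?du x)"
  proof -
    have "transpose (src.\<Gamma> i x) *v differential (\<lambda>x. u (\<phi> x)) x = transpose (jac x ** src.\<Gamma> i x) *v ?du x"
      unfolding d[OF assms(1)] matrix_transpose_mul matrix_vector_mul_assoc ..
    then show ?thesis
      unfolding jac_Gamma[OF assms(1)] linear_add[OF linear_transpose] matrix_transpose_mul mv.add_left
        matrix_vector_mul_assoc .
  qed
  have 3: "transpose (pulled_back_conn i x) *v ?du x
      = (\<Sum>r\<in>UNIV. jac x $ r $ i *\<^sub>R (transpose (tgt.\<Gamma> r (\<phi> x)) *v ?du x))"
    unfolding pulled_back_conn_def linear_sum[OF linear_transpose] linear_cmul[OF linear_transpose] mv.sum_left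
      mv.scaleR_left ..
  have "pd i (differential (\<lambda>x. u (\<phi> x))) x - transpose (src.\<Gamma> i x) *v differential (\<lambda>x. u (\<phi> x)) x
    = transpose (jac x) *v (\<Sum>r\<in>UNIV. jac x $ r $ i *\<^sub>R
        (pd r (differential u) (\<phi> x) - transpose (tgt.\<Gamma> r (\<phi> x)) *v ?du x))"
    unfolding 1 2 3
    by (simp add: scaleR_diff_right sum_subtractf mv.diff_right del: transpose_matrix_vector)
  then have "hessian_coeff G (\<lambda>x. u (\<phi> x)) i j x = (transpose (jac x) *v (\<Sum>r\<in>UNIV. jac x $ r $ i *\<^sub>R
        (pd r (differential u) (\<phi> x) - transpose (tgt.\<Gamma> r (\<phi> x)) *v ?du x))) $ j"
    using src.hessian_row[OF assms(1) smooth_compose_phi[OF assms(2)], of i j] by simp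
  also have "\<dots> = (\<Sum>q\<in>UNIV. \<Sum>r\<in>UNIV. jac x $ q $ j * (jac x $ r $ i * hessian_coeff G' u r q (\<phi> x)))"
    unfolding matrix_vector_mult_def[of "transpose (jac x)"] tgt.hessian_row[OF phi_in[OF assms(1)] assms(2), symmetric]
    by (simp add: transpose_def sum_distrib_left del: transpose_matrix_vector)
  finally show ?thesis by (subst sum.swap) (simp add: mult_ac)
qed

text \<open>By cyclicity the Jacobians move from the Hessian to the inverse metric, where
  \<open>jac_inv_G_jac\<close> absorbs them.\<close>

lemma laplacian_pullback:
  assumes "x \<in> S" "smooth_on S' u"
  shows "(\<Sum>i\<in>UNIV. \<Sum>j\<in>UNIV. src.inv_G x $ i $ j * hessian_coeff G (\<lambda>x. u (\<phi> x)) i j x)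
    = (\<Sum>r\<in>UNIV. \<Sum>q\<in>UNIV. tgt.inv_G (\<phi> x) $ r $ q * hessian_coeff G' u r q (\<phi> x))"
proof -
  define A where "A = (\<chi> i j. hessian_coeff G (\<lambda>x. u (\<phi> x)) i j x)"
  define A' where "A' = (\<chi> r q. hessian_coeff G' u r q (\<phi> x))"
  have A: "A = transpose (jac x) ** A' ** jac x"
  proof -
    have "(transpose (jac x) ** A' ** jac x) $ i $ j = A $ i $ j" for i j
      unfolding A_def vec_lambda_beta hessian_pullback[OF assms] matrix_matrix_mult_def transpose_def
        A'_def sum_distrib_right
      by (subst sum.swap) (simp add: mult_ac)
    then show ?thesis by (simp add: vec_eq_iff)
  qed
  have tr: "trace (P ** Q) = (\<Sum>i\<in>UNIV. \<Sum>j\<in>UNIV. P $ i $ j * Q $ j $ i)" for P Q :: "real^'n^'n"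
    by (simp add: trace_def matrix_matrix_mult_def)
  have "trace (src.inv_G x ** A) = trace (jac x ** (src.inv_G x ** transpose (jac x) ** A'))"
    unfolding A by (subst trace_mul_sym) (simp add: matrix_mul_assoc)
  also have "\<dots> = trace (tgt.inv_G (\<phi> x) ** A')"
    unfolding jac_inv_G_jac[OF assms(1), symmetric] by (simp add: matrix_mul_assoc)
  moreover have "A $ j $ i = hessian_coeff G (\<lambda>x. u (\<phi> x)) i j x" for i j
    by (simp add: A_def src.hessian_coeff_sym[OF assms(1) smooth_compose_phi[OF assms(2)], of j])
  moreover have "A' $ q $ r = hessian_coeff G' u r q (\<phi> x)" for r q
    by (simp add: A'_def tgt.hessian_coeff_sym[OF phi_in[OF assms(1)] assms(2), of q])
  ultimately show ?thesis by (simp add: tr)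
qed

end

section \<open>From charts to the manifold\<close>

lemma chart_inv_map: "is_chart X c \<Longrightarrow> p \<in> chart_dom c \<Longrightarrow> chart_inv c (chart_map c p) = p"
  unfolding is_chart_def chart_inv_def
  by (auto simp: homeomorphic_eq_everything_map intro!: inv_into_f_f dest!: openin_subset
      elim!: inj_on_subset)

lemma chart_map_inv: "x \<in> chart_img c \<Longrightarrow> chart_map c (chart_inv c x) = x"
  and chart_inv_dom: "x \<in> chart_img c \<Longrightarrow> chart_inv c x \<in> chart_dom c"
  unfolding chart_inv_def by (auto simp: f_inv_into_f inv_into_into)

lemma open_chart_image:
  assumes "is_chart X c" "openin X U"
  shows "open (chart_map c ` (chart_dom c \<inter> U))"
proof -
  have h: "homeomorphic_map (subtopology X (chart_dom c)) (top_of_set (chart_img c)) (chart_map c)"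
    and o: "open (chart_img c)"
    using assms(1) by (auto simp: is_chart_def)
  have "openin (subtopology X (chart_dom c)) (chart_dom c \<inter> U)"
    using assms(2) by (simp add: openin_subtopology_Int2)
  then have "openin (top_of_set (chart_img c)) (chart_map c ` (chart_dom c \<inter> U))"
    using h homeomorphic_imp_open_map open_map_def by blast
  then show ?thesis using o openin_open_eq by blast
qed

lemma openin_chart_vimage:
  assumes "is_chart X c" "open W"
  shows "openin X {q \<in> chart_dom c. chart_map c q \<in> W}"
proof -
  have "continuous_map (subtopology X (chart_dom c)) (top_of_set (chart_img c)) (chart_map c)"
    and o: "openin X (chart_dom c)"
    using assms(1) by (auto simp: is_chart_def homeomorphic_imp_continuous_map)
  then have "openin (subtopology X (chart_dom c))
      {q \<in> topspace (subtopology X (chart_dom c)). chart_map c q \<in> W}"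
    by (intro openin_continuous_map_preimage[of _ euclidean])
      (use assms(2) in \<open>simp_all add: continuous_map_in_subtopology\<close>)
  moreover have "topspace (subtopology X (chart_dom c)) = chart_dom c"
    using openin_subset[OF o] by auto
  ultimately have "openin (subtopology X (chart_dom c)) {q \<in> chart_dom c. chart_map c q \<in> W}"
    by (simp only:)
  then show ?thesis unfolding openin_open_subtopology[OF o] by blast
qed

section \<open>Tangent vectors of a manifold\<close>

locale manifold =
  fixes X :: "'m topology" and A :: "('m, 'n::finite) chart set"
  assumes manifold: "smooth_manifold X A"
begin

lemma chart: "c \<in> A \<Longrightarrow> is_chart X c"
  and transition: "c \<in> A \<Longrightarrow> d \<in> A \<Longrightarrow>
    smooth_on (chart_map c ` (chart_dom c \<inter> chart_dom d)) (chart_map d \<circ> chart_inv c)"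
  and covered: "p \<in> topspace X \<longleftrightarrow> (\<exists>c\<in>A. p \<in> chart_dom c)"
  using manifold by (auto simp: smooth_manifold_def)

lemma open_img: "c \<in> A \<Longrightarrow> open (chart_img c)"
  and open_dom: "c \<in> A \<Longrightarrow> openin X (chart_dom c)"
  using chart by (auto simp: is_chart_def)

lemma smooth_nearE:
  assumes "smooth_near X A p h" "c \<in> A" "p \<in> chart_dom c"
  obtains W where "open W" "chart_map c p \<in> W" "W \<subseteq> chart_img c" "smooth_on W (h \<circ> chart_inv c)"
proof -
  obtain U where U: "openin X U" "p \<in> U" "smooth_on (chart_map c ` (chart_dom c \<inter> U)) (h \<circ> chart_inv c)"
    using assms by (auto simp: smooth_near_def)
  show ?thesis
    by (rule that[OF open_chart_image[OF chart[OF assms(2)] U(1)]]) (use U assms in auto)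
qed

lemma smooth_near_differentiable:
  assumes "smooth_near X A p h" "c \<in> A" "p \<in> chart_dom c"
  shows "(h \<circ> chart_inv c) differentiable at (chart_map c p)"
  by (rule smooth_nearE[OF assms]) (rule smooth_on_imp_differentiable)

lemma smooth_near_combine:
  assumes "smooth_near X A p h" "smooth_near X A p k"
    and "\<And>S h k. open S \<Longrightarrow> smooth_on S h \<Longrightarrow> smooth_on S k \<Longrightarrow>
      smooth_on S (\<lambda>x::real^'n. F (h x) (k x) :: real)"
  shows "smooth_near X A p (\<lambda>q. F (h q) (k q))"
proof -
  obtain U U' where U: "openin X U" "p \<in> U" "openin X U'" "p \<in> U'"
    "\<And>c. c \<in> A \<Longrightarrow> smooth_on (chart_map c ` (chart_dom c \<inter> U)) (h \<circ> chart_inv c)"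
    "\<And>c. c \<in> A \<Longrightarrow> smooth_on (chart_map c ` (chart_dom c \<inter> U')) (k \<circ> chart_inv c)"
    using assms(1,2) unfolding smooth_near_def by blast
  have UU: "openin X (U \<inter> U')" using U by blast
  have "smooth_on (chart_map c ` (chart_dom c \<inter> (U \<inter> U'))) ((\<lambda>q. F (h q) (k q)) \<circ> chart_inv c)"
    if "c \<in> A" for c
  proof -
    have "smooth_on (chart_map c ` (chart_dom c \<inter> (U \<inter> U'))) (h \<circ> chart_inv c)"
      "smooth_on (chart_map c ` (chart_dom c \<inter> (U \<inter> U'))) (k \<circ> chart_inv c)"
      by (rule smooth_on_subset[OF U(5)[OF that]] smooth_on_subset[OF U(6)[OF that]]; auto)+
    from assms(3)[OF open_chart_image[OF chart[OF that] UU] this] show ?thesis by (simp add: o_def)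
  qed
  then show ?thesis using UU U unfolding smooth_near_def by blast
qed

lemma smooth_near_linear:
  "smooth_near X A p h \<Longrightarrow> smooth_near X A p k \<Longrightarrow> smooth_near X A p (\<lambda>q. a * h q + b * k q)"
  by (rule smooth_near_combine[of p h k "\<lambda>u v. a * u + b * v"])
    (auto intro!: smooth_on_add smooth_on_mult)

lemma smooth_near_mult:
  "smooth_near X A p h \<Longrightarrow> smooth_near X A p k \<Longrightarrow> smooth_near X A p (\<lambda>q. h q * k q)"
  by (rule smooth_near_combine) (auto intro!: smooth_on_mult)

text \<open>The chart domain serves as the neighbourhood, since the coordinate map is arbitrary
  outside it. These are the test functions that separate the coordinate vectors.\<close>

lemma smooth_near_coordinate:
  assumes "c \<in> A" "p \<in> chart_dom c"
  shows "smooth_near X A p (\<lambda>q. chart_map c q $ i)"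
proof -
  have "smooth_on (chart_map d ` (chart_dom d \<inter> chart_dom c)) ((\<lambda>q. chart_map c q $ i) \<circ> chart_inv d)"
    if "d \<in> A" for d
    using smooth_on_nth[OF open_chart_image[OF chart[OF that] open_dom[OF assms(1)]]
        transition[OF that assms(1)], of i]
    by (simp add: o_def)
  then show ?thesis
    unfolding smooth_near_def using assms open_dom by blast
qed

lemma coord_vec_apply:
  "smooth_near X A p h \<Longrightarrow> coord_vec X A c p i h = pd i (h \<circ> chart_inv c) (chart_map c p)"
  by (simp add: coord_vec_def partial_deriv_eq_pd)

lemma coord_vec_tangent:
  assumes "c \<in> A" "p \<in> chart_dom c"
  shows "coord_vec X A c p i \<in> tangent_space X A p"
proof -
  have cancel: "chart_inv c (chart_map c p) = p" by (rule chart_inv_map[OF chart[OF assms(1)] assms(2)])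
  have dif: "(h \<circ> chart_inv c) differentiable at (chart_map c p)" if "smooth_near X A p h" for h
    by (rule smooth_near_differentiable[OF that assms])
  have 1: "pd i ((\<lambda>q. a * h q + b * k q) \<circ> chart_inv c) (chart_map c p)
      = a * pd i (h \<circ> chart_inv c) (chart_map c p) + b * pd i (k \<circ> chart_inv c) (chart_map c p)"
    if "smooth_near X A p h" "smooth_near X A p k" for h k a b
    using dif[OF that(1)] dif[OF that(2)] unfolding o_def
    by (simp add: dir_deriv_add dir_deriv_mult)
  have 2: "pd i ((\<lambda>q. h q * k q) \<circ> chart_inv c) (chart_map c p)
      = pd i (h \<circ> chart_inv c) (chart_map c p) * k p + h p * pd i (k \<circ> chart_inv c) (chart_map c p)"
    if "smooth_near X A p h" "smooth_near X A p k" for h k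
    using dif[OF that(1)] dif[OF that(2)] unfolding o_def
    by (simp add: dir_deriv_mult cancel)
  show ?thesis
    unfolding tangent_space_def
    using 1 2 by (simp add: coord_vec_apply smooth_near_linear smooth_near_mult) (simp add: coord_vec_def)
qed

lemma tangent_space_linear:
  assumes "u \<in> tangent_space X A p" "v \<in> tangent_space X A p"
  shows "(\<lambda>h. r * u h + s * v h) \<in> tangent_space X A p"
  using assms unfolding tangent_space_def by (auto simp: algebra_simps)

lemma zero_tangent: "(\<lambda>h. 0) \<in> tangent_space X A p"
  by (simp add: tangent_space_def)

lemma tangent_space_sum:
  assumes "\<And>i. i \<in> I \<Longrightarrow> e i \<in> tangent_space X A p" "finite I"
  shows "(\<lambda>h. \<Sum>i\<in>I. v i * e i h) \<in> tangent_space X A p"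
  using assms(2,1)
  by (induction I) (use tangent_space_linear[of _ p _ _ 1] zero_tangent in auto)

lemma inner_product_sum:
  assumes b: "inner_product_on (tangent_space X A p) b" and "finite I" "w \<in> tangent_space X A p"
    and e: "\<And>i. i \<in> I \<Longrightarrow> e i \<in> tangent_space X A p"
  shows "b (\<lambda>h. \<Sum>i\<in>I. v i * e i h) w = (\<Sum>i\<in>I. v i * b (e i) w)"
proof -
  have lin: "b (\<lambda>h. r * u h + s * v h) w = r * b u w + s * b v w"
    if "u \<in> tangent_space X A p" "v \<in> tangent_space X A p" for u v r s
    using b that assms(3) by (auto simp: inner_product_on_def)
  show ?thesis
    using assms(2) e
  proof (induction I)
    case empty
    then show ?case using lin[OF zero_tangent zero_tangent, of 0 0] by simp
  next
    case (insert i I)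
    then show ?case
      using lin[of "e i" "\<lambda>h. \<Sum>i\<in>I. v i * e i h" "v i" 1] tangent_space_sum[of I e p v] by simp
  qed
qed

text \<open>Applied to the k-th coordinate function, the combination returns
  \<open>v $ k\<close>.\<close>

lemma coord_vec_independent:
  assumes "c \<in> A" "p \<in> chart_dom c" "v \<noteq> 0"
  shows "(\<lambda>h. \<Sum>i\<in>UNIV. v $ i * coord_vec X A c p i h) \<noteq> (\<lambda>h. 0)"
proof -
  obtain k where k: "v $ k \<noteq> 0" using assms(3) by (auto simp: vec_eq_iff)
  have d: "pd i ((\<lambda>q. chart_map c q $ k) \<circ> chart_inv c) (chart_map c p) = (if i = k then 1 else 0)" for i
  proof -
    have "pd i ((\<lambda>q. chart_map c q $ k) \<circ> chart_inv c) (chart_map c p)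
        = pd i (\<lambda>x. x $ k) (chart_map c p)"
      by (rule dir_deriv_cong[OF open_img[OF assms(1)]])
        (use assms smooth_near_differentiable[OF smooth_near_coordinate] in \<open>auto simp: chart_map_inv\<close>)
    then show ?thesis
      using dir_deriv_nth[of "\<lambda>x. x" "chart_map c p" "axis i 1" k]
      by (simp add: dir_deriv_eqI[OF has_derivative_ident] axis_def)
  qed
  have "(\<Sum>i\<in>UNIV. v $ i * coord_vec X A c p i (\<lambda>q. chart_map c q $ k)) = v $ k"
    unfolding coord_vec_apply[OF smooth_near_coordinate[OF assms(1,2)]] d
    by (simp add: if_distrib cong: if_cong)
  then show ?thesis using k by metis
qed

lemma coord_vec_change:
  assumes "c \<in> A" "d \<in> A" "p \<in> chart_dom c" "p \<in> chart_dom d"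
  shows "coord_vec X A c p i
    = (\<lambda>h. \<Sum>k\<in>UNIV. pd i (chart_map d \<circ> chart_inv c) (chart_map c p) $ k * coord_vec X A d p k h)"
proof
  fix h
  let ?\<phi> = "chart_map d \<circ> chart_inv c"
  have cancel: "chart_inv c (chart_map c p) = p" by (rule chart_inv_map[OF chart[OF assms(1)] assms(3)])
  show "coord_vec X A c p i h = (\<Sum>k\<in>UNIV. pd i ?\<phi> (chart_map c p) $ k * coord_vec X A d p k h)"
  \<comment> \<open>On functions that are not smooth near p both sides take the default value
    0.\<close>
  proof (cases "smooth_near X A p h")
    case False
    then show ?thesis by (simp add: coord_vec_def)
  next
    case True
    let ?W = "chart_map c ` (chart_dom c \<inter> chart_dom d)"
    have W: "open ?W" "chart_map c p \<in> ?W"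
      using open_chart_image[OF chart open_dom] assms by auto
    have "pd i (h \<circ> chart_inv c) (chart_map c p) = pd i (\<lambda>x. (h \<circ> chart_inv d) (?\<phi> x)) (chart_map c p)"
    proof (rule dir_deriv_cong[OF W smooth_near_differentiable[OF True assms(1,3)]])
      fix y assume "y \<in> ?W"
      then show "(h \<circ> chart_inv c) y = (h \<circ> chart_inv d) (?\<phi> y)"
        by (auto simp: chart_inv_map[OF chart[OF assms(1)]] chart_inv_map[OF chart[OF assms(2)]])
    qed
    also have "\<dots> = (\<Sum>k\<in>UNIV. pd i ?\<phi> (chart_map c p) $ k *\<^sub>R pd k (h \<circ> chart_inv d) (?\<phi> (chart_map c p)))"
    proof (rule dir_deriv_compose)
      show "?\<phi> differentiable at (chart_map c p)"
        by (rule smooth_on_imp_differentiable[OF transition[OF assms(1,2)] W(2)])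
      show "(h \<circ> chart_inv d) differentiable at (?\<phi> (chart_map c p))"
        using smooth_near_differentiable[OF True assms(2,4)] by (simp add: cancel)
    qed
    finally show ?thesis by (simp add: coord_vec_apply[OF True] cancel)
  qed
qed

end

section \<open>The global argument\<close>

locale soliton = manifold X A for X :: "'m topology" and A :: "('m, 'n::finite) chart set" +
  fixes g :: "'m \<Rightarrow> 'm tangent \<Rightarrow> 'm tangent \<Rightarrow> real" and f :: "'m \<Rightarrow> real"
  assumes metric: "riemannian_metric X A g" and smooth_f: "smooth_function A f"
    and soliton: "ricci_plus_hessian_zero X A g f"
begin

abbreviation "mc \<equiv> metric_coeff X A g"

lemma inner_g: "c \<in> A \<Longrightarrow> p \<in> chart_dom c \<Longrightarrow> inner_product_on (tangent_space X A p) (g p)"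
  using metric covered by (auto simp: riemannian_metric_def)

text \<open>The matrix form at v is g on the tangent vector with components v, which is nonzero by
  \<open>coord_vec_independent\<close>; this transfers positivity to the matrix.\<close>

lemma soliton_chart:
  assumes "c \<in> A"
  shows "soliton_chart (chart_img c) (mc c) (f \<circ> chart_inv c)"
proof
  show "open (chart_img c)" by (rule open_img[OF assms])
  show "smooth_on (chart_img c) (\<lambda>x. mc c x $ i $ j)" for i j
    using metric assms by (simp add: riemannian_metric_def)
  show "smooth_on (chart_img c) (f \<circ> chart_inv c)"
    using smooth_f assms by (simp add: smooth_function_def)
  show "ricci_coeff (mc c) i j x + hessian_coeff (mc c) (f \<circ> chart_inv c) i j x = 0"
    if "x \<in> chart_img c" for x i j
    using soliton assms that unfolding ricci_plus_hessian_zero_def by blast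
  fix x assume x: "x \<in> chart_img c"
  define p where "p = chart_inv c x"
  have p: "p \<in> chart_dom c" using chart_inv_dom[OF x] by (simp add: p_def)
  let ?e = "coord_vec X A c p"
  note e = coord_vec_tangent[OF assms p]
  have ip: "inner_product_on (tangent_space X A p) (g p)" by (rule inner_g[OF assms p])
  have G: "mc c x $ i $ j = g p (?e i) (?e j)" for i j by (simp add: metric_coeff_def p_def)
  have sym: "g p u w = g p w u" if "u \<in> tangent_space X A p" "w \<in> tangent_space X A p" for u w
    using ip that by (auto simp: inner_product_on_def)
  show "mc c x $ i $ j = mc c x $ j $ i" for i j
    unfolding G by (rule sym[OF e e])
  fix v :: "real^'n" assume v: "v \<noteq> 0"
  define w where "w = (\<lambda>h. \<Sum>i\<in>UNIV. v $ i * ?e i h)"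
  have w: "w \<in> tangent_space X A p" unfolding w_def by (rule tangent_space_sum[OF e finite])
  have gew: "g p (?e i) w = (\<Sum>j\<in>UNIV. mc c x $ i $ j * v $ j)" for i
    unfolding sym[OF e w] unfolding w_def inner_product_sum[OF ip finite e e]
    by (simp add: G sym[OF e e, of _ i] mult.commute)
  have "g p w w = (\<Sum>i\<in>UNIV. v $ i * g p (?e i) w)"
    by (subst (1) w_def) (rule inner_product_sum[OF ip finite w e])
  also have "\<dots> = v \<bullet> (mc c x *v v)"
    by (simp add: gew inner_vec_def matrix_vector_mult_def)
  finally have "g p w w = v \<bullet> (mc c x *v v)" .
  moreover have "w \<noteq> (\<lambda>h. 0)" unfolding w_def by (rule coord_vec_independent[OF assms p v])
  then have "g p w w > 0" using ip w unfolding inner_product_on_def by blast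
  ultimately show "0 < v \<bullet> (mc c x *v v)" by simp
qed

text \<open>In both charts R = -\<Delta>f, so the claim reduces to \<open>laplacian_pullback\<close>
  on the overlap.\<close>

lemma scalar_coeff_chart_change:
  assumes "c \<in> A" "d \<in> A" "p \<in> chart_dom c" "p \<in> chart_dom d"
  shows "scalar_coeff (mc c) (chart_map c p) = scalar_coeff (mc d) (chart_map d p)"
proof -
  interpret C: soliton_chart "chart_img c" "mc c" "f \<circ> chart_inv c" by (rule soliton_chart[OF assms(1)])
  interpret D: soliton_chart "chart_img d" "mc d" "f \<circ> chart_inv d" by (rule soliton_chart[OF assms(2)])
  let ?S = "chart_map c ` (chart_dom c \<inter> chart_dom d)"
  let ?\<phi> = "chart_map d \<circ> chart_inv c"
  have S: "open ?S" "?S \<subseteq> chart_img c" using open_chart_image[OF chart open_dom] assms by auto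
  have cancel: "chart_inv c (chart_map c q) = q" if "q \<in> chart_dom c" for q
    by (rule chart_inv_map[OF chart[OF assms(1)] that])
  have cancel': "chart_inv d (chart_map d q) = q" if "q \<in> chart_dom d" for q
    by (rule chart_inv_map[OF chart[OF assms(2)] that])
  interpret coordinate_change ?S "chart_img d" "mc c" "mc d" ?\<phi>
  proof
    show "open ?S" by (rule S)
    show "smooth_on ?S (\<lambda>x. mc c x $ i $ j)" for i j
      by (rule smooth_on_subset[OF C.smooth_entries S(2)])
    show "mc c x $ i $ j = mc c x $ j $ i" if "x \<in> ?S" for x i j
      using C.G_sym S that by blast
    show "0 < v \<bullet> (mc c x *v v)" if "x \<in> ?S" "v \<noteq> 0" for x v
      using C.G_pos S that by blast
    show "smooth_on ?S ?\<phi>" by (rule transition[OF assms(1,2)])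
    show "?\<phi> ` ?S \<subseteq> chart_img d" by (auto simp: cancel)
    fix x i j assume "x \<in> ?S"
    then obtain q where q: "q \<in> chart_dom c" "q \<in> chart_dom d" "x = chart_map c q" by auto
    let ?e = "coord_vec X A d q"
    note e = coord_vec_tangent[OF assms(2) q(2)]
    have ip: "inner_product_on (tangent_space X A q) (g q)" by (rule inner_g[OF assms(1) q(1)])
    have sym: "g q u w = g q w u" if "u \<in> tangent_space X A q" "w \<in> tangent_space X A q" for u w
      using ip that by (auto simp: inner_product_on_def)
    have e': "(\<lambda>h. \<Sum>k\<in>UNIV. pd j ?\<phi> x $ k * ?e k h) \<in> tangent_space X A q" for j
      by (rule tangent_space_sum[OF e finite])
    have "mc c x $ i $ j = g q (\<lambda>h. \<Sum>k\<in>UNIV. pd i ?\<phi> x $ k * ?e k h) (\<lambda>h. \<Sum>k\<in>UNIV. pd j ?\<phi> x $ k * ?e k h)"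
      by (simp add: metric_coeff_def q(3) cancel[OF q(1)] coord_vec_change[OF assms(1,2) q(1,2)])
    also have "\<dots> = (\<Sum>k\<in>UNIV. pd i ?\<phi> x $ k * g q (?e k) (\<lambda>h. \<Sum>k\<in>UNIV. pd j ?\<phi> x $ k * ?e k h))"
      by (rule inner_product_sum[OF ip finite e' e])
    also have "\<dots> = (\<Sum>p\<in>UNIV. pd i ?\<phi> x $ p * (\<Sum>r\<in>UNIV. pd j ?\<phi> x $ r * g q (?e r) (?e p)))"
      unfolding sym[OF e e'] inner_product_sum[OF ip finite e e] ..
    also have "\<dots> = (\<Sum>p\<in>UNIV. \<Sum>r\<in>UNIV. pd i ?\<phi> x $ p * pd j ?\<phi> x $ r * mc d (?\<phi> x) $ p $ r)"
      by (simp add: metric_coeff_def q(3) cancel[OF q(1)] cancel'[OF q(2)] sum_distrib_left mult.assoc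
          sym[OF e e])
    finally show "mc c x $ i $ j
        = (\<Sum>p\<in>UNIV. \<Sum>r\<in>UNIV. pd i ?\<phi> x $ p * pd j ?\<phi> x $ r * mc d (?\<phi> x) $ p $ r)" .
  qed
  define x where "x = chart_map c p"
  have x: "x \<in> ?S" using assms by (simp add: x_def)
  have phi: "?\<phi> x = chart_map d p" using assms by (simp add: x_def cancel)
  have ff: "(f \<circ> chart_inv c) y = (f \<circ> chart_inv d) (?\<phi> y)" if "y \<in> ?S" for y
    using that by (auto simp: cancel cancel')
  \<comment> \<open>The two expressions for f agree on the overlap only; since it is open, their
    derivatives at x agree too.\<close>
  have hess: "hessian_coeff (mc c) (f \<circ> chart_inv c) i j x
      = hessian_coeff (mc c) (\<lambda>y. (f \<circ> chart_inv d) (?\<phi> y)) i j x" for i j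
  proof -
    have sm: "smooth_on ?S (f \<circ> chart_inv c)" by (rule smooth_on_subset[OF C.smooth_f S(2)])
    have 1: "pd k (f \<circ> chart_inv c) y = pd k (\<lambda>y. (f \<circ> chart_inv d) (?\<phi> y)) y" if "y \<in> ?S" for k y
      by (rule src.pd_cong[OF that sm ff])
    have "pd i (pd j (f \<circ> chart_inv c)) x = pd i (pd j (\<lambda>y. (f \<circ> chart_inv d) (?\<phi> y))) x"
      by (rule src.pd_cong[OF x smooth_on_dir_deriv[OF sm] 1])
    then show ?thesis by (simp only: hessian_coeff_def partial_deriv_eq_pd 1[OF x])
  qed
  have "scalar_coeff (mc c) x = - (\<Sum>i\<in>UNIV. \<Sum>j\<in>UNIV. C.inv_G x $ i $ j
      * hessian_coeff (mc c) (\<lambda>y. (f \<circ> chart_inv d) (?\<phi> y)) i j x)"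
    using C.scalar_coeff_hessian[of x] S x hess by auto
  also have "\<dots> = scalar_coeff (mc d) (?\<phi> x)"
    using laplacian_pullback[OF x D.smooth_f] D.scalar_coeff_hessian[OF phi_in[OF x]]
    by (simp add: C.inv_G_def src.inv_G_def)
  finally show ?thesis unfolding phi by (simp add: x_def)
qed

lemma scalar_curvature_chart:
  assumes "c \<in> A" "p \<in> chart_dom c"
  shows "scalar_curvature X A g p = scalar_coeff (mc c) (chart_map c p)"
proof -
  have "(SOME c. c \<in> A \<and> p \<in> chart_dom c) \<in> A \<and> p \<in> chart_dom (SOME c. c \<in> A \<and> p \<in> chart_dom c)"
    by (rule someI[of _ c]) (use assms in blast)
  then show ?thesis
    unfolding scalar_curvature_def Let_def using scalar_coeff_chart_change assms by blast
qed

lemma ricci_flat_if_min: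
  assumes "connected_space X" "p \<in> topspace X"
    and min: "\<And>q. q \<in> topspace X \<Longrightarrow> scalar_curvature X A g p \<le> scalar_curvature X A g q"
  shows "ricci_flat X A g"
proof -
  define m where "m = scalar_curvature X A g p"
  define Z where "Z = {q \<in> topspace X. scalar_curvature X A g q = m}"
  have dom: "q \<in> topspace X" if "c \<in> A" "q \<in> chart_dom c" for c q using covered that by blast
  \<comment> \<open>Every point of Z, not only p, attains the global minimum m, so the local
    principle applies in a chart around each.\<close>
  have openZ: "\<exists>N. openin X N \<and> q \<in> N \<and> N \<subseteq> Z" if qZ: "q \<in> Z" for q
  proof -
    obtain c where c: "c \<in> A" "q \<in> chart_dom c" using qZ covered[of q] unfolding Z_def by blast
    interpret C: soliton_chart "chart_img c" "mc c" "f \<circ> chart_inv c" by (rule soliton_chart[OF c(1)])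
    have q: "scalar_coeff (mc c) (chart_map c q) = m"
      using qZ scalar_curvature_chart[OF c] by (simp add: Z_def)
    have ge: "scalar_coeff (mc c) (chart_map c q) \<le> scalar_coeff (mc c) x" if x: "x \<in> chart_img c" for x
    proof -
      obtain r where r: "r \<in> chart_dom c" "x = chart_map c r" using x by blast
      show ?thesis
        using min[OF dom[OF c(1) r(1)]] unfolding q r(2) scalar_curvature_chart[OF c(1) r(1)] m_def .
    qed
    have "chart_map c q \<in> chart_img c" using c(2) by blast
    from C.scalar_coeff_local_min[OF this ge, unfolded q]
    obtain e where e: "e > 0" "\<forall>x\<in>ball (chart_map c q) e. scalar_coeff (mc c) x = m"
      by blast
    have "{p \<in> chart_dom c. chart_map c p \<in> ball (chart_map c q) e} \<subseteq> Z"
      using e(2) by (auto simp: Z_def dom[OF c(1)] scalar_curvature_chart[OF c(1)])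
    moreover have "q \<in> {p \<in> chart_dom c. chart_map c p \<in> ball (chart_map c q) e}" using c(2) e(1) by simp
    ultimately show ?thesis using openin_chart_vimage[OF chart[OF c(1)] open_ball] by blast
  qed
  have closedZ: "\<exists>N. openin X N \<and> q \<in> N \<and> N \<subseteq> topspace X - Z" if qZ: "q \<in> topspace X - Z" for q
  proof -
    obtain c where c: "c \<in> A" "q \<in> chart_dom c" using qZ covered[of q] by blast
    interpret C: soliton_chart "chart_img c" "mc c" "f \<circ> chart_inv c" by (rule soliton_chart[OF c(1)])
    define W where "W = chart_img c \<inter> scalar_coeff (mc c) -` (- {m})"
    have "open W"
      unfolding W_def
      by (rule continuous_open_preimage[OF C.continuous_scalar_coeff C.open_S
            open_Compl[OF closed_singleton]])
    have "{p \<in> chart_dom c. chart_map c p \<in> W} \<subseteq> topspace X - Z"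
      by (auto simp: Z_def W_def dom[OF c(1)] scalar_curvature_chart[OF c(1)])
    moreover have "q \<in> {p \<in> chart_dom c. chart_map c p \<in> W}"
      using qZ c scalar_curvature_chart[OF c] by (auto simp: Z_def W_def)
    ultimately show ?thesis using openin_chart_vimage[OF chart[OF c(1)] \<open>open W\<close>] by blast
  qed
  have "openin X Z" using openZ openin_subopen by blast
  moreover have "closedin X Z"
    using closedZ openin_subopen[of X "topspace X - Z"] by (auto simp: closedin_def Z_def)
  moreover have "p \<in> Z" using assms(2) by (simp add: Z_def m_def)
  ultimately have "Z = topspace X"
    using assms(1) unfolding connected_space_clopen_in by blast
  have const: "scalar_coeff (mc c) x = m" if c: "c \<in> A" and x: "x \<in> chart_img c" for c x
  proof -
    obtain r where r: "r \<in> chart_dom c" "x = chart_map c r" using x by blast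
    then have "r \<in> Z" using \<open>Z = topspace X\<close> dom[OF c] by simp
    then show ?thesis using scalar_curvature_chart[OF c r(1)] r(2) by (simp add: Z_def)
  qed
  show ?thesis
    unfolding ricci_flat_def
    by (blast intro: soliton_chart.ricci_zero_if_scalar_constant[OF soliton_chart const])
qed

end

theorem theorem1p5:
  fixes X :: "'m topology" and A :: "('m, 'n::finite) chart set"
    and g :: "'m \<Rightarrow> 'm tangent \<Rightarrow> 'm tangent \<Rightarrow> real" and f :: "'m \<Rightarrow> real"
  assumes "steady_gradient_soliton X A g f"
  shows "((\<exists>p\<in>topspace X. \<forall>q\<in>topspace X. scalar_curvature X A g p \<le> scalar_curvature X A g q)
            \<longrightarrow> ricci_flat X A g)
       \<and> ((\<exists>k. \<forall>p\<in>topspace X. scalar_curvature X A g p = k) \<longrightarrow> ricci_flat X A g)"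
proof -
  interpret soliton X A g f
    using assms by unfold_locales (auto simp: steady_gradient_soliton_def)
  have min: "ricci_flat X A g"
    if "p \<in> topspace X" "\<forall>q\<in>topspace X. scalar_curvature X A g p \<le> scalar_curvature X A g q" for p
    using ricci_flat_if_min assms that by (auto simp: steady_gradient_soliton_def)
  moreover have "ricci_flat X A g" if "\<forall>p\<in>topspace X. scalar_curvature X A g p = k" for k
  \<comment> \<open>A constant attains its minimum only if there is a point; on an empty space all
    chart domains are empty and flatness is vacuous.\<close>
  proof (cases "topspace X = {}")
    case True
    then show ?thesis using covered by (auto simp: ricci_flat_def)
  next
    case False
    then show ?thesis using min that by fastforce
  qed
  ultimately show ?thesis by blast
qed

end
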